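(* Let $\theta,\varphi$ be two nonconstant inner functions on the unit disk, let $M$ be a Hilbert-Schmidt submodule of $H^2(\mathbb{D}^2)$, and let $M_{\theta,\varphi}=[C_{\theta,\varphi}M]$. Then for all $(a,b)\in\mathbb{D}^2$, $$\Sigma_0^{M_{\theta,\varphi}}(a,b)=\Sigma_0^M(\theta(a),\varphi(b)),\qquad \Sigma_1^{M_{\theta,\varphi}}(a,b)=\Sigma_1^M(\theta(a),\varphi(b)).$$
   Context: $\mathbb{D}$ is the open unit disk and $H^2(\mathbb{D}^2)$ the Hardy space over the bidisk. A submodule is a closed subspace of $H^2(\mathbb{D}^2)$ invariant under multiplication by $z$ and $w$. $[X]$ is the submodule generated by $X$, i.e. the norm closure of the linear span of $\mathbb{C}[z,w]\cdot X$. $C_{\theta,\varphi}f(z,w)=f(\theta(z),\varphi(w))$, a bounded operator on $H^2(\mathbb{D}^2)$. An inner function is a bounded analytic function on $\mathbb{D}$ whose boundary values have modulus 1 a.e. For a submodule $M$ and bounded analytic $\phi$ with $\phi M\subseteq M$, $R_\phi$ denotes multiplication by $\phi$ on $M$; $[A,B]=AB-BA$. $M$ is Hilbert-Schmidt if $[R_z^*,R_z][R_w^*,R_w]$ and $[R_z^*,R_w]$ are Hilbert-Schmidt operators. (If $M$ is Hilbert-Schmidt, then so is $M_{\theta,\varphi}$.) For $a\in\mathbb{D}$ let $\varphi_a(\zeta)=\frac{a-\zeta}{1-\bar a\zeta}$. For $(a,b)\in\mathbb{D}^2$ let $P_a,Q_b,P_a',Q_b'$ be the orthogonal projections from $M$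 onto $M\ominus(z-a)M$, $M\ominus(w-b)M$, $(z-a)(M\ominus(w-b)M)$, $(w-b)(M\ominus(z-a)M)$, respectively. The numerical invariant functions of a Hilbert-Schmidt submodule $M$ are $$\Sigma_0^M(a,b)=\|P_aQ_b\|_{H.S.}^2=\|[R_{\varphi_a(z)}^*,R_{\varphi_a(z)}][R_{\varphi_b(w)}^*,R_{\varphi_b(w)}]\|_{H.S.}^2,$$ $$\Sigma_1^M(a,b)=\|P_a'Q_b'\|_{H.S.}^2=\|[R_{\varphi_a(z)}^*,R_{\varphi_b(w)}]\|_{H.S.}^2 ,$$ where $\|\cdot\|_{H.S.}$ is the Hilbert-Schmidt norm.
   Formalization: Σ₁ is taken as the squared H.S. norm of [R*_{φ_a(z)}, R_{φ_b(w)}]; the form with P_a', Q_b' agrees with it only if z−a, w−b in their definitions are read as φ_a(z), φ_b(w), and read literally the claim fails. *)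

theory Defs
  imports "HOL-Complex_Analysis.Complex_Analysis"
begin

section \<open>Complex inner product spaces\<close>

text \<open>The library only has real inner product spaces. The class below adds a complex scalar
  multiplication and a sesquilinear inner product, linear in the first argument, whose real part
  is the given real inner product. In particular norm and topology are the usual ones.\<close>

class complex_inner = real_inner +
  fixes scaleC :: "complex \<Rightarrow> 'a \<Rightarrow> 'a"  (infixr "*\<^sub>C" 75)
    and cinner :: "'a \<Rightarrow> 'a \<Rightarrow> complex"
  assumes scaleC_add_right: "c *\<^sub>C (x + y) = c *\<^sub>C x + c *\<^sub>C y"
    and scaleC_add_left: "(c + d) *\<^sub>C x = c *\<^sub>C x + d *\<^sub>C x"
    and scaleC_scaleC: "c *\<^sub>C d *\<^sub>C x = (c * d) *\<^sub>C x"
    and scaleR_scaleC: "r *\<^sub>R x = complex_of_real r *\<^sub>C x"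
    and cinner_commute: "cinner x y = cnj (cinner y x)"
    and cinner_add_left: "cinner (x + y) z = cinner x z + cinner y z"
    and cinner_scaleC_left: "cinner (c *\<^sub>C x) y = c * cinner x y"
    and inner_eq_Re_cinner: "inner x y = Re (cinner x y)"

global_interpretation complex_vector: vector_space "scaleC :: complex \<Rightarrow> 'a \<Rightarrow> 'a::complex_inner"
proof
  fix x :: 'a
  show "1 *\<^sub>C x = x"
    using scaleR_scaleC[of 1 x] by simp
qed (simp_all add: scaleC_add_right scaleC_add_left scaleC_scaleC)

abbreviation csubspace :: "'a::complex_inner set \<Rightarrow> bool"
  where "csubspace \<equiv> module.subspace scaleC"

abbreviation cspan :: "'a::complex_inner set \<Rightarrow> 'a set"
  where "cspan \<equiv> module.span scaleC"

subsection \<open>Operators on a closed subspace\<close>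

text \<open>An operator on a closed subspace \<open>M\<close> is represented by a function on the ambient space of
  which only the values on \<open>M\<close> matter.\<close>

definition bounded_operator_on :: "'a::complex_inner set \<Rightarrow> ('a \<Rightarrow> 'a) \<Rightarrow> bool"
  where "bounded_operator_on M T \<longleftrightarrow>
    (\<forall>f\<in>M. T f \<in> M) \<and>
    (\<forall>f\<in>M. \<forall>g\<in>M. T (f + g) = T f + T g) \<and>
    (\<forall>c. \<forall>f\<in>M. T (c *\<^sub>C f) = c *\<^sub>C T f) \<and>
    (\<exists>K. \<forall>f\<in>M. norm (T f) \<le> K * norm f)"

definition adjoint_on :: "'a::complex_inner set \<Rightarrow> ('a \<Rightarrow> 'a) \<Rightarrow> 'a \<Rightarrow> 'a"
  where "adjoint_on M T g = (THE h. h \<in> M \<and> (\<forall>f\<in>M. cinner (T f) g = cinner f h))"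

definition commutator :: "('a \<Rightarrow> 'a) \<Rightarrow> ('a \<Rightarrow> 'a) \<Rightarrow> 'a \<Rightarrow> 'a::complex_inner"
  where "commutator A B f = A (B f) - B (A f)"

definition orthonormal_basis_of :: "'a::complex_inner set \<Rightarrow> 'a set \<Rightarrow> bool"
  where "orthonormal_basis_of M E \<longleftrightarrow>
    (\<forall>e\<in>E. \<forall>e'\<in>E. cinner e e' = (if e = e' then 1 else 0)) \<and> closure (cspan E) = M"

text \<open>The value does not depend on the orthonormal basis that is chosen; it is \<open>\<infinity>\<close> for a bounded
  operator that is not Hilbert-Schmidt.\<close>

definition hs_norm_sq :: "'a::complex_inner set \<Rightarrow> ('a \<Rightarrow> 'a) \<Rightarrow> ennreal"
  where "hs_norm_sq M T =
    (\<Sum>\<^sub>\<infinity>e\<in>(SOME E. orthonormal_basis_of M E). ennreal ((norm (T e))\<^sup>2))"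

definition hilbert_schmidt_on :: "'a::complex_inner set \<Rightarrow> ('a \<Rightarrow> 'a) \<Rightarrow> bool"
  where "hilbert_schmidt_on M T \<longleftrightarrow> bounded_operator_on M T \<and> hs_norm_sq M T < \<infinity>"


section \<open>The Hardy space over the bidisk\<close>

abbreviation unit_disk :: "complex set"  ("\<bbbD>")
  where "\<bbbD> \<equiv> ball 0 1"

definition square_summable :: "(nat \<times> nat \<Rightarrow> complex) \<Rightarrow> bool"
  where "square_summable a \<longleftrightarrow> (\<lambda>k. (cmod (a k))\<^sup>2) summable_on UNIV"

definition power_series_on_bidisk ::
    "(complex \<times> complex \<Rightarrow> complex) \<Rightarrow> (nat \<times> nat \<Rightarrow> complex) \<Rightarrow> bool"
  where "power_series_on_bidisk f a \<longleftrightarrow>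
    (\<forall>z\<in>\<bbbD>. \<forall>w\<in>\<bbbD>. ((\<lambda>(m, n). a (m, n) * z ^ m * w ^ n) has_sum f (z, w)) UNIV)"

text \<open>Functions on the bidisk are represented by functions that vanish outside of it.\<close>

typedef hardy2 = "{f :: complex \<times> complex \<Rightarrow> complex.
    (\<forall>p. p \<notin> \<bbbD> \<times> \<bbbD> \<longrightarrow> f p = 0) \<and>
    (\<exists>a. square_summable a \<and> power_series_on_bidisk f a)}"
  morphisms hfun Abs_hardy2
proof -
  have "square_summable (\<lambda>_. 0)" "power_series_on_bidisk (\<lambda>_. 0) (\<lambda>_. 0)"
    by (auto simp: square_summable_def power_series_on_bidisk_def case_prod_unfold)
  then show ?thesis
    by (intro exI[of _ "\<lambda>_. 0"] CollectI conjI exI[of _ "\<lambda>_. 0 :: complex"]) auto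
qed

definition hardy2_of :: "(complex \<times> complex \<Rightarrow> complex) \<Rightarrow> hardy2"
  where "hardy2_of f = Abs_hardy2 (\<lambda>p. if p \<in> \<bbbD> \<times> \<bbbD> then f p else 0)"

text \<open>The Taylor coefficients at the origin.\<close>

definition hcoeff :: "hardy2 \<Rightarrow> nat \<times> nat \<Rightarrow> complex"
  where "hcoeff f = (THE a. square_summable a \<and> power_series_on_bidisk (hfun f) a)"

subsection \<open>Uniqueness of the coefficients\<close>

lemma power_series_zero_unique:
  fixes a :: "nat \<Rightarrow> complex"
  assumes "\<And>z. z \<in> \<bbbD> \<Longrightarrow> (\<lambda>n. a n * z ^ n) sums 0"
  shows "a n = 0"
proof (rule ccontr)
  assume n: "a n \<noteq> 0"
  have "(\<lambda>n. a n * 0 ^ n) sums 0"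
    using assms[of 0] by simp
  then have "a 0 = 0"
    using powser_sums_zero_iff by blast
  with n have "n > 0"
    by (cases n) auto
  have sm: "(\<lambda>n. a n * (x - 0) ^ n) sums (\<lambda>_. 0 :: complex) x" if "norm (x - 0) < 1" for x
    using assms[of x] that by simp
  obtain s where s: "s > 0" "\<And>z::complex. z \<in> cball 0 s - {0} \<Longrightarrow> (\<lambda>_. 0 :: complex) z \<noteq> 0"
    using powser_0_nonzero[OF zero_less_one sm refl n \<open>n > 0\<close>] by blast
  have "complex_of_real s \<in> cball 0 s - {0}"
    using \<open>s > 0\<close> by simp
  from s(2)[OF this] show False
    by simp
qed

lemma power_series_on_bidisk_zero_unique:
  assumes "power_series_on_bidisk (\<lambda>_. 0) a"
  shows "a k = 0"
proof -
  obtain m n where k: "k = (m, n)"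
    by (cases k)
  have 1: "((\<lambda>(m, n). a (m, n) * z ^ m * w ^ n) has_sum 0) (UNIV \<times> UNIV)"
    if "z \<in> \<bbbD>" "w \<in> \<bbbD>" for z w
    using assms that unfolding power_series_on_bidisk_def by simp
  have row: "(\<lambda>n. a (m, n) * z ^ m * w ^ n) summable_on UNIV" if "z \<in> \<bbbD>" "w \<in> \<bbbD>" for z w m
    using summable_on_SigmaD1[of "\<lambda>m n. a (m, n) * z ^ m * w ^ n" UNIV "\<lambda>_. UNIV" m]
      1[OF that] by (auto simp: summable_on_def)
  have row': "(\<lambda>n. a (m, n) * w ^ n) summable_on UNIV" if w: "w \<in> \<bbbD>" for w m
  proof -
    have "(\<lambda>n. a (m, n) * (1/2) ^ m * w ^ n) summable_on UNIV"
      by (rule row) (use w in auto)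
    then have "(\<lambda>n. 2 ^ m * (a (m, n) * (1/2) ^ m * w ^ n)) summable_on UNIV"
      by (rule summable_on_cmult_right)
    then show ?thesis
      by (simp add: power_divide)
  qed
  have "(\<Sum>\<^sub>\<infinity>n. a (m, n) * w ^ n) = 0" if w: "w \<in> \<bbbD>" for w m
  proof (rule power_series_zero_unique[of "\<lambda>m. \<Sum>\<^sub>\<infinity>n. a (m, n) * w ^ n"])
    fix z :: complex
    assume z: "z \<in> \<bbbD>"
    have "((\<lambda>n. a (m, n) * z ^ m * w ^ n) has_sum (z ^ m * (\<Sum>\<^sub>\<infinity>n. a (m, n) * w ^ n))) UNIV" for m
    proof -
      have "((\<lambda>n. z ^ m * (a (m, n) * w ^ n)) has_sum (z ^ m * (\<Sum>\<^sub>\<infinity>n. a (m, n) * w ^ n))) UNIV"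
        by (intro has_sum_cmult_right has_sum_infsum row' w)
      then show ?thesis
        by (simp add: mult_ac)
    qed
    then have "((\<lambda>m. z ^ m * (\<Sum>\<^sub>\<infinity>n. a (m, n) * w ^ n)) has_sum 0) UNIV"
      using 1[OF z w] by (intro has_sum_SigmaD[OF 1[OF z w]]) auto
    then show "(\<lambda>m. (\<Sum>\<^sub>\<infinity>n. a (m, n) * w ^ n) * z ^ m) sums 0"
      by (simp add: has_sum_imp_sums mult.commute)
  qed
  then have "(\<lambda>n. a (m, n) * w ^ n) sums 0" if "w \<in> \<bbbD>" for w
    using has_sum_imp_sums[OF has_sum_infsum[OF row'[OF that]]] that by simp
  from power_series_zero_unique[OF this] show ?thesis
    by (simp add: k)
qed

lemma power_series_on_bidisk_lincomb:
  assumes "power_series_on_bidisk f a" "power_series_on_bidisk g b"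
  shows "power_series_on_bidisk (\<lambda>p. c * f p + d * g p) (\<lambda>k. c * a k + d * b k)"
  unfolding power_series_on_bidisk_def
proof (intro ballI)
  fix z w :: complex
  assume zw: "z \<in> \<bbbD>" "w \<in> \<bbbD>"
  have "((\<lambda>k. c * (case k of (m, n) \<Rightarrow> a (m, n) * z ^ m * w ^ n)
      + d * (case k of (m, n) \<Rightarrow> b (m, n) * z ^ m * w ^ n))
      has_sum (c * f (z, w) + d * g (z, w))) UNIV"
    using assms zw unfolding power_series_on_bidisk_def
    by (intro has_sum_add has_sum_cmult_right) auto
  then show "((\<lambda>(m, n). (c * a (m, n) + d * b (m, n)) * z ^ m * w ^ n)
      has_sum c * f (z, w) + d * g (z, w)) UNIV"
    by (simp add: case_prod_unfold algebra_simps)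
qed

lemma power_series_on_bidisk_unique:
  assumes "power_series_on_bidisk f a" "power_series_on_bidisk f b"
  shows "a = b"
proof
  fix k
  have "power_series_on_bidisk (\<lambda>_. 0) (\<lambda>k. a k - b k)"
    using power_series_on_bidisk_lincomb[OF assms, of 1 "-1"] by simp
  from power_series_on_bidisk_zero_unique[OF this] show "a k = b k"
    by simp
qed

lemma square_summable_lincomb:
  assumes "square_summable a" "square_summable b"
  shows "square_summable (\<lambda>k. c * a k + d * b k)"
  unfolding square_summable_def
proof (rule summable_on_comparison_test)
  show "(\<lambda>k. (2 * (cmod c)\<^sup>2) * (cmod (a k))\<^sup>2 + (2 * (cmod d)\<^sup>2) * (cmod (b k))\<^sup>2) summable_on UNIV"
    using assms unfolding square_summable_def
    by (intro summable_on_add summable_on_cmult_right)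
  fix k
  have "(cmod (c * a k + d * b k))\<^sup>2 \<le> (cmod (c * a k) + cmod (d * b k))\<^sup>2"
    by (intro power_mono norm_triangle_ineq) auto
  also have "\<dots> \<le> 2 * (cmod (c * a k))\<^sup>2 + 2 * (cmod (d * b k))\<^sup>2"
    using sum_squares_bound[of "cmod (c * a k)" "cmod (d * b k)"]
    by (simp add: power2_sum)
  finally show "(cmod (c * a k + d * b k))\<^sup>2
      \<le> (2 * (cmod c)\<^sup>2) * (cmod (a k))\<^sup>2 + (2 * (cmod d)\<^sup>2) * (cmod (b k))\<^sup>2"
    by (simp add: norm_mult power_mult_distrib mult_ac)
qed auto

lemma hcoeff_props: "square_summable (hcoeff f)" "power_series_on_bidisk (hfun f) (hcoeff f)"
proof -
  have "\<exists>a. square_summable a \<and> power_series_on_bidisk (hfun f) a"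
    using hfun[of f, unfolded mem_Collect_eq] by (rule conjunct2)
  then have "\<exists>!a. square_summable a \<and> power_series_on_bidisk (hfun f) a"
    by (rule ex_ex1I) (elim conjE, rule power_series_on_bidisk_unique)
  from theI'[OF this]
  have "square_summable (hcoeff f) \<and> power_series_on_bidisk (hfun f) (hcoeff f)"
    unfolding hcoeff_def[symmetric] .
  then show "square_summable (hcoeff f)" "power_series_on_bidisk (hfun f) (hcoeff f)"
    by auto
qed

lemma hcoeff_eqI: "power_series_on_bidisk (hfun f) a \<Longrightarrow> hcoeff f = a"
  by (rule power_series_on_bidisk_unique[OF hcoeff_props(2)])

lemma hfun_outside: "p \<notin> \<bbbD> \<times> \<bbbD> \<Longrightarrow> hfun f p = 0"
  using hfun[of f, unfolded mem_Collect_eq, THEN conjunct1, THEN spec, of p] by (rule mp)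

lemma hardy2_eqI:
  assumes "\<And>k. hcoeff f k = hcoeff g k"
  shows "f = g"
proof -
  have "hcoeff f = hcoeff g"
    using assms by blast
  then have *: "power_series_on_bidisk (hfun g) (hcoeff f)"
    using hcoeff_props(2)[of g] by simp
  have "hfun f (z, w) = hfun g (z, w)" if "z \<in> \<bbbD>" "w \<in> \<bbbD>" for z w
    using hcoeff_props(2)[of f, unfolded power_series_on_bidisk_def, rule_format, OF that]
      *[unfolded power_series_on_bidisk_def, rule_format, OF that]
    by (rule has_sum_unique)
  then have "hfun f p = hfun g p" for p
    using hfun_outside[of p f] hfun_outside[of p g] by (cases "p \<in> \<bbbD> \<times> \<bbbD>"; cases p) auto
  then show ?thesis
    by (simp add: hfun_inject[symmetric] fun_eq_iff)
qed

lemma Abs_hardy2_lincomb: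
  "hfun (Abs_hardy2 (\<lambda>p. c * hfun f p + d * hfun g p)) = (\<lambda>p. c * hfun f p + d * hfun g p)"
proof (rule Abs_hardy2_inverse, intro CollectI conjI exI)
  show "\<forall>p. p \<notin> \<bbbD> \<times> \<bbbD> \<longrightarrow> c * hfun f p + d * hfun g p = 0"
    using hfun_outside[of _ f] hfun_outside[of _ g] by (metis add_0 mult_zero_right)
  show "square_summable (\<lambda>k. c * hcoeff f k + d * hcoeff g k)"
    by (intro square_summable_lincomb hcoeff_props)
  show "power_series_on_bidisk (\<lambda>p. c * hfun f p + d * hfun g p)
      (\<lambda>k. c * hcoeff f k + d * hcoeff g k)"
    by (intro power_series_on_bidisk_lincomb hcoeff_props)
qed

lemma hcoeff_lincomb:
  "hcoeff (Abs_hardy2 (\<lambda>p. c * hfun f p + d * hfun g p)) k = c * hcoeff f k + d * hcoeff g k"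
  by (subst hcoeff_eqI[where a = "\<lambda>k. c * hcoeff f k + d * hcoeff g k"])
    (simp_all add: Abs_hardy2_lincomb power_series_on_bidisk_lincomb hcoeff_props)

subsection \<open>Hilbert space structure\<close>

lemma square_summable_mult:
  assumes "square_summable a" "square_summable b"
  shows "(\<lambda>k. a k * cnj (b k)) summable_on UNIV"
proof (rule Infinite_Sum.abs_summable_summable, rule Infinite_Sum.abs_summable_on_comparison_test')
  show "(\<lambda>k. (cmod (a k))\<^sup>2 + (cmod (b k))\<^sup>2) summable_on UNIV"
    using assms unfolding square_summable_def by (intro summable_on_add)
  fix k
  have "2 * (cmod (a k) * cmod (b k)) \<le> (cmod (a k))\<^sup>2 + (cmod (b k))\<^sup>2"
    using sum_squares_bound[of "cmod (a k)" "cmod (b k)"] by simp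
  moreover have "0 \<le> cmod (a k) * cmod (b k)"
    by simp
  ultimately show "norm (a k * cnj (b k)) \<le> (cmod (a k))\<^sup>2 + (cmod (b k))\<^sup>2"
    unfolding norm_mult complex_mod_cnj by linarith
qed

instantiation hardy2 :: complex_inner
begin

definition "0 = Abs_hardy2 (\<lambda>_. 0)"
definition "f + g = Abs_hardy2 (\<lambda>p. hfun f p + hfun g p)"
definition "f - g = Abs_hardy2 (\<lambda>p. hfun f p - hfun g p)"
definition "- f = Abs_hardy2 (\<lambda>p. - hfun f p)"
definition "c *\<^sub>C f = Abs_hardy2 (\<lambda>p. c * hfun f p)"
definition "r *\<^sub>R (f :: hardy2) = complex_of_real r *\<^sub>C f"
definition "cinner f g = (\<Sum>\<^sub>\<infinity>k. hcoeff f k * cnj (hcoeff g k))"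
definition "inner (f :: hardy2) g = Re (cinner f g)"
definition "norm (f :: hardy2) = sqrt (inner f f)"
definition "sgn (f :: hardy2) = inverse (norm f) *\<^sub>R f"
definition "dist f (g :: hardy2) = norm (f - g)"
definition "uniformity =
  (INF e\<in>{0<..}. principal {(f :: hardy2, g). dist f g < e})"
definition "open (U :: hardy2 set) \<longleftrightarrow>
  (\<forall>f\<in>U. eventually (\<lambda>(f', g). f' = f \<longrightarrow> g \<in> U) uniformity)"

lemma hcoeff_simps [simp]:
  "hcoeff 0 k = 0"
  "hcoeff (f + g) k = hcoeff f k + hcoeff g k"
  "hcoeff (f - g) k = hcoeff f k - hcoeff g k"
  "hcoeff (- f) k = - hcoeff f k"
  "hcoeff (c *\<^sub>C f) k = c * hcoeff f k"
  "hcoeff (r *\<^sub>R f) k = r * hcoeff f k"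
  using hcoeff_lincomb[of 0 undefined 0 undefined k] hcoeff_lincomb[of 1 f 1 g k]
    hcoeff_lincomb[of 1 f "-1" g k] hcoeff_lincomb[of "-1" f 0 f k] hcoeff_lincomb[of c f 0 f k]
    hcoeff_lincomb[of "of_real r" f 0 f k]
  by (simp_all add: zero_hardy2_def plus_hardy2_def minus_hardy2_def uminus_hardy2_def
      scaleC_hardy2_def scaleR_hardy2_def)

lemma hcoeff_mult_summable: "(\<lambda>k. hcoeff f k * cnj (hcoeff g k)) summable_on UNIV"
  by (intro square_summable_mult hcoeff_props)

instance
proof
  fix f g h :: hardy2 and r s :: real and c d :: complex
  show "f + g + h = f + (g + h)" "f + g = g + f" "0 + f = f" "- f + f = 0" "f - g = f + - g"
    "r *\<^sub>R (f + g) = r *\<^sub>R f + r *\<^sub>R g" "(r + s) *\<^sub>R f = r *\<^sub>R f + s *\<^sub>R f"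
    "r *\<^sub>R s *\<^sub>R f = (r * s) *\<^sub>R f" "1 *\<^sub>R f = f" "c *\<^sub>C (f + g) = c *\<^sub>C f + c *\<^sub>C g"
    "(c + d) *\<^sub>C f = c *\<^sub>C f + d *\<^sub>C f" "c *\<^sub>C d *\<^sub>C f = (c * d) *\<^sub>C f"
    by (rule hardy2_eqI; simp add: algebra_simps)+
  show "r *\<^sub>R f = complex_of_real r *\<^sub>C f"
    by (rule scaleR_hardy2_def)
  show "dist f g = norm (f - g)"
    by (rule dist_hardy2_def)
  show "sgn f = inverse (norm f) *\<^sub>R f"
    by (rule sgn_hardy2_def)
  show "uniformity = (INF e\<in>{0<..}. principal {(f :: hardy2, g). dist f g < e})"
    by (rule uniformity_hardy2_def)
  show "open U \<longleftrightarrow> (\<forall>f\<in>U. eventually (\<lambda>(f', g). f' = f \<longrightarrow> g \<in> U) uniformity)"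
    for U :: "hardy2 set"
    by (rule open_hardy2_def)
  show norm_eq: "norm f = sqrt (inner f f)"
    by (rule norm_hardy2_def)
  show Re_eq: "inner f g = Re (cinner f g)"
    by (rule inner_hardy2_def)
  have comm: "cinner f g = cnj (cinner g f)" for f g :: hardy2
    unfolding cinner_hardy2_def infsum_cnj[symmetric] by (simp add: mult.commute)
  have add: "cinner (f + g) h = cinner f h + cinner g h" for f g h :: hardy2
    unfolding cinner_hardy2_def
    by (simp add: distrib_right infsum_add hcoeff_mult_summable)
  have scale: "cinner (c *\<^sub>C f) g = c * cinner f g" for c and f g :: hardy2
    unfolding cinner_hardy2_def by (simp add: mult.assoc infsum_cmult_right')
  show "cinner f g = cnj (cinner g f)" "cinner (f + g) h = cinner f h + cinner g h"
    "cinner (c *\<^sub>C f) g = c * cinner f g"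
    by (fact comm add scale)+
  show "inner f g = inner g f"
    unfolding inner_hardy2_def by (subst comm) simp
  show "inner (f + g) h = inner f h + inner g h"
    by (simp add: inner_hardy2_def add)
  show "inner (r *\<^sub>R f) g = r * inner f g"
    by (simp add: inner_hardy2_def scaleR_hardy2_def scale)
  have inner_self: "inner f f = (\<Sum>\<^sub>\<infinity>k. (cmod (hcoeff f k))\<^sup>2)"
    unfolding inner_hardy2_def cinner_hardy2_def infsum_Re[OF hcoeff_mult_summable, symmetric]
    by (simp add: complex_mult_cnj cmod_power2)
  show nonneg: "0 \<le> inner f f"
    unfolding inner_self by (rule infsum_nonneg) simp
  show "inner f f = 0 \<longleftrightarrow> f = 0"
  proof
    assume "inner f f = 0"
    then have "(cmod (hcoeff f k))\<^sup>2 = 0" for k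
      using nonneg_infsum_le_0D[of "\<lambda>k. (cmod (hcoeff f k))\<^sup>2" UNIV k] hcoeff_props(1)[of f]
      unfolding inner_self square_summable_def by simp
    then show "f = 0"
      by (intro hardy2_eqI) simp
  next
    assume "f = 0"
    then show "inner f f = 0"
      unfolding inner_self by simp
  qed
qed

end

subsection \<open>Submodules and multiplication operators\<close>

text \<open>For bounded analytic \<open>\<phi>\<close> the product lies in the Hardy space again.\<close>

definition hmult :: "(complex \<times> complex \<Rightarrow> complex) \<Rightarrow> hardy2 \<Rightarrow> hardy2"
  where "hmult \<phi> f = hardy2_of (\<lambda>p. \<phi> p * hfun f p)"

definition submodule :: "hardy2 set \<Rightarrow> bool"
  where "submodule M \<longleftrightarrow> closed M \<and> csubspace M \<and>
    (\<forall>f\<in>M. hmult (\<lambda>(z, w). z) f \<in> M) \<and> (\<forall>f\<in>M. hmult (\<lambda>(z, w). w) f \<in> M)"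

text \<open>A polynomial in \<open>z\<close> and \<open>w\<close> is represented as a polynomial in \<open>w\<close> with coefficients that
  are polynomials in \<open>z\<close>.\<close>

definition poly2 :: "complex poly poly \<Rightarrow> complex \<times> complex \<Rightarrow> complex"
  where "poly2 p = (\<lambda>(z, w). poly (poly p [:w:]) z)"

definition submodule_generated :: "hardy2 set \<Rightarrow> hardy2 set"
  where "submodule_generated X = closure (cspan {hmult (poly2 p) f | p f. f \<in> X})"

definition disk_aut :: "complex \<Rightarrow> complex \<Rightarrow> complex"
  where "disk_aut a \<zeta> = (a - \<zeta>) / (1 - cnj a * \<zeta>)"

abbreviation mult_fst :: "(complex \<Rightarrow> complex) \<Rightarrow> hardy2 \<Rightarrow> hardy2"
  where "mult_fst \<phi> \<equiv> hmult (\<lambda>(z, w). \<phi> z)"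

abbreviation mult_snd :: "(complex \<Rightarrow> complex) \<Rightarrow> hardy2 \<Rightarrow> hardy2"
  where "mult_snd \<phi> \<equiv> hmult (\<lambda>(z, w). \<phi> w)"

text \<open>The operators \<open>[A\<^sup>*, A][B\<^sup>*, B]\<close> and \<open>[A\<^sup>*, B]\<close> on \<open>M\<close>.\<close>

definition self_commutator_product ::
    "hardy2 set \<Rightarrow> (hardy2 \<Rightarrow> hardy2) \<Rightarrow> (hardy2 \<Rightarrow> hardy2) \<Rightarrow> hardy2 \<Rightarrow> hardy2"
  where "self_commutator_product M A B =
    commutator (adjoint_on M A) A \<circ> commutator (adjoint_on M B) B"

definition cross_commutator ::
    "hardy2 set \<Rightarrow> (hardy2 \<Rightarrow> hardy2) \<Rightarrow> (hardy2 \<Rightarrow> hardy2) \<Rightarrow> hardy2 \<Rightarrow> hardy2"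
  where "cross_commutator M A B = commutator (adjoint_on M A) B"

definition hilbert_schmidt_submodule :: "hardy2 set \<Rightarrow> bool"
  where "hilbert_schmidt_submodule M \<longleftrightarrow> submodule M \<and>
    hilbert_schmidt_on M (self_commutator_product M (mult_fst (\<lambda>z. z)) (mult_snd (\<lambda>w. w))) \<and>
    hilbert_schmidt_on M (cross_commutator M (mult_fst (\<lambda>z. z)) (mult_snd (\<lambda>w. w)))"

text \<open>The numerical invariants, as squared Hilbert-Schmidt norms of commutators. The self-commutators
  of \<open>R\<close> for \<open>\<phi>\<^sub>a(z)\<close> and \<open>\<phi>\<^sub>b(w)\<close> are the orthogonal projections \<open>P\<^sub>a\<close> and \<open>Q\<^sub>b\<close> of \<open>M\<close> onto
  \<open>M \<ominus> (z - a)M\<close> and \<open>M \<ominus> (w - b)M\<close>. The cross commutator has the same Hilbert-Schmidt norm as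
  the product of the projections onto \<open>\<phi>\<^sub>a(z)(M \<ominus> (w - b)M)\<close> and \<open>\<phi>\<^sub>b(w)(M \<ominus> (z - a)M)\<close>; here
  \<open>\<phi>\<^sub>a(z)\<close> and \<open>\<phi>\<^sub>b(w)\<close> may not be replaced by \<open>z - a\<close> and \<open>w - b\<close>, because \<open>M \<ominus> (w - b)M\<close> is in
  general not invariant under multiplication by \<open>1 - cnj a * z\<close>.\<close>

definition Sigma0 :: "hardy2 set \<Rightarrow> complex \<times> complex \<Rightarrow> ennreal"
  where "Sigma0 M = (\<lambda>(a, b).
    hs_norm_sq M (self_commutator_product M (mult_fst (disk_aut a)) (mult_snd (disk_aut b))))"

definition Sigma1 :: "hardy2 set \<Rightarrow> complex \<times> complex \<Rightarrow> ennreal"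
  where "Sigma1 M = (\<lambda>(a, b).
    hs_norm_sq M (cross_commutator M (mult_fst (disk_aut a)) (mult_snd (disk_aut b))))"


section \<open>Inner functions and composition operators\<close>

text \<open>Boundary values are radial limits.\<close>

definition inner_function :: "(complex \<Rightarrow> complex) \<Rightarrow> bool"
  where "inner_function \<theta> \<longleftrightarrow> \<theta> holomorphic_on \<bbbD> \<and> bounded (\<theta> ` \<bbbD>) \<and>
    (AE t in lebesgue_on {0..2 * pi}.
      \<exists>\<zeta>. ((\<lambda>r. \<theta> (of_real r * cis t)) \<longlongrightarrow> \<zeta>) (at_left 1) \<and> cmod \<zeta> = 1)"

definition comp_op :: "(complex \<Rightarrow> complex) \<Rightarrow> (complex \<Rightarrow> complex) \<Rightarrow> hardy2 \<Rightarrow> hardy2"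
  where "comp_op \<theta> \<phi> f = hardy2_of (\<lambda>(z, w). hfun f (\<theta> z, \<phi> w))"

end

theory Submission
  imports Defs "HOL-Real_Asymp.Real_Asymp"
begin

text \<open>Fix \<open>a\<close> and \<open>b\<close> in the disk. Then \<open>\<tau> = disk_aut (\<theta> a) \<circ> \<theta>\<close> is an inner function with
  \<open>\<tau> a = 0\<close>. Multiplication by \<open>\<tau>\<close> is an isometry of the Hardy space \<open>H\<^sup>2\<close> of the disk
  (\<open>inner_function_mult_isometric\<close>), so \<open>H\<^sup>2\<close> is the orthogonal sum of the spaces \<open>\<tau>\<^sup>n K\<close>, where
  \<open>K = H\<^sup>2 \<ominus> \<tau> H\<^sup>2\<close>. Equivalently \<open>e \<otimes> f \<mapsto> e (f \<circ> \<theta>)\<close>, with a weight that makes composition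
  isometric, maps \<open>K \<otimes> H\<^sup>2\<close> unitarily onto \<open>H\<^sup>2\<close>. Doing this in both variables gives vectors
  \<open>tensor e d f\<close> in the Hardy space over the bidisk, with \<open>e\<close> and \<open>d\<close> in the model spaces of the two
  variables, whose inner products factor (\<open>cinner_tensor\<close>). The submodule \<open>N\<close> generated by the
  functions \<open>f(\<theta>(z), \<phi>(w))\<close> with \<open>f \<in> M\<close> is exactly the tensor product of the two model
  spaces and \<open>M\<close> (\<open>submodule_generated_eq_tensors\<close>).

  Let \<open>A\<close> be multiplication by \<open>disk_aut a z\<close> on \<open>N\<close> and \<open>X\<close> multiplication by \<open>disk_aut (\<theta> a) z\<close> on
  \<open>M\<close>, and let \<open>k \<in> K\<close> be the normalized Szego kernel at \<open>a\<close>. The function \<open>disk_aut a\<close> maps \<open>K\<close> into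
  \<open>K \<oplus> \<tau> k \<complex>\<close>, and a factor \<open>\<tau>\<close> amounts to applying \<open>X\<close> on \<open>M\<close>. Therefore \<open>A\<close> is the
  sum of an operator acting on \<open>K\<close> alone and of a rank one operator of norm 1 on \<open>K\<close> tensored with
  \<open>X\<close>. In the second variable the same holds for multiplication by \<open>disk_aut b w\<close>, called \<open>B\<close>, and
  multiplication by \<open>disk_aut (\<phi> b) w\<close>, called \<open>Y\<close>. Computing with these formulas on
  elementary tensors, everything that takes place in different factors cancels: \<open>[A\<^sup>*, A][B\<^sup>*, B]\<close>
  is a tensor product of two rank one projections with \<open>[X\<^sup>*, X][Y\<^sup>*, Y]\<close>, and \<open>[A\<^sup>*, B]\<close> is a
  tensor product of two rank one operators of norm 1 with \<open>[X\<^sup>*, Y]\<close> (locale \<open>tensor_bishift\<close>).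
  A rank one factor of norm 1 does not change the Hilbert-Schmidt norm
  (\<open>hs_norm_sq_rank_one_tensor\<close>).

  Three facts about the Hardy space carry the rest. Bounded analytic functions of one variable act
  boundedly, by Parseval on circles (\<open>mult_square_summable\<close>), and inner ones isometrically, by
  dominated convergence as the radius tends to 1. Closed subspaces that are invariant under a
  coordinate function are invariant under all bounded analytic functions of it, by dilation
  (\<open>mult_fst_invariant\<close>). And weighted composition is isometric because it maps the orthonormal
  basis \<open>kernel_basis\<close> to an orthonormal family (\<open>tensor_formula_basis\<close>).\<close>

section \<open>Complex inner product spaces\<close>

lemma cinner_add_right: "cinner x (y + z) = cinner x y + cinner x (z :: 'a::complex_inner)"
  by (metis cinner_commute cinner_add_left complex_cnj_add)

lemma cinner_scaleC_right: "cinner x (c *\<^sub>C y) = cnj c * cinner x (y :: 'a::complex_inner)"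
  by (metis cinner_commute cinner_scaleC_left complex_cnj_mult)

lemma cinner_zero_left [simp]: "cinner 0 (x :: 'a::complex_inner) = 0"
  by (metis add_cancel_right_left cinner_add_left)

lemma cinner_zero_right [simp]: "cinner (x :: 'a::complex_inner) 0 = 0"
  by (metis cinner_commute cinner_zero_left complex_cnj_zero)

lemma cinner_diff_left: "cinner (x - y) z = cinner x z - cinner y (z :: 'a::complex_inner)"
  by (metis cinner_add_left diff_add_cancel add_diff_cancel_right')

lemma cinner_diff_right: "cinner x (y - z) = cinner x y - cinner x (z :: 'a::complex_inner)"
  by (metis cinner_add_right diff_add_cancel add_diff_cancel_right')

lemma cinner_scaleR_left: "cinner (r *\<^sub>R x) y = of_real r * cinner x (y :: 'a::complex_inner)"
  by (simp add: scaleR_scaleC cinner_scaleC_left)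

lemma cinner_scaleR_right: "cinner x (r *\<^sub>R y) = of_real r * cinner x (y :: 'a::complex_inner)"
  by (simp add: scaleR_scaleC cinner_scaleC_right)

lemmas cinner_simps = cinner_add_left cinner_add_right cinner_diff_left cinner_diff_right
  cinner_scaleC_left cinner_scaleC_right

lemma cinner_self: "cinner x x = of_real ((norm (x :: 'a::complex_inner))\<^sup>2)"
proof -
  have "Im (cinner x x) = 0"
    using arg_cong[OF cinner_commute[of x x], of Im] by simp
  moreover have "Re (cinner x x) = (norm x)\<^sup>2"
    by (simp add: inner_eq_Re_cinner[symmetric] power2_norm_eq_inner)
  ultimately show ?thesis
    by (simp add: complex_eq_iff)
qed

lemma norm_eq_of_cinner_eq:
  fixes x :: "'a::complex_inner" and y :: "'b::complex_inner"
  shows "cinner x x = cinner y y \<Longrightarrow> norm x = norm y"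
  unfolding cinner_self of_real_eq_iff by simp

lemma norm_scaleC: "norm (c *\<^sub>C x) = cmod c * norm (x :: 'a::complex_inner)"
proof -
  have "complex_of_real ((norm (c *\<^sub>C x))\<^sup>2) = of_real ((cmod c * norm x)\<^sup>2)"
    unfolding cinner_self[symmetric] cinner_scaleC_left cinner_scaleC_right power_mult_distrib
      of_real_mult complex_norm_square by simp
  then have "(norm (c *\<^sub>C x))\<^sup>2 = (cmod c * norm x)\<^sup>2"
    using of_real_eq_iff by blast
  then show ?thesis
    by (simp add: power2_eq_iff_nonneg)
qed

lemma cinner_Cauchy_Schwarz: "cmod (cinner x y) \<le> norm x * norm (y :: 'a::complex_inner)"
proof -
  define c where "c = cnj (sgn (cinner x y))"
  have "cmod (cinner x y) = Re (cinner (c *\<^sub>C x) y)"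
    by (simp add: c_def cinner_scaleC_left sgn_eq complex_norm_square[symmetric] field_simps
        power2_eq_square)
  also have "\<dots> = inner (c *\<^sub>C x) y"
    by (simp add: inner_eq_Re_cinner)
  also have "\<dots> \<le> norm (c *\<^sub>C x) * norm y"
    by (rule norm_cauchy_schwarz)
  also have "\<dots> \<le> norm x * norm y"
    by (auto simp: norm_scaleC c_def norm_sgn mult_left_le_one_le intro!: mult_right_mono)
  finally show ?thesis .
qed

lemma bounded_bilinear_cinner:
  "bounded_bilinear (cinner :: 'a::complex_inner \<Rightarrow> 'a \<Rightarrow> complex)"
proof
  show "\<exists>K. \<forall>a b :: 'a. norm (cinner a b) \<le> norm a * norm b * K"
    using cinner_Cauchy_Schwarz by (intro exI[of _ 1]) auto
qed (simp_all add: cinner_simps cinner_scaleR_left cinner_scaleR_right scaleR_conv_of_real)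

lemmas tendsto_cinner = bounded_bilinear.tendsto[OF bounded_bilinear_cinner]
lemmas continuous_on_cinner [continuous_intros] =
  bounded_bilinear.continuous_on[OF bounded_bilinear_cinner]

lemma bounded_linear_scaleC: "bounded_linear (\<lambda>x :: 'a::complex_inner. c *\<^sub>C x)"
proof (rule bounded_linear_intro)
  show "norm (c *\<^sub>C x) \<le> norm x * cmod c" for x :: 'a
    by (simp add: norm_scaleC)
  show "c *\<^sub>C r *\<^sub>R x = r *\<^sub>R c *\<^sub>C x" for r and x :: 'a
    by (simp add: scaleR_scaleC mult.commute)
qed (simp add: scaleC_add_right)

lemmas continuous_on_scaleC [continuous_intros] =
  bounded_linear.continuous_on[OF bounded_linear_scaleC]
lemmas tendsto_scaleC = bounded_linear.tendsto[OF bounded_linear_scaleC]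

lemma csubspaceI:
  assumes "0 \<in> S" "\<And>x y. x \<in> S \<Longrightarrow> y \<in> S \<Longrightarrow> x + y \<in> S" "\<And>c x. x \<in> S \<Longrightarrow> c *\<^sub>C x \<in> S"
  shows "csubspace (S :: 'a::complex_inner set)"
  using assms by (simp add: complex_vector.subspace_def)

lemmas csubspace_0 = complex_vector.subspace_0
lemmas csubspace_add = complex_vector.subspace_add
lemmas csubspace_scale = complex_vector.subspace_scale
lemmas csubspace_diff = complex_vector.subspace_diff

lemma csubspace_closure:
  assumes "csubspace (S :: 'a::complex_inner set)"
  shows "csubspace (closure S)"
proof (rule csubspaceI)
  show "0 \<in> closure S"
    using csubspace_0[OF assms] closure_subset by blast
  fix x y assume "x \<in> closure S" "y \<in> closure S"
  then obtain f g where "\<And>n. f n \<in> S" "f \<longlonglongrightarrow> x" "\<And>n. g n \<in> S" "g \<longlonglongrightarrow> y"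
    unfolding closure_sequential by blast
  then show "x + y \<in> closure S"
    unfolding closure_sequential
    by (intro exI[of _ "\<lambda>n. f n + g n"]) (auto intro: csubspace_add[OF assms] tendsto_add)
next
  fix c x assume "x \<in> closure S"
  then obtain f where "\<And>n. f n \<in> S" "f \<longlonglongrightarrow> x"
    unfolding closure_sequential by blast
  then show "c *\<^sub>C x \<in> closure S"
    unfolding closure_sequential
    by (intro exI[of _ "\<lambda>n. c *\<^sub>C f n"]) (auto intro: csubspace_scale[OF assms] tendsto_scaleC)
qed

abbreviation closed_cspan :: "'a::complex_inner set \<Rightarrow> 'a set"
  where "closed_cspan S \<equiv> closure (cspan S)"

lemma csubspace_closed_cspan: "csubspace (closed_cspan S)"
  by (intro csubspace_closure complex_vector.subspace_span)

lemma closed_cspan_superset: "x \<in> S \<Longrightarrow> x \<in> closed_cspan S"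
  using closure_subset complex_vector.span_base by blast

lemma closed_cspan_minimal:
  assumes "S \<subseteq> L" "csubspace L" "closed L"
  shows "closed_cspan S \<subseteq> L"
  by (intro closure_minimal complex_vector.span_minimal assms)

subsection \<open>Bounded operators and their adjoints on complete subspaces\<close>

lemma bounded_operator_onI:
  assumes "\<And>f. f \<in> M \<Longrightarrow> T f \<in> M"
    and "\<And>f g. f \<in> M \<Longrightarrow> g \<in> M \<Longrightarrow> T (f + g) = T f + T g"
    and "\<And>c f. f \<in> M \<Longrightarrow> T (c *\<^sub>C f) = c *\<^sub>C T f"
    and "\<And>f. f \<in> M \<Longrightarrow> norm (T f) \<le> K * norm f"
  shows "bounded_operator_on M T"
  using assms unfolding bounded_operator_on_def by blast

lemma bounded_operator_onD:
  assumes "bounded_operator_on M T"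
  shows "f \<in> M \<Longrightarrow> T f \<in> M" "f \<in> M \<Longrightarrow> g \<in> M \<Longrightarrow> T (f + g) = T f + T g"
    "f \<in> M \<Longrightarrow> T (c *\<^sub>C f) = c *\<^sub>C T f"
  using assms unfolding bounded_operator_on_def by auto

lemma bounded_operator_on_boundE:
  assumes "bounded_operator_on M T"
  obtains K where "K \<ge> 0" "\<And>f. f \<in> M \<Longrightarrow> norm (T f) \<le> K * norm f"
proof -
  from assms obtain K where K: "\<And>f. f \<in> M \<Longrightarrow> norm (T f) \<le> K * norm f"
    unfolding bounded_operator_on_def by blast
  have "norm (T f) \<le> max K 0 * norm f" if "f \<in> M" for f
    using K[OF that] by (meson max.cobounded1 mult_right_mono norm_ge_zero order_trans)
  then show ?thesis
    using that[of "max K 0"] by simp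
qed

lemma bounded_operator_on_comp:
  assumes S: "bounded_operator_on M S" and T: "bounded_operator_on M T"
  shows "bounded_operator_on M (S \<circ> T)"
proof -
  obtain K where K: "K \<ge> 0" "\<And>f. f \<in> M \<Longrightarrow> norm (S f) \<le> K * norm f"
    using bounded_operator_on_boundE[OF S] by blast
  obtain L where L: "L \<ge> 0" "\<And>f. f \<in> M \<Longrightarrow> norm (T f) \<le> L * norm f"
    using bounded_operator_on_boundE[OF T] by blast
  note S' = bounded_operator_onD[OF S] and T' = bounded_operator_onD[OF T]
  show ?thesis
  proof (rule bounded_operator_onI)
    fix f assume f: "f \<in> M"
    have "norm (S (T f)) \<le> K * norm (T f)"
      using f by (intro K(2) T')
    also have "\<dots> \<le> K * (L * norm f)"
      using f by (intro mult_left_mono L(2) K(1))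
    finally show "norm ((S \<circ> T) f) \<le> (K * L) * norm f"
      by (simp add: mult.assoc)
  qed (simp_all add: S' T')
qed

lemma bounded_operator_on_diff:
  assumes S: "bounded_operator_on M S" and T: "bounded_operator_on M T" and M: "csubspace M"
  shows "bounded_operator_on M (\<lambda>f. S f - T f)"
proof -
  obtain K where K: "\<And>f. f \<in> M \<Longrightarrow> norm (S f) \<le> K * norm f"
    using bounded_operator_on_boundE[OF S] by blast
  obtain L where L: "\<And>f. f \<in> M \<Longrightarrow> norm (T f) \<le> L * norm f"
    using bounded_operator_on_boundE[OF T] by blast
  note S' = bounded_operator_onD[OF S] and T' = bounded_operator_onD[OF T]
  show ?thesis
  proof (rule bounded_operator_onI)
    fix f assume f: "f \<in> M"
    have "norm (S f - T f) \<le> norm (S f) + norm (T f)"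
      by (rule norm_triangle_ineq4)
    also have "\<dots> \<le> (K + L) * norm f"
      using K[OF f] L[OF f] by (simp add: distrib_right)
    finally show "norm (S f - T f) \<le> (K + L) * norm f" .
  qed (auto simp: S' T' complex_vector.scale_right_diff_distrib intro: csubspace_diff[OF M])
qed

lemma bounded_operator_on_commutator:
  assumes "bounded_operator_on M S" "bounded_operator_on M T" "csubspace M"
  shows "bounded_operator_on M (commutator S T)"
  using bounded_operator_on_diff[OF bounded_operator_on_comp[OF assms(1,2)]
      bounded_operator_on_comp[OF assms(2,1)] assms(3)]
  unfolding commutator_def comp_def .

text \<open>The representing vector minimizes \<open>\<parallel>f\<parallel>\<^sup>2 - 2 Re (p f)\<close>; minimizing sequences are Cauchy by
  the parallelogram law.\<close>

lemma riesz_representation: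
  fixes M :: "'a::complex_inner set"
  assumes M: "complete M" "csubspace M"
    and add: "\<And>f g. f \<in> M \<Longrightarrow> g \<in> M \<Longrightarrow> p (f + g) = p f + p g"
    and scale: "\<And>c f. f \<in> M \<Longrightarrow> p (c *\<^sub>C f) = c * p f"
    and bound: "\<And>f. f \<in> M \<Longrightarrow> cmod (p f) \<le> K * norm f"
  obtains h where "h \<in> M" "\<And>f. f \<in> M \<Longrightarrow> p f = cinner f h"
proof -
  define J where "J f = (norm f)\<^sup>2 - 2 * Re (p f)" for f
  have J_lower: "J f \<ge> - (K\<^sup>2)" if "f \<in> M" for f
  proof -
    have "2 * Re (p f) \<le> 2 * (K * norm f)"
      using bound[OF that] complex_Re_le_cmod[of "p f"] by linarith
    moreover have "0 \<le> (norm f - K)\<^sup>2" by simp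
    ultimately show ?thesis
      unfolding J_def by (simp add: power2_diff algebra_simps)
  qed
  define m where "m = Inf (J ` M)"
  have bdd: "bdd_below (J ` M)"
    using J_lower by (intro bdd_belowI2) auto
  have ne: "J ` M \<noteq> {}"
    using csubspace_0[OF M(2)] by blast
  have m_le: "m \<le> J f" if "f \<in> M" for f
    unfolding m_def using that bdd by (intro cInf_lower) auto
  have "\<exists>f\<in>M. J f < m + inverse (real (Suc n))" for n
  proof -
    have "Inf (J ` M) < m + inverse (real (Suc n))"
      unfolding m_def by simp
    from cInf_lessD[OF ne this] show ?thesis by auto
  qed
  then obtain x where x: "\<And>n. x n \<in> M" "\<And>n. J (x n) < m + inverse (real (Suc n))"
    by metis
  have half: "(1/2) *\<^sub>C (f + g) \<in> M" if "f \<in> M" "g \<in> M" for f g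
    using that M(2) by (intro csubspace_scale csubspace_add)
  have parallelogram: "(norm (f - g))\<^sup>2 \<le> 2 * (J f - m) + 2 * (J g - m)"
    if "f \<in> M" "g \<in> M" for f g
  proof -
    have "p ((1/2) *\<^sub>C (f + g)) = (1/2) * (p f + p g)"
      using that M(2) by (simp add: scale add csubspace_add)
    then have Re: "2 * Re (p ((1/2) *\<^sub>C (f + g))) = Re (p f) + Re (p g)"
      by (simp only:) simp
    have nrm: "norm ((1/2) *\<^sub>C (f + g)) = norm (f + g) / 2"
      by (simp add: norm_scaleC)
    have "J ((1/2) *\<^sub>C (f + g)) = (norm (f + g))\<^sup>2 / 4 - (Re (p f) + Re (p g))"
      unfolding J_def Re nrm by (simp add: power_divide)
    moreover have "(norm (f + g))\<^sup>2 + (norm (f - g))\<^sup>2 = 2 * (norm f)\<^sup>2 + 2 * (norm g)\<^sup>2"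
      by (simp add: power2_norm_eq_inner inner_simps inner_commute)
    ultimately have "(norm (f - g))\<^sup>2 = 2 * J f + 2 * J g - 4 * J ((1/2) *\<^sub>C (f + g))"
      unfolding J_def by (simp add: algebra_simps)
    then show ?thesis
      using m_le[OF half[OF that]] by simp
  qed
  have "Cauchy x"
  proof (rule metric_CauchyI)
    fix e :: real assume e: "e > 0"
    obtain N where N: "inverse (real (Suc N)) < e\<^sup>2 / 4"
      using reals_Archimedean[of "e\<^sup>2 / 4"] e by auto
    have small: "J (x i) - m < e\<^sup>2 / 4" if "i \<ge> N" for i
    proof -
      have "inverse (real (Suc i)) \<le> inverse (real (Suc N))"
        using that by (intro le_imp_inverse_le) auto
      then show ?thesis
        using x(2)[of i] N by linarith
    qed
    have "dist (x i) (x j) < e" if "i \<ge> N" "j \<ge> N" for i j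
    proof -
      have "(norm (x i - x j))\<^sup>2 < e\<^sup>2"
      proof -
        have "2 * (J (x i) - m) + 2 * (J (x j) - m) < 2 * (e\<^sup>2 / 4) + 2 * (e\<^sup>2 / 4)"
          by (intro add_strict_mono mult_strict_left_mono small that) auto
        with parallelogram[OF x(1) x(1), of i j] show ?thesis
          by simp
      qed
      then show ?thesis
        using e by (simp add: dist_norm power_less_imp_less_base)
    qed
    then show "\<exists>N. \<forall>m\<ge>N. \<forall>n\<ge>N. dist (x m) (x n) < e"
      by blast
  qed
  then obtain h where h: "h \<in> M" "x \<longlonglongrightarrow> h"
    using M(1) x(1) unfolding complete_def by blast
  have p_diff: "p (f - g) = p f - p g" if "f \<in> M" "g \<in> M" for f g
    using add[OF csubspace_diff[OF M(2) that] that(2)] by simp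
  have "(\<lambda>n. p (x n)) \<longlonglongrightarrow> p h"
  proof (rule Lim_transform_bound[of "\<lambda>n. p (x n) - p h" "\<lambda>n. K * norm (x n - h)", THEN Lim_null[THEN iffD2]])
    show "\<forall>\<^sub>F n in sequentially. norm (p (x n) - p h) \<le> norm (K * norm (x n - h))"
    proof (rule always_eventually, rule allI)
      fix n
      have "norm (p (x n) - p h) \<le> K * norm (x n - h)"
        using bound[OF csubspace_diff[OF M(2) x(1) h(1)]] p_diff[OF x(1) h(1)] by simp
      then show "norm (p (x n) - p h) \<le> norm (K * norm (x n - h))"
        by simp
    qed
    show "(\<lambda>n. K * norm (x n - h)) \<longlonglongrightarrow> 0"
      using tendsto_mult_right_zero[OF tendsto_norm_zero[OF LIM_zero[OF h(2)]], of K] .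
  qed
  then have "(\<lambda>n. J (x n)) \<longlonglongrightarrow> J h"
    unfolding J_def by (intro tendsto_intros h(2))
  moreover have "(\<lambda>n. m + inverse (real (Suc n))) \<longlonglongrightarrow> m + 0"
    by (intro tendsto_intros LIMSEQ_inverse_real_of_nat)
  ultimately have "J h \<le> m + 0"
    by (rule LIMSEQ_le) (use x(2) in \<open>auto intro: less_imp_le\<close>)
  then have J_min: "J h \<le> J f" if "f \<in> M" for f
    using m_le[OF that] by simp
  have Re_eq: "Re (p f) = Re (cinner f h)" if f: "f \<in> M" for f
  proof -
    define d where "d = inner h f - Re (p f)"
    \<comment> \<open>the first variation of \<open>J\<close> at its minimum \<open>h\<close> in the direction \<open>f\<close>\<close>
    have quad: "0 \<le> t\<^sup>2 * (norm f)\<^sup>2 + 2 * t * d" for t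
    proof -
      have tf: "of_real t *\<^sub>C f \<in> M"
        using f M(2) by (rule csubspace_scale[rotated])
      have "J (h + of_real t *\<^sub>C f) = J h + t\<^sup>2 * (norm f)\<^sup>2 + 2 * t * d"
      proof -
        have "Re (p (h + of_real t *\<^sub>C f)) = Re (p h) + t * Re (p f)"
          by (simp add: add[OF h(1) tf] scale[OF f])
        moreover have "(norm (h + t *\<^sub>R f))\<^sup>2 = (norm h)\<^sup>2 + t\<^sup>2 * (norm f)\<^sup>2 + 2 * t * inner h f"
          unfolding power2_norm_eq_inner
          by (simp add: inner_simps inner_commute[of f h] algebra_simps power2_eq_square)
        ultimately show ?thesis
          unfolding J_def d_def scaleR_scaleC by (simp add: algebra_simps)
      qed
      then show ?thesis
        using J_min[OF csubspace_add[OF M(2) h(1) tf]] by simp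
    qed
    have "d = 0"
    proof (cases "norm f = 0")
      case True
      then show ?thesis
        using quad[of "- d"] by (auto simp: power2_eq_square mult_le_0_iff)
    next
      case False
      then have n: "(norm f)\<^sup>2 > 0" by simp
      have "(- d / (norm f)\<^sup>2)\<^sup>2 * (norm f)\<^sup>2 + 2 * (- d / (norm f)\<^sup>2) * d = - (d\<^sup>2 / (norm f)\<^sup>2)"
        using False by (simp add: field_simps power2_eq_square)
      then have "d\<^sup>2 / (norm f)\<^sup>2 \<le> 0"
        using quad[of "- d / (norm f)\<^sup>2"] by simp
      then show ?thesis
        using n by (simp add: divide_le_0_iff)
    qed
    then show ?thesis
      by (simp add: d_def inner_eq_Re_cinner[symmetric] inner_commute)
  qed
  show ?thesis
  proof (rule that[OF h(1)])
    fix f assume f: "f \<in> M"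
    have "Re (p (\<i> *\<^sub>C f)) = Re (cinner (\<i> *\<^sub>C f) h)"
      by (intro Re_eq csubspace_scale M(2) f)
    then have "Im (p f) = Im (cinner f h)"
      by (simp add: scale[OF f] cinner_scaleC_left)
    with Re_eq[OF f] show "p f = cinner f h"
      by (simp add: complex_eq_iff)
  qed
qed

lemma cinner_eq_imp_eq:
  assumes "csubspace M" "x \<in> M" "y \<in> M" "\<And>f. f \<in> M \<Longrightarrow> cinner f x = cinner f y"
  shows "x = (y :: 'a::complex_inner)"
proof -
  have "cinner (x - y) (x - y) = 0"
    using assms(4)[OF csubspace_diff[OF assms(1-3)]] by (simp add: cinner_diff_right)
  then show ?thesis
    by (simp add: cinner_self)
qed

lemma adjoint_on_eqI:
  assumes "csubspace M" "h \<in> M" "\<And>f. f \<in> M \<Longrightarrow> cinner (T f) g = cinner f h"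
  shows "adjoint_on M T g = h"
  unfolding adjoint_on_def
proof (rule the_equality)
  fix h' assume h': "h' \<in> M \<and> (\<forall>f\<in>M. cinner (T f) g = cinner f h')"
  show "h' = h"
    using h' assms(3) by (intro cinner_eq_imp_eq[OF assms(1) _ assms(2)]) auto
qed (use assms in auto)

lemma adjoint_on:
  assumes M: "complete M" "csubspace M" and T: "bounded_operator_on M T"
  shows adjoint_on_in: "adjoint_on M T g \<in> M"
    and cinner_adjoint_on: "f \<in> M \<Longrightarrow> cinner (T f) g = cinner f (adjoint_on M T g)"
proof -
  obtain K where K: "\<And>f. f \<in> M \<Longrightarrow> norm (T f) \<le> K * norm f"
    using bounded_operator_on_boundE[OF T] by blast
  obtain h where h: "h \<in> M" "\<And>f. f \<in> M \<Longrightarrow> cinner (T f) g = cinner f h"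
  proof (rule riesz_representation[OF M, of "\<lambda>f. cinner (T f) g" "K * norm g"])
    show "cmod (cinner (T f) g) \<le> K * norm g * norm f" if "f \<in> M" for f
      using order_trans[OF cinner_Cauchy_Schwarz[of _ g]
          mult_right_mono[OF K[OF that] norm_ge_zero[of g]]]
      by (simp add: mult_ac)
  qed (use bounded_operator_onD[OF T] in \<open>auto simp: cinner_simps\<close>)
  have "adjoint_on M T g = h"
    by (rule adjoint_on_eqI[OF M(2) h])
  with h show "adjoint_on M T g \<in> M" "f \<in> M \<Longrightarrow> cinner (T f) g = cinner f (adjoint_on M T g)"
    by auto
qed

lemma bounded_operator_on_adjoint:
  assumes M: "complete M" "csubspace M" and T: "bounded_operator_on M T"
  shows "bounded_operator_on M (adjoint_on M T)"
proof -
  obtain K where K: "K \<ge> 0" "\<And>f. f \<in> M \<Longrightarrow> norm (T f) \<le> K * norm f"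
    using bounded_operator_on_boundE[OF T] by blast
  note adj = adjoint_on_in[OF M T] cinner_adjoint_on[OF M T]
  show ?thesis
  proof (rule bounded_operator_onI)
    show "adjoint_on M T f \<in> M" for f
      by (rule adj)
    show "adjoint_on M T (f + g) = adjoint_on M T f + adjoint_on M T g" for f g
      by (rule adjoint_on_eqI[OF M(2)]) (auto simp: adj cinner_simps csubspace_add[OF M(2)])
    show "adjoint_on M T (c *\<^sub>C f) = c *\<^sub>C adjoint_on M T f" for c f
      by (rule adjoint_on_eqI[OF M(2)]) (auto simp: adj cinner_simps csubspace_scale[OF M(2)])
    fix g
    let ?h = "adjoint_on M T g"
    have "(norm ?h)\<^sup>2 = cmod (cinner (T ?h) g)"
      by (simp add: adj cinner_self norm_power)
    also have "\<dots> \<le> norm (T ?h) * norm g"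
      by (rule cinner_Cauchy_Schwarz)
    also have "\<dots> \<le> K * norm ?h * norm g"
      by (intro mult_right_mono K adj) auto
    finally have "norm ?h * norm ?h \<le> norm ?h * (K * norm g)"
      by (simp add: power2_eq_square mult_ac)
    then show "norm ?h \<le> K * norm g"
      using K(1) by (cases "norm ?h = 0") auto
  qed
qed

subsection \<open>Orthonormal bases and Hilbert-Schmidt norms\<close>

definition orthonormal :: "'a::complex_inner set \<Rightarrow> bool"
  where "orthonormal E \<longleftrightarrow> (\<forall>e\<in>E. \<forall>e'\<in>E. cinner e e' = (if e = e' then 1 else 0))"

lemma orthonormal_basis_of_iff: "orthonormal_basis_of M E \<longleftrightarrow> orthonormal E \<and> closed_cspan E = M"
  by (simp add: orthonormal_basis_of_def orthonormal_def)

text \<open>A maximal orthonormal subset of \<open>M\<close> spans a dense subspace: otherwise the Riesz theorem in its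
  closed span yields a nonzero vector orthogonal to it, which extends the set.\<close>

lemma orthonormal_basis_exists:
  fixes M :: "'a::complex_inner set"
  assumes M: "complete M" "csubspace M"
  shows "\<exists>E. orthonormal_basis_of M E"
proof -
  define \<A> where "\<A> = {E. orthonormal E \<and> E \<subseteq> M}"
  have "\<exists>E\<in>\<A>. \<forall>X\<in>\<A>. E \<subseteq> X \<longrightarrow> X = E"
  proof (rule subset_Zorn')
    fix C assume C: "subset.chain \<A> C"
    show "\<Union>C \<in> \<A>"
    proof -
      have sub: "C \<subseteq> \<A>" and chain: "\<And>X Y. X \<in> C \<Longrightarrow> Y \<in> C \<Longrightarrow> X \<subseteq> Y \<or> Y \<subseteq> X"
        using C unfolding subset.chain_def by blast+
      have "cinner e e' = (if e = e' then 1 else 0)" if e: "e \<in> \<Union>C" "e' \<in> \<Union>C" for e e'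
      proof -
        obtain X where "X \<in> C" "e \<in> X" "e' \<in> X"
          using e chain by blast
        then show ?thesis
          using sub unfolding \<A>_def orthonormal_def by blast
      qed
      then show ?thesis
        using sub unfolding \<A>_def orthonormal_def by blast
    qed
  qed
  then obtain E where E: "orthonormal E" "E \<subseteq> M"
    and maximal: "\<And>X. orthonormal X \<Longrightarrow> X \<subseteq> M \<Longrightarrow> E \<subseteq> X \<Longrightarrow> X = E"
    unfolding \<A>_def by auto
  let ?L = "closed_cspan E"
  have L: "?L \<subseteq> M"
    by (intro closed_cspan_minimal E M complete_imp_closed)
  have "M \<subseteq> ?L"
  proof
    fix x assume x: "x \<in> M"
    have "complete ?L"
      using complete_closed_subset[OF _ L M(1)] by simp
    then obtain y where y: "y \<in> ?L" "\<And>f. f \<in> ?L \<Longrightarrow> cinner f x = cinner f y"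
    proof (rule riesz_representation[OF _ csubspace_closed_cspan, of _ "\<lambda>f. cinner f x" "norm x"])
      show "cmod (cinner f x) \<le> norm x * norm f" for f
        using cinner_Cauchy_Schwarz[of f x] by (simp add: mult.commute)
    qed (auto simp: cinner_simps)
    show "x \<in> ?L"
    proof (rule ccontr)
      assume "x \<notin> ?L"
      with y have ne: "x - y \<noteq> 0" by auto
      define u where "u = of_real (inverse (norm (x - y))) *\<^sub>C (x - y)"
      have u_M: "u \<in> M"
        unfolding u_def using x y L M(2) by (intro csubspace_scale csubspace_diff) auto
      have u_u: "cinner u u = 1"
        using ne by (simp add: cinner_self u_def norm_scaleC norm_inverse)
      have orth: "cinner e u = 0" if "e \<in> E" for e
        using y(2)[OF closed_cspan_superset[OF that]] by (simp add: u_def cinner_simps)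
      have orth': "cinner u e = 0" if "e \<in> E" for e
        using orth[OF that] cinner_commute[of u e] by simp
      have "u \<notin> E"
        using orth[of u] u_u by auto
      have "orthonormal (insert u E)"
        using E(1) u_u orth orth' \<open>u \<notin> E\<close> unfolding orthonormal_def by auto
      from maximal[OF this] u_M E(2) \<open>u \<notin> E\<close> show False
        by auto
    qed
  qed
  with L E show ?thesis
    unfolding orthonormal_basis_of_iff by blast
qed

text \<open>Pythagoras. The choice \<open>r e = cinner x e\<close> gives the inequality of Bessel; for general \<open>r\<close> it
  says that this choice is the best approximation.\<close>

lemma norm_sq_diff_orthonormal_sum:
  assumes E: "orthonormal E" "finite F" "F \<subseteq> E"
  shows "(norm (x - (\<Sum>e\<in>F. r e *\<^sub>C e)))\<^sup>2
    = (norm x)\<^sup>2 - (\<Sum>e\<in>F. (cmod (cinner x e))\<^sup>2) + (\<Sum>e\<in>F. (cmod (cinner x e - r e))\<^sup>2)"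
  using E(2,3)
proof (induction F arbitrary: x)
  case (insert e F)
  have e: "cinner e e = 1" and eF: "\<And>f. f \<in> F \<Longrightarrow> cinner e f = 0"
    using E(1) insert.prems insert.hyps unfolding orthonormal_def by auto
  let ?y = "x - r e *\<^sub>C e"
  have y_F: "cinner ?y f = cinner x f" if "f \<in> F" for f
    using eF[OF that] by (simp add: cinner_simps)
  have "complex_of_real ((norm ?y)\<^sup>2) = of_real ((norm x)\<^sup>2 - (cmod (cinner x e))\<^sup>2 + (cmod (cinner x e - r e))\<^sup>2)"
    unfolding of_real_diff of_real_add complex_norm_square cinner_self[symmetric]
    using cinner_commute[of x e] by (simp add: cinner_simps e algebra_simps)
  then have y: "(norm ?y)\<^sup>2 = (norm x)\<^sup>2 - (cmod (cinner x e))\<^sup>2 + (cmod (cinner x e - r e))\<^sup>2"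
    using of_real_eq_iff by blast
  have "x - (\<Sum>e\<in>insert e F. r e *\<^sub>C e) = ?y - (\<Sum>e\<in>F. r e *\<^sub>C e)"
    using insert.hyps by simp
  then show ?case
    using insert.IH[of ?y] insert.prems insert.hyps by (simp add: y_F y diff_diff_eq)
qed simp

lemma ennreal_summable_on: "(f :: 'a \<Rightarrow> ennreal) summable_on A"
  by (rule nonneg_summable_on_complete) simp

lemma finite_sum_le_infsum_ennreal:
  fixes f :: "'a \<Rightarrow> ennreal"
  assumes "finite F" "F \<subseteq> A"
  shows "sum f F \<le> infsum f A"
proof -
  have "sum f F \<le> (SUP F\<in>{F. finite F \<and> F \<subseteq> A}. sum f F)"
    using assms by (intro SUP_upper) simp
  then show ?thesis
    by (simp add: nonneg_infsum_complete)
qed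

lemma orthonormal_basis_Parseval:
  assumes E: "orthonormal_basis_of M E" and x: "x \<in> M"
  shows "(\<Sum>\<^sub>\<infinity>e\<in>E. ennreal ((cmod (cinner x e))\<^sup>2)) = ennreal ((norm x)\<^sup>2)"
proof -
  have orth: "orthonormal E" and dense: "closed_cspan E = M"
    using E by (auto simp: orthonormal_basis_of_iff)
  let ?s = "\<lambda>F. \<Sum>e\<in>F. (cmod (cinner x e))\<^sup>2"
  have sum_eq: "(\<Sum>e\<in>F. ennreal ((cmod (cinner x e))\<^sup>2)) = ennreal (?s F)" for F
    by (rule sum_ennreal) simp
  show ?thesis
  proof (rule antisym)
    show "(\<Sum>\<^sub>\<infinity>e\<in>E. ennreal ((cmod (cinner x e))\<^sup>2)) \<le> ennreal ((norm x)\<^sup>2)"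
    proof (rule infsum_le_finite_sums)
      fix F assume F: "finite F" "F \<subseteq> E"
      have "?s F \<le> (norm x)\<^sup>2"
        using norm_sq_diff_orthonormal_sum[OF orth F, of x "\<lambda>e. cinner x e"]
        by simp (metis diff_ge_0_iff_ge zero_le_power2)
      then show "(\<Sum>e\<in>F. ennreal ((cmod (cinner x e))\<^sup>2)) \<le> ennreal ((norm x)\<^sup>2)"
        unfolding sum_eq by (rule ennreal_leI)
    qed (rule ennreal_summable_on)
    show "ennreal ((norm x)\<^sup>2) \<le> (\<Sum>\<^sub>\<infinity>e\<in>E. ennreal ((cmod (cinner x e))\<^sup>2))"
    proof (rule ennreal_le_epsilon)
      fix d :: real assume d: "d > 0"
      obtain y where y: "y \<in> cspan E" "dist y x < sqrt d"
        using x d unfolding dense[symmetric] closure_approachable by (metis real_sqrt_gt_0_iff)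
      obtain F r where F: "finite F" "F \<subseteq> E" and y_eq: "y = (\<Sum>e\<in>F. r e *\<^sub>C e)"
        using y(1) unfolding complex_vector.span_explicit by blast
      have "(norm (x - y))\<^sup>2 \<le> d"
        using y(2) d by (metis dist_commute dist_norm less_imp_le norm_ge_zero power_mono real_sqrt_pow2)
      then have "(norm x)\<^sup>2 \<le> ?s F + d"
        using norm_sq_diff_orthonormal_sum[OF orth F, of x r]
          sum_nonneg[of F "\<lambda>e. (cmod (cinner x e - r e))\<^sup>2"]
        unfolding y_eq by simp
      then have "ennreal ((norm x)\<^sup>2) \<le> ennreal (?s F + d)"
        by (rule ennreal_leI)
      also have "\<dots> = ennreal (?s F) + ennreal d"
        using d by (intro ennreal_plus sum_nonneg) auto
      also have "ennreal (?s F) \<le> (\<Sum>\<^sub>\<infinity>e\<in>E. ennreal ((cmod (cinner x e))\<^sup>2))"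
        unfolding sum_eq[symmetric] using F by (intro finite_sum_le_infsum_ennreal) auto
      finally show "ennreal ((norm x)\<^sup>2) \<le> (\<Sum>\<^sub>\<infinity>e\<in>E. ennreal ((cmod (cinner x e))\<^sup>2)) + ennreal d"
        by (simp add: add_right_mono)
    qed
  qed
qed

lemma infsum_ennreal_swap_le:
  fixes f :: "'a \<Rightarrow> 'b \<Rightarrow> ennreal"
  shows "(\<Sum>\<^sub>\<infinity>x\<in>A. \<Sum>\<^sub>\<infinity>y\<in>B. f x y) \<le> (\<Sum>\<^sub>\<infinity>y\<in>B. \<Sum>\<^sub>\<infinity>x\<in>A. f x y)"
proof (rule infsum_le_finite_sums)
  fix F assume F: "finite F" "F \<subseteq> A"
  have "(\<Sum>x\<in>F. \<Sum>\<^sub>\<infinity>y\<in>B. f x y) = (\<Sum>\<^sub>\<infinity>y\<in>B. \<Sum>x\<in>F. f x y)"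
    using F(1) by induction (simp_all add: infsum_add ennreal_summable_on)
  also have "\<dots> \<le> (\<Sum>\<^sub>\<infinity>y\<in>B. \<Sum>\<^sub>\<infinity>x\<in>A. f x y)"
    using F by (intro infsum_mono finite_sum_le_infsum_ennreal ennreal_summable_on)
  finally show "(\<Sum>x\<in>F. \<Sum>\<^sub>\<infinity>y\<in>B. f x y) \<le> (\<Sum>\<^sub>\<infinity>y\<in>B. \<Sum>\<^sub>\<infinity>x\<in>A. f x y)" .
qed (rule ennreal_summable_on)

lemma infsum_ennreal_swap:
  fixes f :: "'a \<Rightarrow> 'b \<Rightarrow> ennreal"
  shows "(\<Sum>\<^sub>\<infinity>x\<in>A. \<Sum>\<^sub>\<infinity>y\<in>B. f x y) = (\<Sum>\<^sub>\<infinity>y\<in>B. \<Sum>\<^sub>\<infinity>x\<in>A. f x y)"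
  by (intro antisym infsum_ennreal_swap_le)

text \<open>The situation is \<open>T' = V T W\<^sup>*\<close> with isometries \<open>V\<close> and \<open>W\<close> from \<open>M\<close> to \<open>N\<close>, where \<open>V\<close> drops out
  of the norms. By Parseval in both spaces the sum of \<open>\<parallel>T' e\<parallel>\<^sup>2\<close> over an orthonormal basis of \<open>N\<close>
  becomes the sum of \<open>\<parallel>W T\<^sup>* f\<parallel>\<^sup>2 = \<parallel>T\<^sup>* f\<parallel>\<^sup>2\<close> over an orthonormal basis of \<open>M\<close>. Taking \<open>T' = T\<close> shows that
  this is the squared norm of \<open>T\<close> itself, whatever bases are chosen.\<close>

lemma hs_norm_sq_isometric_factor:
  assumes M: "complete M" "csubspace M" and N: "complete N" "csubspace N"
    and T: "bounded_operator_on M T"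
    and W: "\<And>f. f \<in> M \<Longrightarrow> W f \<in> N" "\<And>f. f \<in> M \<Longrightarrow> norm (W f) = norm f"
    and R: "\<And>x. x \<in> N \<Longrightarrow> R x \<in> M" "\<And>x f. x \<in> N \<Longrightarrow> f \<in> M \<Longrightarrow> cinner (R x) f = cinner x (W f)"
    and T': "\<And>x. x \<in> N \<Longrightarrow> norm (T' x) = norm (T (R x))"
    and E: "orthonormal_basis_of M E"
  shows "hs_norm_sq N T' = (\<Sum>\<^sub>\<infinity>f\<in>E. ennreal ((norm (adjoint_on M T f))\<^sup>2))"
proof -
  define B where "B = (SOME E. orthonormal_basis_of N E)"
  have B: "orthonormal_basis_of N B"
    unfolding B_def by (rule someI_ex[OF orthonormal_basis_exists[OF N]])
  have B_N: "e \<in> N" if "e \<in> B" for e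
    using B that closed_cspan_superset unfolding orthonormal_basis_of_iff by blast
  have E_M: "f \<in> M" if "f \<in> E" for f
    using E that closed_cspan_superset unfolding orthonormal_basis_of_iff by blast
  note adj = adjoint_on_in[OF M T]
  have swap: "cinner (T (R e)) f = cinner e (W (adjoint_on M T f))" if "e \<in> N" for e f
    using R[OF that] adj cinner_adjoint_on[OF M T] by simp
  have "hs_norm_sq N T' = (\<Sum>\<^sub>\<infinity>e\<in>B. ennreal ((norm (T (R e)))\<^sup>2))"
    unfolding hs_norm_sq_def B_def[symmetric] by (intro infsum_cong) (simp add: T' B_N)
  also have "\<dots> = (\<Sum>\<^sub>\<infinity>e\<in>B. \<Sum>\<^sub>\<infinity>f\<in>E. ennreal ((cmod (cinner (T (R e)) f))\<^sup>2))"
    by (intro infsum_cong orthonormal_basis_Parseval[OF E, symmetric] bounded_operator_onD(1)[OF T]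
        R B_N)
  also have "\<dots> = (\<Sum>\<^sub>\<infinity>f\<in>E. \<Sum>\<^sub>\<infinity>e\<in>B. ennreal ((cmod (cinner (T (R e)) f))\<^sup>2))"
    by (rule infsum_ennreal_swap)
  also have "\<dots> = (\<Sum>\<^sub>\<infinity>f\<in>E. \<Sum>\<^sub>\<infinity>e\<in>B. ennreal ((cmod (cinner (W (adjoint_on M T f)) e))\<^sup>2))"
  proof (intro infsum_cong)
    fix f e assume "e \<in> B"
    then show "ennreal ((cmod (cinner (T (R e)) f))\<^sup>2) = ennreal ((cmod (cinner (W (adjoint_on M T f)) e))\<^sup>2)"
      using swap[OF B_N, of e f] cinner_commute[of e] by (metis complex_mod_cnj)
  qed
  also have "\<dots> = (\<Sum>\<^sub>\<infinity>f\<in>E. ennreal ((norm (W (adjoint_on M T f)))\<^sup>2))"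
    by (intro infsum_cong orthonormal_basis_Parseval[OF B] W adj)
  also have "\<dots> = (\<Sum>\<^sub>\<infinity>f\<in>E. ennreal ((norm (adjoint_on M T f))\<^sup>2))"
    by (intro infsum_cong) (simp add: W adj)
  finally show ?thesis .
qed

lemma hs_norm_sq_eq_adjoint:
  assumes M: "complete M" "csubspace M" and T: "bounded_operator_on M T"
    and E: "orthonormal_basis_of M E"
  shows "hs_norm_sq M T = (\<Sum>\<^sub>\<infinity>f\<in>E. ennreal ((norm (adjoint_on M T f))\<^sup>2))"
  by (rule hs_norm_sq_isometric_factor[OF M M T, of "\<lambda>f. f" "\<lambda>f. f"]) (use E in auto)

theorem hs_norm_sq_eq_of_factor:
  assumes M: "complete M" "csubspace M" and N: "complete N" "csubspace N"
    and T: "bounded_operator_on M T"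
    and W: "\<And>f. f \<in> M \<Longrightarrow> W f \<in> N" "\<And>f. f \<in> M \<Longrightarrow> norm (W f) = norm f"
    and R: "\<And>x. x \<in> N \<Longrightarrow> R x \<in> M" "\<And>x f. x \<in> N \<Longrightarrow> f \<in> M \<Longrightarrow> cinner (R x) f = cinner x (W f)"
    and T': "\<And>x. x \<in> N \<Longrightarrow> norm (T' x) = norm (T (R x))"
  shows "hs_norm_sq N T' = hs_norm_sq M T"
proof -
  obtain E where E: "orthonormal_basis_of M E"
    using orthonormal_basis_exists[OF M] by blast
  show ?thesis
    using hs_norm_sq_isometric_factor[OF assms E] hs_norm_sq_eq_adjoint[OF M T E] by simp
qed

section \<open>Operators on a tensor product\<close>

lemma bounded_linear_maps_eq_on_closed_cspan:
  fixes P Q :: "'a::complex_inner \<Rightarrow> 'a"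
  assumes N: "N = closed_cspan S"
    and addP: "\<And>x y. x \<in> N \<Longrightarrow> y \<in> N \<Longrightarrow> P (x + y) = P x + P y"
    and scaleP: "\<And>c x. x \<in> N \<Longrightarrow> P (c *\<^sub>C x) = c *\<^sub>C P x"
    and boundP: "\<And>x. x \<in> N \<Longrightarrow> norm (P x) \<le> K * norm x"
    and addQ: "\<And>x y. x \<in> N \<Longrightarrow> y \<in> N \<Longrightarrow> Q (x + y) = Q x + Q y"
    and scaleQ: "\<And>c x. x \<in> N \<Longrightarrow> Q (c *\<^sub>C x) = c *\<^sub>C Q x"
    and boundQ: "\<And>x. x \<in> N \<Longrightarrow> norm (Q x) \<le> L * norm x"
    and gen: "\<And>x. x \<in> S \<Longrightarrow> P x = Q x"
    and x: "x \<in> N"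
  shows "P x = Q x"
proof -
  have sub: "csubspace N"
    unfolding N by (rule csubspace_closed_cspan)
  define D where "D x = P x - Q x" for x
  have D_add: "D (x + y) = D x + D y" if "x \<in> N" "y \<in> N" for x y
    unfolding D_def using addP[OF that] addQ[OF that] by simp
  have D_scale: "D (c *\<^sub>C x) = c *\<^sub>C D x" if "x \<in> N" for c x
    unfolding D_def using scaleP[OF that] scaleQ[OF that]
    by (simp add: complex_vector.scale_right_diff_distrib)
  have D_bound: "norm (D x) \<le> (K + L) * norm x" if "x \<in> N" for x
    using norm_triangle_ineq4[of "P x" "Q x"] boundP[OF that] boundQ[OF that]
    unfolding D_def by (simp add: distrib_right)
  have S_N: "S \<subseteq> N"
    unfolding N using closed_cspan_superset by blast
  have D0: "D 0 = 0"
    using D_bound[OF csubspace_0[OF sub]] by simp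
  have "cspan S \<subseteq> {x \<in> N. D x = 0}"
  proof (intro complex_vector.span_minimal csubspaceI)
    show "S \<subseteq> {x \<in> N. D x = 0}"
      using S_N gen by (auto simp: D_def)
  qed (auto simp: D0 D_add D_scale csubspace_0[OF sub] csubspace_add[OF sub]
      csubspace_scale[OF sub] simp del: complex_vector.subspace_0)
  moreover obtain y where y: "\<And>n. y n \<in> cspan S" "y \<longlonglongrightarrow> x"
    using x unfolding N closure_sequential by blast
  ultimately have y': "y n \<in> N" "D (y n) = 0" for n
    by blast+
  have "norm (D x) \<le> (K + L) * norm (x - y n)" for n
  proof -
    have "D x = D (x - y n)"
      using D_add[OF csubspace_diff[OF sub x y'(1)] y'(1), of n n] y'(2)[of n] by simp
    then show ?thesis
      using D_bound[OF csubspace_diff[OF sub x y'(1)], of n] by simp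
  qed
  moreover have "(\<lambda>n. (K + L) * norm (x - y n)) \<longlonglongrightarrow> (K + L) * norm (x - x)"
    by (intro tendsto_intros y)
  ultimately have "norm (D x) \<le> (K + L) * norm (x - x)"
    by (intro LIMSEQ_le_const) auto
  then show ?thesis
    by (simp add: D_def)
qed

lemma orthogonal_to_generators:
  assumes "x \<in> closed_cspan S" "\<And>y. y \<in> S \<Longrightarrow> cinner y x = 0"
  shows "x = 0"
proof -
  have "closed_cspan S \<subseteq> {y. cinner y x = 0}"
    by (intro closed_cspan_minimal csubspaceI closed_Collect_eq continuous_intros)
      (auto simp: assms cinner_simps)
  then have "cinner x x = 0"
    using assms(1) by blast
  then show ?thesis
    by (simp add: cinner_self)
qed

text \<open>\<open>N\<close> is a Hilbert space tensor product of two inner product spaces, given by the index sets \<open>E\<close> and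
  \<open>D\<close> with their Gram matrices, and of \<open>M\<close>: \<open>F e d f\<close> is the image of the elementary tensor. The index
  sets only need to contain enough vectors to generate \<open>N\<close>, so they carry no linear structure.\<close>

locale tensor_model =
  fixes M N :: "'h::complex_inner set" and E :: "'i set" and D :: "'j set"
    and ipE :: "'i \<Rightarrow> 'i \<Rightarrow> complex" and ipD :: "'j \<Rightarrow> 'j \<Rightarrow> complex"
    and F :: "'i \<Rightarrow> 'j \<Rightarrow> 'h \<Rightarrow> 'h"
  assumes M: "complete M" "csubspace M"
    and N: "complete N"
    and F_add: "\<And>e d f g. e \<in> E \<Longrightarrow> d \<in> D \<Longrightarrow> F e d (f + g) = F e d f + F e d g"
    and F_scale: "\<And>e d c f. e \<in> E \<Longrightarrow> d \<in> D \<Longrightarrow> F e d (c *\<^sub>C f) = c *\<^sub>C F e d f"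
    and cinner_F: "\<And>e u d v f g. e \<in> E \<Longrightarrow> u \<in> E \<Longrightarrow> d \<in> D \<Longrightarrow> v \<in> D \<Longrightarrow> f \<in> M \<Longrightarrow> g \<in> M \<Longrightarrow>
      cinner (F e d f) (F u v g) = ipE e u * ipD d v * cinner f g"
    and N_eq: "N = closed_cspan {F e d f | e d f. e \<in> E \<and> d \<in> D \<and> f \<in> M}"
begin

lemma N_sub: "csubspace N"
  unfolding N_eq by (rule csubspace_closed_cspan)

lemma F_in: "e \<in> E \<Longrightarrow> d \<in> D \<Longrightarrow> f \<in> M \<Longrightarrow> F e d f \<in> N"
  unfolding N_eq by (intro closed_cspan_superset) blast

lemma F_diff: "e \<in> E \<Longrightarrow> d \<in> D \<Longrightarrow> F e d (f - g) = F e d f - F e d g"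
  using F_add[of e d "f - g" g] by simp

text \<open>The value of an operator on the elementary tensors determines its Hilbert-Schmidt norm: if
  \<open>T'\<close> is \<open>(e\<^sub>1 \<otimes> e\<^sub>0\<^sup>*) \<otimes> (d\<^sub>1 \<otimes> d\<^sub>0\<^sup>*) \<otimes> T\<close> with unit vectors, the rank one factors have norm 1.\<close>

lemma hs_norm_sq_rank_one_tensor:
  assumes E: "e0 \<in> E" "e1 \<in> E" "ipE e0 e0 = 1" "ipE e1 e1 = 1"
    and D: "d0 \<in> D" "d1 \<in> D" "ipD d0 d0 = 1" "ipD d1 d1 = 1"
    and T': "bounded_operator_on N T'" and T: "bounded_operator_on M T"
    and eq: "\<And>e d f. e \<in> E \<Longrightarrow> d \<in> D \<Longrightarrow> f \<in> M \<Longrightarrow>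
      T' (F e d f) = (ipE e e0 * ipD d d0) *\<^sub>C F e1 d1 (T f)"
  shows "hs_norm_sq N T' = hs_norm_sq M T"
proof -
  have norm_W: "norm (F e0 d0 f) = norm f" and norm_V: "norm (F e1 d1 f) = norm f" if "f \<in> M" for f
    using that E D by (auto intro!: norm_eq_of_cinner_eq simp: cinner_F)
  have "\<exists>h\<in>M. \<forall>f\<in>M. cinner (F e0 d0 f) x = cinner f h" for x
  proof (rule riesz_representation[OF M, of "\<lambda>f. cinner (F e0 d0 f) x" "norm x"])
    show "cmod (cinner (F e0 d0 f) x) \<le> norm x * norm f" if "f \<in> M" for f
      using cinner_Cauchy_Schwarz[of "F e0 d0 f" x] norm_W[OF that] by (simp add: mult.commute)
  qed (auto simp: F_add F_scale E D cinner_simps)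
  then obtain R where R: "\<And>x. R x \<in> M" "\<And>x f. f \<in> M \<Longrightarrow> cinner (F e0 d0 f) x = cinner f (R x)"
    by metis
  have R_eqI: "R x = h" if "h \<in> M" "\<And>f. f \<in> M \<Longrightarrow> cinner (F e0 d0 f) x = cinner f h" for x h
    using that R by (intro cinner_eq_imp_eq[OF M(2)]) auto
  have R_add: "R (x + y) = R x + R y" for x y
    by (rule R_eqI) (auto simp: R cinner_simps csubspace_add[OF M(2)])
  have R_scale: "R (c *\<^sub>C x) = c *\<^sub>C R x" for c x
    by (rule R_eqI) (auto simp: R cinner_simps csubspace_scale[OF M(2)])
  have R_bound: "norm (R x) \<le> norm x" for x
  proof -
    have "(norm (R x))\<^sup>2 = cmod (cinner (F e0 d0 (R x)) x)"
      by (simp add: R cinner_self norm_power)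
    also have "\<dots> \<le> norm (R x) * norm x"
      using cinner_Cauchy_Schwarz[of "F e0 d0 (R x)" x] by (simp add: norm_W R)
    finally show ?thesis
      by (cases "norm (R x) = 0") (auto simp: power2_eq_square)
  qed
  have R_F: "R (F e d f) = (ipE e e0 * ipD d d0) *\<^sub>C f" if "e \<in> E" "d \<in> D" "f \<in> M" for e d f
  proof (rule R_eqI)
    show "(ipE e e0 * ipD d d0) *\<^sub>C f \<in> M"
      by (intro csubspace_scale M that)
    fix g assume g: "g \<in> M"
    have "cinner (F e0 d0 g) (F e d f) = cnj (ipE e e0 * ipD d d0) * cinner g f"
      using cinner_commute[of "F e0 d0 g" "F e d f"] cinner_commute[of g f]
      by (simp add: cinner_F E D that g)
    then show "cinner (F e0 d0 g) (F e d f) = cinner g ((ipE e e0 * ipD d d0) *\<^sub>C f)"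
      by (simp add: cinner_scaleC_right)
  qed
  obtain K where K: "K \<ge> 0" "\<And>f. f \<in> M \<Longrightarrow> norm (T f) \<le> K * norm f"
    using bounded_operator_on_boundE[OF T] by blast
  obtain L where L: "\<And>f. f \<in> N \<Longrightarrow> norm (T' f) \<le> L * norm f"
    using bounded_operator_on_boundE[OF T'] by blast
  note T_lin = bounded_operator_onD[OF T] and T'_lin = bounded_operator_onD[OF T']
  have factor: "T' x = F e1 d1 (T (R x))" if x: "x \<in> N" for x
  proof (rule bounded_linear_maps_eq_on_closed_cspan[OF N_eq _ _ L _ _ _ _ x])
    show "norm (F e1 d1 (T (R x))) \<le> K * norm x" for x
      using order_trans[OF K(2)[OF R(1)] mult_left_mono[OF R_bound K(1)]] norm_V T_lin(1) R(1)
      by simp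
    fix x assume "x \<in> {F e d f | e d f. e \<in> E \<and> d \<in> D \<and> f \<in> M}"
    then show "T' x = F e1 d1 (T (R x))"
      by (auto simp: R_F eq T_lin F_scale E D)
  qed (auto simp: T_lin T'_lin R F_add F_scale E D R_add R_scale)
  show ?thesis
  proof (rule hs_norm_sq_eq_of_factor[OF M N N_sub T, of "F e0 d0" R])
    show "cinner (R x) f = cinner x (F e0 d0 f)" if "f \<in> M" for x f
      using R(2)[OF that, of x] cinner_commute by metis
    show "norm (T' x) = norm (T (R x))" if "x \<in> N" for x
      using factor[OF that] norm_V T_lin(1) R(1) by simp
  qed (auto simp: R norm_W F_in E D)
qed

end

text \<open>An isometry \<open>A\<close> that acts on the first and the last tensor factor. On the first factor \<open>A e\<close> is
  \<open>forward e\<close> up to a component that leaves the space \<open>E\<close> and reappears as a multiple of \<open>one\<close> with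
  \<open>X\<close> applied to the last factor; \<open>q\<close> is the unit vector that \<open>A\<close> maps to this component
  alone. Dually, \<open>A\<close> maps \<open>backward e\<close> to the part of \<open>e\<close> orthogonal to \<open>one\<close>.\<close>

locale tensor_shift = tensor_model M N E D ipE ipD F
  for M N :: "'h::complex_inner set" and E :: "'i set" and D :: "'j set" and ipE ipD F +
  fixes A X :: "'h \<Rightarrow> 'h" and forward backward :: "'i \<Rightarrow> 'i" and one q :: 'i
  assumes A: "bounded_operator_on N A" "\<And>x y. x \<in> N \<Longrightarrow> y \<in> N \<Longrightarrow> cinner (A x) (A y) = cinner x y"
    and X: "bounded_operator_on M X" "\<And>f g. f \<in> M \<Longrightarrow> g \<in> M \<Longrightarrow> cinner (X f) (X g) = cinner f g"
    and one: "one \<in> E" "ipE one one = 1"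
    and q: "q \<in> E" "ipE q q = 1"
    and forward: "\<And>e. e \<in> E \<Longrightarrow> forward e \<in> E"
    and backward: "\<And>e. e \<in> E \<Longrightarrow> backward e \<in> E"
    and A_F: "\<And>e d f. e \<in> E \<Longrightarrow> d \<in> D \<Longrightarrow> f \<in> M \<Longrightarrow>
      A (F e d f) = F (forward e) d f + ipE e q *\<^sub>C F one d (X f)"
    and A_backward: "\<And>e d f. e \<in> E \<Longrightarrow> d \<in> D \<Longrightarrow> f \<in> M \<Longrightarrow>
      A (F (backward e) d f) = F e d f - ipE e one *\<^sub>C F one d f"
    and A_q: "\<And>d f. d \<in> D \<Longrightarrow> f \<in> M \<Longrightarrow> A (F q d f) = F one d (X f)"
    and ip_forward: "\<And>e u. e \<in> E \<Longrightarrow> u \<in> E \<Longrightarrow> ipE (forward u) e = ipE u (backward e)"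
    and ip_one: "\<And>e. e \<in> E \<Longrightarrow> ipE one e = cnj (ipE e one)"
begin

lemma X_in: "f \<in> M \<Longrightarrow> X f \<in> M"
  by (rule bounded_operator_onD(1)[OF X(1)])

lemmas A_add = bounded_operator_onD(2)[OF A(1)]
lemmas A_scale = bounded_operator_onD(3)[OF A(1)]
lemmas adjX_in = adjoint_on_in[OF M X(1)]

text \<open>It suffices to test the formula against elementary tensors, where it becomes
  \<open>ip_forward\<close> and \<open>cinner (X g) f = cinner g (X\<^sup>* f)\<close>.\<close>

lemma adjoint_A_F:
  assumes e: "e \<in> E" and d: "d \<in> D" and f: "f \<in> M"
  shows "adjoint_on N A (F e d f)
    = F (backward e) d f + ipE e one *\<^sub>C F q d (adjoint_on M X f)" (is "?l = ?r")
proof -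
  have "?l - ?r \<in> N"
    by (intro csubspace_diff csubspace_add csubspace_scale N_sub F_in backward q adjX_in assms
        adjoint_on_in N A)
  moreover have "cinner x (?l - ?r) = 0" if "x \<in> {F e d f | e d f. e \<in> E \<and> d \<in> D \<and> f \<in> M}" for x
  proof -
    from that obtain u v g where uvg: "u \<in> E" "v \<in> D" "g \<in> M" and x: "x = F u v g"
      by blast
    have "cinner x ?l = cinner (A (F u v g)) (F e d f)"
      unfolding x by (rule cinner_adjoint_on[OF N N_sub A(1) F_in[OF uvg], symmetric])
    also have "\<dots> = ipE u (backward e) * ipD v d * cinner g f
            + ipE u q * (cnj (ipE e one) * ipD v d * cinner (X g) f)"
      using uvg assms by (simp add: A_F cinner_simps cinner_F forward one X_in ip_forward ip_one)
    also have "cinner (X g) f = cinner g (adjoint_on M X f)"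
      by (rule cinner_adjoint_on[OF M X(1) uvg(3)])
    finally show ?thesis
      using uvg assms by (simp add: x cinner_simps cinner_F backward q adjX_in)
  qed
  ultimately have "?l - ?r = 0"
    unfolding N_eq by (rule orthogonal_to_generators)
  then show ?thesis
    by simp
qed

text \<open>\<open>A A\<^sup>*\<close> sends \<open>F e d f\<close> to itself up to a multiple of the \<open>one\<close> tensor, and on the latter it acts
  as \<open>X X\<^sup>*\<close> on \<open>f\<close>; so the defect projection of \<open>A\<close> is that of \<open>X\<close> tensored with the projection
  onto \<open>one\<close>.\<close>

lemma defect_F:
  assumes e: "e \<in> E" and d: "d \<in> D" and f: "f \<in> M"
  shows "commutator (adjoint_on N A) A (F e d f)
    = ipE e one *\<^sub>C F one d (commutator (adjoint_on M X) X f)"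
proof -
  have isometry: "adjoint_on N A (A x) = x" if "x \<in> N" for x
    by (rule adjoint_on_eqI[OF N_sub that]) (simp add: A that)
  have isometry': "adjoint_on M X (X g) = g" if "g \<in> M" for g
    by (rule adjoint_on_eqI[OF M(2) that]) (simp add: X that)
  have "A (adjoint_on N A (F e d f))
      = F e d f - ipE e one *\<^sub>C F one d f + ipE e one *\<^sub>C F one d (X (adjoint_on M X f))"
    using assms by (simp add: adjoint_A_F A_add A_scale F_in backward q adjX_in
        csubspace_scale[OF N_sub] A_backward A_q)
  then show ?thesis
    using assms
    by (simp add: commutator_def isometry isometry' F_in F_diff one complex_vector.scale_right_diff_distrib)
qed

end

text \<open>A pair of such operators, \<open>A\<close> acting on the first and last factor and \<open>B\<close> on the second and last.\<close>

locale tensor_bishift =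
  first: tensor_shift M N E D ipE ipD F A X forward backward one q +
  second: tensor_shift M N D E ipD ipE "\<lambda>d e. F e d" B Y forward' backward' one' q'
  for M N :: "'h::complex_inner set" and E :: "'i set" and D :: "'j set" and ipE ipD F
    and A X forward backward one q and B Y forward' backward' one' q'
begin

lemma adjoint_bounded:
  "bounded_operator_on N (adjoint_on N A)" "bounded_operator_on N (adjoint_on N B)"
  "bounded_operator_on M (adjoint_on M X)" "bounded_operator_on M (adjoint_on M Y)"
  by (intro bounded_operator_on_adjoint first.N first.N_sub first.M first.A second.A first.X second.X)+

theorem hs_norm_sq_defect_product:
  "hs_norm_sq N (commutator (adjoint_on N A) A \<circ> commutator (adjoint_on N B) B)
    = hs_norm_sq M (commutator (adjoint_on M X) X \<circ> commutator (adjoint_on M Y) Y)"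
proof (rule first.hs_norm_sq_rank_one_tensor[of one one one' one'])
  have Y: "bounded_operator_on M (commutator (adjoint_on M Y) Y)"
    by (intro bounded_operator_on_commutator adjoint_bounded second.X first.M)
  have A: "bounded_operator_on N (commutator (adjoint_on N A) A)"
    by (intro bounded_operator_on_commutator adjoint_bounded first.A first.N_sub)
  show "bounded_operator_on N (commutator (adjoint_on N A) A \<circ> commutator (adjoint_on N B) B)"
    by (intro bounded_operator_on_comp bounded_operator_on_commutator adjoint_bounded first.A second.A
        first.N_sub)
  show "bounded_operator_on M (commutator (adjoint_on M X) X \<circ> commutator (adjoint_on M Y) Y)"
    by (intro bounded_operator_on_comp bounded_operator_on_commutator adjoint_bounded first.X second.X
        first.M)
  show "(commutator (adjoint_on N A) A \<circ> commutator (adjoint_on N B) B) (F e d f)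
      = (ipE e one * ipD d one') *\<^sub>C
        F one one' ((commutator (adjoint_on M X) X \<circ> commutator (adjoint_on M Y) Y) f)"
    if "e \<in> E" "d \<in> D" "f \<in> M" for e d f
    using that bounded_operator_onD(1)[OF Y] first.F_in[OF _ second.one(1)] bounded_operator_onD(3)[OF A]
    by (simp add: second.defect_F first.defect_F second.one complex_vector.scale_scale mult.commute)
qed (simp_all add: first.one second.one)

text \<open>Whatever \<open>A\<^sup>*\<close> and \<open>B\<close> do on different factors commutes. The only term of
  \<open>A\<^sup>* B - B A\<^sup>*\<close> that survives is the one in which both act on the last factor.\<close>

theorem hs_norm_sq_cross_commutator:
  "hs_norm_sq N (commutator (adjoint_on N A) B) = hs_norm_sq M (commutator (adjoint_on M X) Y)"
proof (rule first.hs_norm_sq_rank_one_tensor[of one q q' one'])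
  show "bounded_operator_on N (commutator (adjoint_on N A) B)"
    by (intro bounded_operator_on_commutator adjoint_bounded second.A first.N_sub)
  show "bounded_operator_on M (commutator (adjoint_on M X) Y)"
    by (intro bounded_operator_on_commutator adjoint_bounded second.X first.M)
  fix e d f assume edf: "e \<in> E" "d \<in> D" "f \<in> M"
  let ?v = "ipE e one" and ?c = "ipD d q'" and ?X = "adjoint_on M X"
  have 1: "adjoint_on N A (B (F e d f)) = F (backward e) (forward' d) f
      + ?v *\<^sub>C F q (forward' d) (?X f) + ?c *\<^sub>C F (backward e) one' (Y f)
      + (?c * ?v) *\<^sub>C F q one' (?X (Y f))"
    using edf by (simp add: second.A_F bounded_operator_onD(2,3)[OF adjoint_bounded(1)] first.F_in
        second.forward second.one second.X_in csubspace_scale[OF first.N_sub] first.adjoint_A_F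
        complex_vector.scale_right_distrib complex_vector.scale_scale)
  have 2: "B (adjoint_on N A (F e d f)) = F (backward e) (forward' d) f
      + ?c *\<^sub>C F (backward e) one' (Y f) + ?v *\<^sub>C F q (forward' d) (?X f)
      + (?c * ?v) *\<^sub>C F q one' (Y (?X f))"
    using edf by (simp add: first.adjoint_A_F second.A_add second.A_scale first.F_in first.backward
        first.q first.adjX_in csubspace_scale[OF first.N_sub] second.A_F
        complex_vector.scale_right_distrib complex_vector.scale_scale mult.commute)
  show "commutator (adjoint_on N A) B (F e d f)
      = (ipE e one * ipD d q') *\<^sub>C F q one' (commutator (adjoint_on M X) Y f)"
    unfolding commutator_def 1 2 
    by (simp add: first.F_diff first.q second.one complex_vector.scale_right_diff_distrib mult.commute)
qed (simp_all add: first.one second.one first.q second.q)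

end

section \<open>The Hardy space as a Hilbert space of functions\<close>

text \<open>The orthogonal projection of a vector to the closed span of \<open>S\<close> exists by the Riesz theorem.\<close>

lemma orthogonal_trivial_imp_total:
  fixes S :: "'a::complex_inner set"
  assumes "complete (UNIV :: 'a set)" "\<And>x. (\<And>y. y \<in> S \<Longrightarrow> cinner y x = 0) \<Longrightarrow> x = 0"
  shows "closed_cspan S = UNIV"
proof -
  have "x \<in> closed_cspan S" for x
  proof -
    have "complete (closed_cspan S)"
      using complete_closed_subset[OF _ _ assms(1)] by simp
    then obtain y where y: "y \<in> closed_cspan S" "\<And>f. f \<in> closed_cspan S \<Longrightarrow> cinner f x = cinner f y"
    proof (rule riesz_representation[OF _ csubspace_closed_cspan, of _ "\<lambda>f. cinner f x" "norm x"])
      show "cmod (cinner f x) \<le> norm x * norm f" for f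
        using cinner_Cauchy_Schwarz[of f x] by (simp add: mult.commute)
    qed (auto simp: cinner_simps)
    have "x - y = 0"
      by (rule assms(2)) (simp add: y(2) closed_cspan_superset cinner_simps)
    with y(1) show ?thesis
      by simp
  qed
  then show ?thesis
    by blast
qed

lemma has_sum_product:
  fixes f :: "'a \<Rightarrow> complex" and g :: "'b \<Rightarrow> complex"
  assumes f: "(\<lambda>m. norm (f m)) summable_on UNIV" and g: "(\<lambda>n. norm (g n)) summable_on UNIV"
  shows "((\<lambda>(m, n). f m * g n) has_sum (infsum f UNIV * infsum g UNIV)) UNIV"
    "(\<lambda>(m, n). norm (f m * g n)) summable_on UNIV"
proof -
  have "(\<lambda>(m, n). norm (f m * g n)) summable_on UNIV \<times> UNIV"
  proof (rule summable_on_SigmaI)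
    show "((\<lambda>n. case (m, n) of (m, n) \<Rightarrow> norm (f m * g n))
        has_sum (norm (f m) * (\<Sum>\<^sub>\<infinity>n. norm (g n)))) UNIV" for m
      by (auto simp: norm_mult intro!: has_sum_cmult_right has_sum_infsum g)
    show "(\<lambda>m. norm (f m) * (\<Sum>\<^sub>\<infinity>n. norm (g n))) summable_on UNIV"
      by (intro summable_on_cmult_left f)
  qed auto
  then show abs: "(\<lambda>(m, n). norm (f m * g n)) summable_on UNIV"
    by simp
  have "((\<lambda>(m, n). f m * g n) has_sum (infsum f UNIV * infsum g UNIV)) (UNIV \<times> UNIV)"
  proof (rule has_sum_SigmaI)
    have "(\<lambda>k. norm (case k of (m, n) \<Rightarrow> f m * g n)) summable_on UNIV"
      using abs by (simp add: case_prod_unfold)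
    then show "(\<lambda>(m, n). f m * g n) summable_on UNIV \<times> UNIV"
      using Infinite_Sum.abs_summable_summable by fastforce
    show "((\<lambda>n. case (m, n) of (m, n) \<Rightarrow> f m * g n) has_sum (f m * infsum g UNIV)) UNIV" for m
      using Infinite_Sum.abs_summable_summable[OF g] by (auto intro!: has_sum_cmult_right has_sum_infsum)
    show "((\<lambda>m. f m * infsum g UNIV) has_sum (infsum f UNIV * infsum g UNIV)) UNIV"
      using Infinite_Sum.abs_summable_summable[OF f] by (intro has_sum_cmult_left has_sum_infsum)
  qed
  then show "((\<lambda>(m, n). f m * g n) has_sum (infsum f UNIV * infsum g UNIV)) UNIV"
    by simp
qed

lemma geometric_norm_summable_on:
  "cmod z < 1 \<Longrightarrow> (\<lambda>n. norm (z ^ n)) summable_on (UNIV :: nat set)"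
  using norm_summable_imp_summable_on[of "\<lambda>n. norm (z ^ n)"]
  by (simp add: norm_power summable_geometric)

lemma square_summable_geometric:
  assumes "cmod z < 1" "cmod w < 1"
  shows "square_summable (\<lambda>(m, n). z ^ m * w ^ n)"
proof -
  have "(\<lambda>(m, n). norm ((z\<^sup>2) ^ m * (w\<^sup>2) ^ n)) summable_on (UNIV :: (nat \<times> nat) set)"
    using assms
    by (intro has_sum_product geometric_norm_summable_on) (simp_all add: norm_power power_less_one_iff)
  then show ?thesis
    unfolding square_summable_def
    by (rule summable_on_cong[THEN iffD1, rotated])
      (auto simp: norm_mult norm_power power_mult_distrib power_mult[symmetric] mult.commute)
qed

lemma hcoeff_surj:
  assumes a: "square_summable a"
  obtains f where "hcoeff f = a"
proof -
  define h where "h = (\<lambda>(z, w). if z \<in> \<bbbD> \<and> w \<in> \<bbbD>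
    then \<Sum>\<^sub>\<infinity>(m, n). a (m, n) * z ^ m * w ^ n else (0 :: complex))"
  have "power_series_on_bidisk h a"
    unfolding power_series_on_bidisk_def
  proof (intro ballI)
    fix z w :: complex
    assume zw: "z \<in> \<bbbD>" "w \<in> \<bbbD>"
    have "(\<lambda>k. a k * cnj (case k of (m, n) \<Rightarrow> cnj z ^ m * cnj w ^ n)) summable_on UNIV"
      using zw by (intro square_summable_mult a square_summable_geometric) simp_all
    then have "(\<lambda>(m, n). a (m, n) * z ^ m * w ^ n) summable_on UNIV"
      by (rule summable_on_cong[THEN iffD1, rotated]) (auto simp: mult.assoc)
    then show "((\<lambda>(m, n). a (m, n) * z ^ m * w ^ n) has_sum h (z, w)) UNIV"
      using zw by (simp add: h_def)
  qed
  moreover have "\<forall>p. p \<notin> \<bbbD> \<times> \<bbbD> \<longrightarrow> h p = 0"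
    by (auto simp: h_def)
  ultimately have "hfun (Abs_hardy2 h) = h"
    using a by (intro Abs_hardy2_inverse) auto
  then have "hcoeff (Abs_hardy2 h) = a"
    using \<open>power_series_on_bidisk h a\<close> by (intro hcoeff_eqI) simp
  then show ?thesis
    by (rule that)
qed

lemma cinner_has_sum: "((\<lambda>k. hcoeff f k * cnj (hcoeff g k)) has_sum cinner f g) UNIV"
  unfolding cinner_hardy2_def by (intro has_sum_infsum hcoeff_mult_summable)

lemma norm_has_sum: "((\<lambda>k. (cmod (hcoeff f k))\<^sup>2) has_sum (norm f)\<^sup>2) UNIV"
proof -
  have "((\<lambda>k. Re (hcoeff f k * cnj (hcoeff f k))) has_sum Re (cinner f f)) UNIV"
    by (intro has_sum_Re cinner_has_sum)
  then show ?thesis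
    by (simp add: cinner_self complex_mult_cnj cmod_power2)
qed

lemma sum_hcoeff_le_norm: "finite F \<Longrightarrow> (\<Sum>k\<in>F. (cmod (hcoeff f k))\<^sup>2) \<le> (norm f)\<^sup>2"
  using finite_sum_le_has_sum[OF norm_has_sum] by auto

lemma cmod_hcoeff_le: "cmod (hcoeff f k) \<le> norm f"
  using sum_hcoeff_le_norm[of "{k}" f] by (simp add: power2_le_iff_abs_le)

lemma norm_le_of_finite_sums:
  assumes "\<And>F. finite F \<Longrightarrow> (\<Sum>k\<in>F. (cmod (hcoeff f k))\<^sup>2) \<le> C"
  shows "(norm f)\<^sup>2 \<le> C"
  by (rule has_sum_le_finite_sums[OF norm_has_sum]) (use assms in auto)

lemma square_summable_of_finite_sums:
  assumes "\<And>F. finite F \<Longrightarrow> (\<Sum>k\<in>F. (cmod (a k))\<^sup>2) \<le> C"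
  shows "square_summable a"
  unfolding square_summable_def
  by (rule nonneg_bdd_above_summable_on) (use assms in \<open>auto intro!: bdd_aboveI2\<close>)

text \<open>Completeness of \<open>\<ell>\<^sup>2\<close>: the coefficientwise limit of a Cauchy sequence is square summable
  because all finite partial sums are bounded uniformly.\<close>

lemma complete_hardy2: "complete (UNIV :: hardy2 set)"
  unfolding complete_def
proof (intro allI impI, elim conjE)
  fix X :: "nat \<Rightarrow> hardy2"
  assume X: "Cauchy X"
  have "Cauchy (\<lambda>n. hcoeff (X n) k)" for k
  proof (rule metric_CauchyI)
    fix e :: real assume "e > 0"
    then obtain N where N: "\<And>m n. m \<ge> N \<Longrightarrow> n \<ge> N \<Longrightarrow> dist (X m) (X n) < e"
      using metric_CauchyD[OF X] by blast
    have "dist (hcoeff (X m) k) (hcoeff (X n) k) < e" if "m \<ge> N" "n \<ge> N" for m n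
      using cmod_hcoeff_le[of "X m - X n" k] N[OF that] by (simp add: dist_norm)
    then show "\<exists>N. \<forall>m\<ge>N. \<forall>n\<ge>N. dist (hcoeff (X m) k) (hcoeff (X n) k) < e"
      by blast
  qed
  then have "\<exists>l. (\<lambda>n. hcoeff (X n) k) \<longlonglongrightarrow> l" for k
    by (simp add: Cauchy_convergent_iff convergent_def)
  then obtain a where a: "\<And>k. (\<lambda>n. hcoeff (X n) k) \<longlonglongrightarrow> a k"
    by metis
  obtain B where B: "\<And>n. norm (X n) \<le> B"
    using cauchy_imp_bounded[OF X] unfolding bounded_iff by auto
  have "square_summable a"
  proof (rule square_summable_of_finite_sums)
    fix F :: "(nat \<times> nat) set" assume F: "finite F"
    have "(\<lambda>n. \<Sum>k\<in>F. (cmod (hcoeff (X n) k))\<^sup>2) \<longlonglongrightarrow> (\<Sum>k\<in>F. (cmod (a k))\<^sup>2)"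
      by (intro tendsto_intros a)
    moreover have "(\<Sum>k\<in>F. (cmod (hcoeff (X n) k))\<^sup>2) \<le> B\<^sup>2" for n
      using sum_hcoeff_le_norm[OF F, of "X n"] power_mono[OF B norm_ge_zero, of n 2] by linarith
    ultimately show "(\<Sum>k\<in>F. (cmod (a k))\<^sup>2) \<le> B\<^sup>2"
      by (intro LIMSEQ_le_const2) auto
  qed
  then obtain f where f: "hcoeff f = a"
    by (rule hcoeff_surj)
  have "X \<longlonglongrightarrow> f"
  proof (rule metric_LIMSEQ_I)
    fix e :: real assume e: "e > 0"
    then obtain N where N: "\<And>m n. m \<ge> N \<Longrightarrow> n \<ge> N \<Longrightarrow> dist (X m) (X n) < e / 2"
      using metric_CauchyD[OF X, of "e / 2"] by auto
    have "dist (X n) f < e" if n: "n \<ge> N" for n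
    proof -
      have "(norm (X n - f))\<^sup>2 \<le> (e / 2)\<^sup>2"
      proof (rule norm_le_of_finite_sums)
        fix F :: "(nat \<times> nat) set" assume F: "finite F"
        have "(\<lambda>m. \<Sum>k\<in>F. (cmod (hcoeff (X n - X m) k))\<^sup>2)
            \<longlonglongrightarrow> (\<Sum>k\<in>F. (cmod (hcoeff (X n - f) k))\<^sup>2)"
          unfolding hcoeff_simps f by (intro tendsto_intros a)
        moreover have "(\<Sum>k\<in>F. (cmod (hcoeff (X n - X m) k))\<^sup>2) \<le> (e / 2)\<^sup>2" if "m \<ge> N" for m
        proof -
          have "(norm (X n - X m))\<^sup>2 \<le> (e / 2)\<^sup>2"
            using N[OF n that] by (intro power_mono) (auto simp: dist_norm)
          then show ?thesis
            using sum_hcoeff_le_norm[OF F, of "X n - X m"] by linarith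
        qed
        ultimately show "(\<Sum>k\<in>F. (cmod (hcoeff (X n - f) k))\<^sup>2) \<le> (e / 2)\<^sup>2"
          by (intro LIMSEQ_le_const2) auto
      qed
      then have "norm (X n - f) \<le> e / 2"
        using e by (simp add: power2_le_iff_abs_le)
      then show ?thesis
        using e by (simp add: dist_norm)
    qed
    then show "\<exists>N. \<forall>n\<ge>N. dist (X n) f < e"
      by blast
  qed
  then show "\<exists>l\<in>UNIV. X \<longlonglongrightarrow> l"
    by blast
qed

lemma closed_imp_complete_hardy2: "closed M \<Longrightarrow> complete (M :: hardy2 set)"
  using complete_closed_subset[OF _ _ complete_hardy2] by auto

subsection \<open>Point evaluations\<close>

lemma hfun_simps [simp]:
  "hfun 0 p = 0" "hfun (f + g) p = hfun f p + hfun g p" "hfun (f - g) p = hfun f p - hfun g p"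
  "hfun (c *\<^sub>C f) p = c * hfun f p"
  using Abs_hardy2_lincomb[of 0 undefined 0 undefined] Abs_hardy2_lincomb[of 1 f 1 g]
    Abs_hardy2_lincomb[of 1 f "-1" g] Abs_hardy2_lincomb[of c f 0 f]
  by (simp_all add: zero_hardy2_def plus_hardy2_def minus_hardy2_def scaleC_hardy2_def)

lemma hfun_has_sum:
  "z \<in> \<bbbD> \<Longrightarrow> w \<in> \<bbbD> \<Longrightarrow> ((\<lambda>(m, n). hcoeff f (m, n) * z ^ m * w ^ n) has_sum hfun f (z, w)) UNIV"
  using hcoeff_props(2)[of f] unfolding power_series_on_bidisk_def by blast

lemma hardy2_eqI_hfun:
  assumes "\<And>z w. z \<in> \<bbbD> \<Longrightarrow> w \<in> \<bbbD> \<Longrightarrow> hfun f (z, w) = hfun g (z, w)"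
  shows "f = g"
proof -
  have "hfun f p = hfun g p" for p
    using assms hfun_outside[of p f] hfun_outside[of p g] by (cases "p \<in> \<bbbD> \<times> \<bbbD>"; cases p) auto
  then show ?thesis
    by (simp add: hfun_inject[symmetric] fun_eq_iff)
qed

lemma reproducing_kernel:
  assumes "z \<in> \<bbbD>" "w \<in> \<bbbD>"
  obtains K where "\<And>f. hfun f (z, w) = cinner f K"
proof -
  obtain K where K: "hcoeff K = (\<lambda>(m, n). cnj z ^ m * cnj w ^ n)"
    using hcoeff_surj[OF square_summable_geometric[of "cnj z" "cnj w"]] assms by auto
  have "hfun f (z, w) = cinner f K" for f
  proof -
    have "((\<lambda>(m, n). hcoeff f (m, n) * z ^ m * w ^ n) has_sum cinner f K) UNIV"
      using cinner_has_sum[of f K] by (simp add: K case_prod_unfold mult.assoc)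
    then show ?thesis
      using has_sum_unique[OF hfun_has_sum[OF assms]] by blast
  qed
  then show ?thesis
    by (rule that)
qed

lemma tendsto_hfun:
  assumes "(X \<longlongrightarrow> f) A"
  shows "((\<lambda>n. hfun (X n) p) \<longlongrightarrow> hfun f p) A"
proof (cases "p \<in> \<bbbD> \<times> \<bbbD>")
  case True
  then obtain z w where p: "p = (z, w)" "z \<in> \<bbbD>" "w \<in> \<bbbD>"
    by auto
  obtain K where "\<And>f. hfun f (z, w) = cinner f K"
    using reproducing_kernel[OF p(2,3)] by blast
  then show ?thesis
    unfolding p(1) by (simp add: tendsto_cinner assms)
qed (simp add: hfun_outside)

text \<open>\<open>hardy2_of g\<close> is meaningful only for these \<open>g\<close>; their values outside of the bidisk are ignored.\<close>

definition in_hardy2 :: "(complex \<times> complex \<Rightarrow> complex) \<Rightarrow> bool"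
  where "in_hardy2 g \<longleftrightarrow> (\<exists>f. \<forall>z\<in>\<bbbD>. \<forall>w\<in>\<bbbD>. hfun f (z, w) = g (z, w))"

lemma hardy2_of_eqI:
  assumes "\<And>z w. z \<in> \<bbbD> \<Longrightarrow> w \<in> \<bbbD> \<Longrightarrow> g (z, w) = hfun f (z, w)"
  shows "hardy2_of g = f"
proof -
  have "(\<lambda>p. if p \<in> \<bbbD> \<times> \<bbbD> then g p else 0) = hfun f"
    using assms hfun_outside[of _ f] by fastforce
  then show ?thesis
    by (simp add: hardy2_of_def hfun_inverse)
qed

lemma hfun_hardy2_of:
  assumes "in_hardy2 g" "z \<in> \<bbbD>" "w \<in> \<bbbD>"
  shows "hfun (hardy2_of g) (z, w) = g (z, w)"
proof -
  obtain f where f: "\<And>z w. z \<in> \<bbbD> \<Longrightarrow> w \<in> \<bbbD> \<Longrightarrow> hfun f (z, w) = g (z, w)"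
    using assms(1) unfolding in_hardy2_def by blast
  then have "hardy2_of g = f"
    by (intro hardy2_of_eqI) simp
  with f assms show ?thesis
    by simp
qed

lemma hardy2_of_coeff:
  assumes "square_summable a" "power_series_on_bidisk g a"
  shows "in_hardy2 g" "hcoeff (hardy2_of g) = a"
proof -
  obtain f where f: "hcoeff f = a"
    using hcoeff_surj[OF assms(1)] by blast
  have "g (z, w) = hfun f (z, w)" if "z \<in> \<bbbD>" "w \<in> \<bbbD>" for z w
    using hfun_has_sum[OF that, of f] assms(2) that unfolding f power_series_on_bidisk_def
    by (meson has_sum_unique)
  then show "in_hardy2 g" "hcoeff (hardy2_of g) = a"
    using hardy2_of_eqI[of g f] f unfolding in_hardy2_def by metis+
qed

subsection \<open>Monomials\<close>

definition hmonom :: "nat \<times> nat \<Rightarrow> hardy2"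
  where "hmonom k = hardy2_of (\<lambda>(z, w). z ^ fst k * w ^ snd k)"

lemma hmonom:
  shows hcoeff_hmonom: "hcoeff (hmonom k) = (\<lambda>j. if j = k then 1 else 0)"
    and hfun_hmonom: "z \<in> \<bbbD> \<Longrightarrow> w \<in> \<bbbD> \<Longrightarrow> hfun (hmonom k) (z, w) = z ^ fst k * w ^ snd k"
proof -
  let ?a = "\<lambda>j. if j = k then 1 else 0 :: complex"
  have a: "square_summable ?a"
    unfolding square_summable_def
    by (rule finite_nonzero_values_imp_summable_on) (rule finite_subset[of _ "{k}"], auto)
  have ps: "power_series_on_bidisk (\<lambda>(z, w). z ^ fst k * w ^ snd k) ?a"
    unfolding power_series_on_bidisk_def
  proof (intro ballI)
    fix z w :: complex
    show "((\<lambda>(m, n). ?a (m, n) * z ^ m * w ^ n) has_sum (case (z, w) of (z, w) \<Rightarrow> z ^ fst k * w ^ snd k)) UNIV"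
      by (rule has_sum_finite_neutralI[of "{k}"]) (auto split: prod.splits if_splits)
  qed
  show "hcoeff (hmonom k) = ?a" "z \<in> \<bbbD> \<Longrightarrow> w \<in> \<bbbD> \<Longrightarrow> hfun (hmonom k) (z, w) = z ^ fst k * w ^ snd k"
    unfolding hmonom_def using hardy2_of_coeff[OF a ps] hfun_hardy2_of by auto
qed

lemma hmonom_total: "closed_cspan (range hmonom) = UNIV"
proof (rule orthogonal_trivial_imp_total[OF complete_hardy2])
  fix x assume x: "\<And>y. y \<in> range hmonom \<Longrightarrow> cinner y x = 0"
  have "cinner (hmonom k) x = cnj (hcoeff x k)" for k
  proof -
    have "((\<lambda>j. hcoeff (hmonom k) j * cnj (hcoeff x j)) has_sum cnj (hcoeff x k)) UNIV"
      by (rule has_sum_finite_neutralI[of "{k}"]) (auto simp: hcoeff_hmonom)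
    then show ?thesis
      using has_sum_unique[OF cinner_has_sum] by blast
  qed
  then have "hcoeff x k = hcoeff 0 k" for k
    using x by (metis complex_cnj_zero_iff hcoeff_simps(1) rangeI)
  then show "x = 0"
    by (rule hardy2_eqI)
qed

subsection \<open>Exchanging the variables\<close>

text \<open>Statements about multiplication in one variable transfer to the other one along this unitary.\<close>

definition hswap :: "hardy2 \<Rightarrow> hardy2"
  where "hswap f = hardy2_of (\<lambda>(z, w). hfun f (w, z))"

lemma hswap:
  shows hcoeff_hswap: "hcoeff (hswap f) (m, n) = hcoeff f (n, m)"
    and hfun_hswap: "z \<in> \<bbbD> \<Longrightarrow> w \<in> \<bbbD> \<Longrightarrow> hfun (hswap f) (z, w) = hfun f (w, z)"
proof -
  have bij: "bij prod.swap"
    by simp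
  let ?a = "\<lambda>k. hcoeff f (prod.swap k)"
  have a: "square_summable ?a"
    using hcoeff_props(1)[of f] summable_on_reindex_bij_betw[OF bij, of "\<lambda>k. (cmod (hcoeff f k))\<^sup>2"]
    unfolding square_summable_def by simp
  have ps: "power_series_on_bidisk (\<lambda>(z, w). hfun f (w, z)) ?a"
    unfolding power_series_on_bidisk_def
  proof (intro ballI)
    fix z w :: complex assume "z \<in> \<bbbD>" "w \<in> \<bbbD>"
    then have "((\<lambda>(m, n). hcoeff f (m, n) * w ^ m * z ^ n) has_sum hfun f (w, z)) UNIV"
      by (intro hfun_has_sum)
    then have "((\<lambda>k. case prod.swap k of (m, n) \<Rightarrow> hcoeff f (m, n) * w ^ m * z ^ n) has_sum hfun f (w, z)) UNIV"
      using has_sum_reindex_bij_betw[OF bij] by blast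
    then show "((\<lambda>(m, n). ?a (m, n) * z ^ m * w ^ n) has_sum (case (z, w) of (z, w) \<Rightarrow> hfun f (w, z))) UNIV"
      by (simp add: case_prod_unfold prod.swap_def mult_ac)
  qed
  show "hcoeff (hswap f) (m, n) = hcoeff f (n, m)"
    "z \<in> \<bbbD> \<Longrightarrow> w \<in> \<bbbD> \<Longrightarrow> hfun (hswap f) (z, w) = hfun f (w, z)"
    unfolding hswap_def using hardy2_of_coeff[OF a ps] hfun_hardy2_of by auto
qed

lemma hswap_hswap [simp]: "hswap (hswap f) = f"
  by (rule hardy2_eqI_hfun) (simp add: hfun_hswap)

lemma hswap_add: "hswap (f + g) = hswap f + hswap g"
  and hswap_scaleC: "hswap (c *\<^sub>C f) = c *\<^sub>C hswap f"
  by (rule hardy2_eqI_hfun; simp add: hfun_hswap)+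

lemma cinner_hswap: "cinner (hswap f) (hswap g) = cinner f g"
proof -
  have bij: "bij prod.swap"
    by simp
  have "((\<lambda>k. hcoeff f (prod.swap k) * cnj (hcoeff g (prod.swap k))) has_sum cinner f g) UNIV"
    using has_sum_reindex_bij_betw[OF bij, of "\<lambda>k. hcoeff f k * cnj (hcoeff g k)"]
      cinner_has_sum[of f g] by simp
  moreover have "hcoeff f (prod.swap k) = hcoeff (hswap f) k" for f k
    by (cases k) (simp add: hcoeff_hswap)
  ultimately show ?thesis
    using has_sum_unique[OF cinner_has_sum] by simp
qed

lemma norm_hswap [simp]: "norm (hswap f) = norm f"
  by (rule norm_eq_of_cinner_eq) (rule cinner_hswap)

section \<open>Bounded analytic functions on the disk\<close>

definition taylor_coeff :: "(complex \<Rightarrow> complex) \<Rightarrow> nat \<Rightarrow> complex"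
  where "taylor_coeff u n = (deriv ^^ n) u 0 / fact n"

lemma taylor_coeff_sums:
  assumes "u holomorphic_on \<bbbD>" "z \<in> \<bbbD>"
  shows "(\<lambda>n. taylor_coeff u n * z ^ n) sums u z"
  using holomorphic_power_series[OF assms] by (simp add: taylor_coeff_def)

lemma taylor_coeff_eqI:
  assumes a: "\<And>z. z \<in> \<bbbD> \<Longrightarrow> (\<lambda>n. a n * z ^ n) sums u z"
  shows "u holomorphic_on \<bbbD>" "taylor_coeff u = a"
proof -
  show hol: "u holomorphic_on \<bbbD>"
    by (rule power_series_holomorphic[of _ _ a]) (use a in auto)
  show "taylor_coeff u = a"
  proof
    fix n
    have "(\<lambda>n. (taylor_coeff u n - a n) * z ^ n) sums 0" if "z \<in> \<bbbD>" for z
      using sums_diff[OF taylor_coeff_sums[OF hol that] a[OF that]] by (simp add: left_diff_distrib)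
    from power_series_zero_unique[OF this] show "taylor_coeff u n = a n"
      by simp
  qed
qed

lemma taylor_coeff_cong:
  assumes "u holomorphic_on \<bbbD>" "\<And>z. z \<in> \<bbbD> \<Longrightarrow> v z = u z"
  shows "taylor_coeff v = taylor_coeff u"
  by (rule taylor_coeff_eqI(2)) (use taylor_coeff_sums[OF assms(1)] assms(2) in simp)

lemma power_series_abs_summable:
  fixes a :: "nat \<Rightarrow> complex"
  assumes a: "\<And>z. z \<in> \<bbbD> \<Longrightarrow> summable (\<lambda>n. a n * z ^ n)" and r: "0 \<le> r" "r < 1"
  shows "summable (\<lambda>n. cmod (a n) * r ^ n)"
proof -
  define s :: complex where "s = of_real ((1 + r) / 2)"
  have s: "cmod s < 1" "r < cmod s"
    unfolding s_def norm_of_real using r by auto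
  have "summable (\<lambda>n. norm (a n * of_real r ^ n))"
    by (rule powser_insidea[of a s "of_real r"]) (use s r a in auto)
  then show ?thesis
    using r by (simp add: norm_mult norm_power)
qed

subsection \<open>Parseval's identity on circles\<close>

abbreviation circle_measure :: "real measure"
  where "circle_measure \<equiv> lebesgue_on {0..2 * pi}"

lemma circle_integral_cis:
  fixes k :: int
  shows "(\<integral>t. cis (of_int k * t) \<partial>circle_measure) = (if k = 0 then 2 * pi else 0)"
proof -
  have cont: "continuous_on {0..2 * pi} (\<lambda>t. cis (of_int k * t))"
    by (intro continuous_intros)
  have eq: "(\<integral>t. cis (of_int k * t) \<partial>circle_measure) = integral {0..2 * pi} (\<lambda>t. cis (of_int k * t))"
    by (rule lebesgue_integral_eq_integral[OF continuous_imp_integrable_real[OF cont]]) simp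
  show ?thesis
  proof (cases "k = 0")
    case False
    let ?F = "\<lambda>t. cis (of_int k * t) / (\<i> * of_int k)"
    have "((\<lambda>t. cis (of_int k * t)) has_integral (?F (2 * pi) - ?F 0)) {0..2 * pi}"
    proof (rule fundamental_theorem_of_calculus)
      fix t
      show "(?F has_vector_derivative cis (of_int k * t)) (at t within {0..2 * pi})"
      proof -
        have "((\<lambda>z. exp (\<i> * of_int k * z) / (\<i> * of_int k)) has_field_derivative
            exp (\<i> * of_int k * of_real t)) (at (of_real t))"
          using False by (auto intro!: derivative_eq_intros)
        from has_vector_derivative_real_field[OF this] show ?thesis
          by (simp add: cis_conv_exp mult.assoc)
      qed
    qed simp
    moreover have "cis (of_int k * (2 * pi)) = 1"
      using cis_multiple_2pi[of "of_int k"] by (simp add: mult_ac)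
    ultimately show ?thesis
      unfolding eq using False by (simp add: integral_unique)
  qed (simp add: measure_restrict_space scaleR_conv_of_real)
qed

lemma continuous_on_circle:
  assumes "u holomorphic_on \<bbbD>" "0 \<le> r" "r < 1"
  shows "continuous_on A (\<lambda>t. u (of_real r * cis t))"
proof -
  have "continuous_on A (u \<circ> (\<lambda>t. of_real r * cis t))"
    by (intro continuous_on_compose continuous_intros)
      (rule continuous_on_subset[OF holomorphic_on_imp_continuous_on[OF assms(1)]],
       use assms in \<open>auto simp: norm_mult\<close>)
  then show ?thesis
    by (simp add: comp_def)
qed

text \<open>Integrate the conjugate power series of \<open>u\<close> against \<open>g\<close> term by term; it converges absolutely and
  uniformly on the circle of radius \<open>r\<close>.\<close>

lemma circle_integral_sums:
  assumes u: "u holomorphic_on \<bbbD>" and r: "0 \<le> r" "r < 1"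
    and g: "continuous_on {0..2 * pi} g"
  shows "(\<lambda>n. cnj (taylor_coeff u n) * of_real (r ^ n) * (\<integral>t. g t * cis (- (real n * t)) \<partial>circle_measure))
    sums (\<integral>t. g t * cnj (u (of_real r * cis t)) \<partial>circle_measure)"
proof -
  let ?c = "taylor_coeff u"
  define f where "f n t = cnj (?c n) * of_real (r ^ n) * (g t * cis (- (real n * t)))" for n t
  obtain G where "\<forall>t\<in>{0..2 * pi}. cmod (g t) \<le> G"
    using compact_imp_bounded[OF compact_continuous_image[OF g compact_Icc]]
    unfolding bounded_iff by auto
  then have G: "cmod (g t) \<le> G" if "t \<in> {0..2 * pi}" for t
    using that by blast
  have cont: "continuous_on {0..2 * pi} (f n)" for n
    unfolding f_def by (intro continuous_intros g)
  have summ: "summable (\<lambda>n. cmod (?c n) * r ^ n)"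
    using power_series_abs_summable[OF sums_summable[OF taylor_coeff_sums[OF u]]] r by simp
  have f_norm: "norm (f n t) = cmod (?c n) * r ^ n * cmod (g t)" for n t
    using r by (simp add: f_def norm_mult norm_power)
  have f_sums: "(\<lambda>n. f n t) sums (g t * cnj (u (of_real r * cis t)))" for t
  proof -
    have "(\<lambda>n. ?c n * (of_real r * cis t) ^ n) sums u (of_real r * cis t)"
      by (intro taylor_coeff_sums u) (use r in \<open>auto simp: norm_mult\<close>)
    then have "(\<lambda>n. g t * cnj (?c n * (of_real r * cis t) ^ n)) sums (g t * cnj (u (of_real r * cis t)))"
      by (intro sums_mult) (simp only: sums_cnj)
    moreover have "cnj (cis t ^ n) = cis (- (real n * t))" for n
      by (simp only: Complex.DeMoivre cis_cnj)
    then have "g t * cnj (?c n * (of_real r * cis t) ^ n) = f n t" for n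
      by (simp add: f_def power_mult_distrib flip: of_real_power del: complex_cnj_power)
    ultimately show ?thesis
      by simp
  qed
  have int: "integrable circle_measure (f n)" for n
    by (rule continuous_imp_integrable_real[OF cont])
  have "(\<lambda>n. integral\<^sup>L circle_measure (f n)) sums (\<integral>t. (\<Sum>n. f n t) \<partial>circle_measure)"
  proof (rule sums_integral[OF int])
    show "AE t in circle_measure. summable (\<lambda>n. norm (f n t))"
      unfolding f_norm by (intro AE_I2 summable_mult2 summ)
    show "summable (\<lambda>n. \<integral>t. norm (f n t) \<partial>circle_measure)"
    proof (rule summable_comparison_test')
      show "summable (\<lambda>n. cmod (?c n) * r ^ n * (2 * pi * G))"
        by (intro summable_mult2 summ)
      fix n
      have "(\<integral>t. norm (f n t) \<partial>circle_measure) \<le> (\<integral>t. cmod (?c n) * r ^ n * G \<partial>circle_measure)"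
        using r G unfolding f_norm
        by (intro integral_mono integrable_const_ivl mult_left_mono
            continuous_imp_integrable_real continuous_intros g) auto
      then show "norm (\<integral>t. norm (f n t) \<partial>circle_measure) \<le> cmod (?c n) * r ^ n * (2 * pi * G)"
        by (simp add: measure_restrict_space mult_ac)
    qed
  qed
  moreover have "(\<Sum>n. f n t) = g t * cnj (u (of_real r * cis t))" for t
    using f_sums by (rule sums_unique[symmetric])
  moreover have "integral\<^sup>L circle_measure (f n)
      = cnj (?c n) * of_real (r ^ n) * (\<integral>t. g t * cis (- (real n * t)) \<partial>circle_measure)" for n
    unfolding f_def by simp
  ultimately show ?thesis
    by simp
qed

text \<open>The preceding lemma with \<open>g\<close> a character computes the Fourier coefficients of \<open>u\<close> on the circle,
  and with \<open>g = u\<close> it expresses the mean of \<open>|u|\<^sup>2\<close> by them.\<close>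

theorem circle_Parseval:
  assumes u: "u holomorphic_on \<bbbD>" and r: "0 \<le> r" "r < 1"
  shows "(\<lambda>n. (cmod (taylor_coeff u n))\<^sup>2 * r ^ (2 * n))
    sums ((\<integral>t. (cmod (u (of_real r * cis t)))\<^sup>2 \<partial>circle_measure) / (2 * pi))"
proof -
  let ?c = "taylor_coeff u" and ?u = "\<lambda>t. u (of_real r * cis t)"
  note cont_u = continuous_on_circle[OF assms]
  have coeff: "(\<integral>t. ?u t * cis (- (real k * t)) \<partial>circle_measure) = 2 * pi * ?c k * of_real (r ^ k)" for k
  proof -
    have "(\<lambda>n. cnj (?c n) * of_real (r ^ n)
        * (\<integral>t. cis (real k * t) * cis (- (real n * t)) \<partial>circle_measure))
        sums (\<integral>t. cis (real k * t) * cnj (?u t) \<partial>circle_measure)"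
      by (intro circle_integral_sums assms continuous_intros)
    moreover have "(\<integral>t. cis (real k * t) * cis (- (real n * t)) \<partial>circle_measure)
        = (if n = k then 2 * pi else 0)" for n
      using circle_integral_cis[of "int k - int n"] by (simp add: cis_mult left_diff_distrib)
    ultimately have "(\<lambda>n. if n = k then cnj (?c n) * of_real (r ^ n) * (2 * pi) else 0)
        sums (\<integral>t. cis (real k * t) * cnj (?u t) \<partial>circle_measure)"
      by (simp add: if_distrib cong: if_cong)
    then have "(\<integral>t. cis (real k * t) * cnj (?u t) \<partial>circle_measure)
        = cnj (?c k) * of_real (r ^ k) * (2 * pi)"
      using sums_single[of k "\<lambda>n. cnj (?c n) * of_real (r ^ n) * (2 * pi)"] sums_unique2 by blast
    then have "cnj (\<integral>t. cis (real k * t) * cnj (?u t) \<partial>circle_measure)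
        = ?c k * of_real (r ^ k) * (2 * pi)"
      by simp
    moreover have "cnj (\<integral>t. cis (real k * t) * cnj (?u t) \<partial>circle_measure)
        = (\<integral>t. ?u t * cis (- (real k * t)) \<partial>circle_measure)"
      by (subst Bochner_Integration.integral_cnj[symmetric]) (simp add: cis_cnj mult.commute)
    ultimately show ?thesis
      by (simp add: mult_ac)
  qed
  have "(\<lambda>n. cnj (?c n) * of_real (r ^ n) * (\<integral>t. ?u t * cis (- (real n * t)) \<partial>circle_measure))
      sums (\<integral>t. ?u t * cnj (?u t) \<partial>circle_measure)"
    by (intro circle_integral_sums assms cont_u)
  moreover have "cnj (?c n) * of_real (r ^ n) * (\<integral>t. ?u t * cis (- (real n * t)) \<partial>circle_measure)
      = complex_of_real ((cmod (?c n))\<^sup>2 * r ^ (2 * n)) * (2 * pi)" for n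
  proof -
    have "complex_of_real (r ^ (2 * n)) = of_real (r ^ n) * of_real (r ^ n)"
      by (simp add: mult_2 power_add)
    then show ?thesis
      unfolding coeff of_real_mult complex_norm_square by (simp add: mult_ac)
  qed
  moreover have "(\<integral>t. ?u t * cnj (?u t) \<partial>circle_measure)
      = of_real (\<integral>t. (cmod (?u t))\<^sup>2 \<partial>circle_measure)"
    by (simp add: complex_norm_square[symmetric] del: of_real_power flip: integral_complex_of_real)
  ultimately have "(\<lambda>n. complex_of_real ((cmod (?c n))\<^sup>2 * r ^ (2 * n) * (2 * pi)))
      sums of_real (\<integral>t. (cmod (?u t))\<^sup>2 \<partial>circle_measure)"
    by simp
  then have "(\<lambda>n. (cmod (?c n))\<^sup>2 * r ^ (2 * n) * (2 * pi)) sums (\<integral>t. (cmod (?u t))\<^sup>2 \<partial>circle_measure)"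
    by (simp only: sums_of_real_iff)
  from sums_divide[OF this, of "2 * pi"] show ?thesis
    by simp
qed

lemma sum_le_of_Abel_sums:
  fixes c :: "nat \<Rightarrow> real"
  assumes "\<And>r. 0 < r \<Longrightarrow> r < 1 \<Longrightarrow> (\<Sum>n<N. c n * r ^ (2 * n)) \<le> B"
  shows "(\<Sum>n<N. c n) \<le> B"
proof -
  let ?r = "\<lambda>k. 1 - 1 / (real k + 2)"
  have "?r \<longlonglongrightarrow> 1"
    by real_asymp
  then have "(\<lambda>k. \<Sum>n<N. c n * ?r k ^ (2 * n)) \<longlonglongrightarrow> (\<Sum>n<N. c n * 1 ^ (2 * n))"
    by (intro tendsto_intros)
  moreover have "(\<Sum>n<N. c n * ?r k ^ (2 * n)) \<le> B" for k
    by (intro assms) (auto simp: field_simps)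
  ultimately show ?thesis
    by (intro LIMSEQ_le_const2) auto
qed

text \<open>Multiplication by a function bounded by \<open>K\<close> has norm at most \<open>K\<close> on the Hardy space of the
  disk: compare the means over each circle.\<close>

lemma mult_square_summable:
  assumes u: "u holomorphic_on \<bbbD>" "\<And>z. z \<in> \<bbbD> \<Longrightarrow> cmod (u z) \<le> K"
    and f: "f holomorphic_on \<bbbD>" "((\<lambda>n. (cmod (taylor_coeff f n))\<^sup>2) has_sum S) UNIV"
  shows "(\<Sum>n<N. (cmod (taylor_coeff (\<lambda>z. u z * f z) n))\<^sup>2) \<le> K\<^sup>2 * S"
proof (rule sum_le_of_Abel_sums)
  fix r :: real assume r: "0 < r" "r < 1"
  let ?m = "\<lambda>g. (\<integral>t. (cmod (g (of_real r * cis t)))\<^sup>2 \<partial>circle_measure) / (2 * pi)"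
  let ?uf = "\<lambda>z. u z * f z"
  have hol: "?uf holomorphic_on \<bbbD>"
    by (intro holomorphic_intros u f)
  have K: "K \<ge> 0"
    using u(2)[of 0] norm_ge_zero[of "u 0"] by (simp del: norm_ge_zero)
  have "(\<Sum>n<N. (cmod (taylor_coeff ?uf n))\<^sup>2 * r ^ (2 * n)) \<le> ?m ?uf"
  proof -
    note sums = circle_Parseval[OF hol less_imp_le[OF r(1)] r(2)]
    show ?thesis
      unfolding sums_unique[OF sums] using r by (intro sum_le_suminf sums_summable[OF sums]) auto
  qed
  also have "?m ?uf \<le> K\<^sup>2 * ?m f"
  proof -
    have "(\<integral>t. (cmod (?uf (of_real r * cis t)))\<^sup>2 \<partial>circle_measure)
        \<le> (\<integral>t. K\<^sup>2 * (cmod (f (of_real r * cis t)))\<^sup>2 \<partial>circle_measure)"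
    proof (rule integral_mono)
      show "integrable circle_measure (\<lambda>t. (cmod (?uf (of_real r * cis t)))\<^sup>2)"
        "integrable circle_measure (\<lambda>t. K\<^sup>2 * (cmod (f (of_real r * cis t)))\<^sup>2)"
        using r by (intro continuous_imp_integrable_real continuous_intros
            continuous_on_circle[OF hol] continuous_on_circle[OF f(1)]; simp)+
      show "(cmod (?uf (of_real r * cis t)))\<^sup>2 \<le> K\<^sup>2 * (cmod (f (of_real r * cis t)))\<^sup>2" for t
        unfolding norm_mult power_mult_distrib
        using r by (intro mult_right_mono power_mono u) (auto simp: norm_mult)
    qed
    from divide_right_mono[OF this, of "2 * pi"] show ?thesis
      by simp
  qed
  also have "?m f \<le> S"
  proof -
    have "(\<lambda>n. (cmod (taylor_coeff f n))\<^sup>2) sums S"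
      using f(2) by (rule has_sum_imp_sums)
    then show ?thesis
      using circle_Parseval[OF f(1), of r] r
      by (intro sums_le[of _ _ _ S]) (auto intro!: mult_right_le_one_le power_le_one)
  qed
  finally show "(\<Sum>n<N. (cmod (taylor_coeff ?uf n))\<^sup>2 * r ^ (2 * n)) \<le> K\<^sup>2 * S"
    by (simp add: mult_left_mono)
qed

definition bounded_analytic :: "(complex \<Rightarrow> complex) \<Rightarrow> bool"
  where "bounded_analytic u \<longleftrightarrow> u holomorphic_on \<bbbD> \<and> bounded (u ` \<bbbD>)"

lemma bounded_analyticE:
  assumes "bounded_analytic u"
  obtains K where "K \<ge> 0" "\<And>z. z \<in> \<bbbD> \<Longrightarrow> cmod (u z) \<le> K"
proof -
  from assms obtain K where K: "\<forall>z\<in>\<bbbD>. cmod (u z) \<le> K"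
    unfolding bounded_analytic_def bounded_iff by auto
  then have "cmod (u 0) \<le> K"
    by simp
  then have "K \<ge> 0"
    using norm_ge_zero order_trans by blast
  with K show ?thesis
    using that by blast
qed

lemma bounded_analyticI:
  assumes "u holomorphic_on \<bbbD>" "\<And>z. z \<in> \<bbbD> \<Longrightarrow> cmod (u z) \<le> K"
  shows "bounded_analytic u"
  using assms unfolding bounded_analytic_def bounded_iff by blast

lemma bounded_analytic_const [intro, simp]: "bounded_analytic (\<lambda>_. c)"
  by (rule bounded_analyticI[of _ "cmod c"]) auto

lemma bounded_analytic_id [intro, simp]: "bounded_analytic (\<lambda>z. z)"
  by (rule bounded_analyticI[of _ 1]) (auto intro: less_imp_le)

lemma bounded_analytic_mult [intro]:
  assumes "bounded_analytic u" "bounded_analytic v"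
  shows "bounded_analytic (\<lambda>z. u z * v z)"
proof -
  obtain K where K: "\<And>z. z \<in> \<bbbD> \<Longrightarrow> cmod (u z) \<le> K" "K \<ge> 0"
    using bounded_analyticE[OF assms(1)] by blast
  obtain L where L: "\<And>z. z \<in> \<bbbD> \<Longrightarrow> cmod (v z) \<le> L"
    using bounded_analyticE[OF assms(2)] by blast
  show ?thesis
    by (rule bounded_analyticI[of _ "K * L"])
      (use assms K L in \<open>auto simp: bounded_analytic_def norm_mult intro!: holomorphic_intros mult_mono\<close>)
qed

lemma bounded_analytic_add [intro]:
  assumes "bounded_analytic u" "bounded_analytic v"
  shows "bounded_analytic (\<lambda>z. u z + v z)"
proof -
  obtain K where K: "\<And>z. z \<in> \<bbbD> \<Longrightarrow> cmod (u z) \<le> K" "K \<ge> 0"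
    using bounded_analyticE[OF assms(1)] by blast
  obtain L where L: "\<And>z. z \<in> \<bbbD> \<Longrightarrow> cmod (v z) \<le> L"
    using bounded_analyticE[OF assms(2)] by blast
  show ?thesis
    by (rule bounded_analyticI[of _ "K + L"])
      (use assms K L in \<open>auto simp: bounded_analytic_def intro!: holomorphic_intros norm_triangle_mono\<close>)
qed

lemma bounded_analytic_diff [intro]:
  assumes "bounded_analytic u" "bounded_analytic v"
  shows "bounded_analytic (\<lambda>z. u z - v z)"
  using bounded_analytic_add[OF assms(1) bounded_analytic_mult[OF bounded_analytic_const assms(2)], of "-1"]
  by simp

lemma bounded_analytic_power [intro]: "bounded_analytic u \<Longrightarrow> bounded_analytic (\<lambda>z. u z ^ n)"
  by (induction n) auto

lemma bounded_analytic_holomorphic: "bounded_analytic u \<Longrightarrow> u holomorphic_on \<bbbD>"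
  by (simp add: bounded_analytic_def)

lemma taylor_coeff_one: "taylor_coeff (\<lambda>_. 1) = (\<lambda>n. if n = 0 then 1 else 0)"
  by (rule taylor_coeff_eqI(2)) (use sums_single[of 0 "\<lambda>n. _ ^ n"] in
        \<open>simp add: if_distrib[of "\<lambda>x. x * _"] cong: if_cong\<close>)

lemma bounded_analytic_square_summable:
  assumes "bounded_analytic u"
  shows "(\<lambda>n. (cmod (taylor_coeff u n))\<^sup>2) summable_on UNIV"
proof -
  obtain K where K: "\<And>z. z \<in> \<bbbD> \<Longrightarrow> cmod (u z) \<le> K"
    using bounded_analyticE[OF assms] by blast
  have "((\<lambda>n. (cmod (taylor_coeff (\<lambda>_. 1) n))\<^sup>2) has_sum 1) UNIV"
    unfolding taylor_coeff_one by (rule has_sum_finite_neutralI[of "{0}"]) auto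
  from mult_square_summable[OF bounded_analytic_holomorphic[OF assms] K _ this]
  have "(\<Sum>n<N. (cmod (taylor_coeff u n))\<^sup>2) \<le> K\<^sup>2" for N
    by simp
  then have "summable (\<lambda>n. (cmod (taylor_coeff u n))\<^sup>2)"
    by (intro summableI_nonneg_bounded) auto
  then show ?thesis
    by (simp add: summable_on_UNIV_nonneg_real_iff)
qed

subsection \<open>Inner functions\<close>

lemma inner_function_bounded_analytic: "inner_function \<theta> \<Longrightarrow> bounded_analytic \<theta>"
  by (simp add: inner_function_def bounded_analytic_def)

lemma Abel_means_tendsto:
  fixes c :: "nat \<Rightarrow> real"
  assumes "(c has_sum S) UNIV" "\<And>n. c n \<ge> 0"
  shows "(\<lambda>k. \<Sum>n. c n * (1 - 1 / (real k + 2)) ^ (2 * n)) \<longlonglongrightarrow> S"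
proof -
  let ?r = "\<lambda>k. 1 - 1 / (real k + 2)"
  have sums: "c sums S"
    using assms(1) by (rule has_sum_imp_sums)
  have r: "?r \<longlonglongrightarrow> 1"
    by real_asymp
  have "(\<lambda>k. \<Sum>n. c n * ?r k ^ (2 * n)) \<longlonglongrightarrow> suminf c"
  proof (rule conjunct2[OF conjunct2[OF tannerys_theorem]])
    show "(\<lambda>k. c n * ?r k ^ (2 * n)) \<longlonglongrightarrow> c n" for n
      using tendsto_mult[OF tendsto_const tendsto_power[OF r]] by simp
    have "norm (c n * ?r k ^ (2 * n)) \<le> c n" for n k
      using assms(2)[of n]
      by (auto simp: abs_mult power_abs intro!: mult_right_le_one_le power_le_one)
    then show "\<forall>\<^sub>F (n, k) in at_top \<times>\<^sub>F sequentially. norm (c n * ?r k ^ (2 * n)) \<le> c n"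
      by (intro always_eventually) auto
    show "summable c"
      using sums by (rule sums_summable)
  qed simp
  then show ?thesis
    using sums_unique[OF sums] by simp
qed

text \<open>The means of \<open>|\<theta> p|\<^sup>2\<close> and \<open>|p|\<^sup>2\<close> over the circles of radius \<open>r\<close> have the same limit as
  \<open>r\<close> tends to 1, by dominated convergence.\<close>

theorem inner_function_mult_isometric:
  assumes \<theta>: "inner_function \<theta>" and p: "bounded_analytic p"
  shows "(\<Sum>\<^sub>\<infinity>n. (cmod (taylor_coeff (\<lambda>z. \<theta> z * p z) n))\<^sup>2) = (\<Sum>\<^sub>\<infinity>n. (cmod (taylor_coeff p n))\<^sup>2)"
proof -
  note \<theta>' = inner_function_bounded_analytic[OF \<theta>]
  let ?q = "\<lambda>z. \<theta> z * p z"
  define r where "r k = 1 - 1 / (real k + 2)" for k :: nat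
  have r: "0 \<le> r k" "r k < 1" for k
    by (auto simp: r_def field_simps)
  have r_lim: "r \<longlonglongrightarrow> 1"
    unfolding r_def by real_asymp
  obtain K where K: "\<And>z. z \<in> \<bbbD> \<Longrightarrow> cmod (\<theta> z) \<le> K"
    using bounded_analyticE[OF \<theta>'] by blast
  obtain P where P: "\<And>z. z \<in> \<bbbD> \<Longrightarrow> cmod (p z) \<le> P"
    using bounded_analyticE[OF p] by blast
  let ?i = "\<lambda>g k. \<integral>t. (cmod (g (of_real (r k) * cis t)))\<^sup>2 \<partial>circle_measure"
  let ?S = "\<lambda>g. \<Sum>\<^sub>\<infinity>n. (cmod (taylor_coeff g n))\<^sup>2"
  have mean: "(\<lambda>k. ?i g k / (2 * pi)) \<longlonglongrightarrow> ?S g" if g: "bounded_analytic g" for g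
  proof -
    have "?i g k / (2 * pi) = (\<Sum>n. (cmod (taylor_coeff g n))\<^sup>2 * r k ^ (2 * n))" for k
      by (rule sums_unique[OF circle_Parseval[OF bounded_analytic_holomorphic[OF g] r]])
    then show ?thesis
      using Abel_means_tendsto[OF has_sum_infsum[OF bounded_analytic_square_summable[OF g]]]
      by (simp add: r_def)
  qed
  have disk: "of_real (r k) * cis t \<in> \<bbbD>" for k t
    using r[of k] by (simp add: norm_mult)
  have cont: "continuous_on {0..2 * pi} (\<lambda>t. g (of_real (r k) * cis t))" if "bounded_analytic g" for g k
    by (rule continuous_on_circle[OF bounded_analytic_holomorphic[OF that] r])
  \<comment> \<open>the difference of the two integrands, which tends to 0 wherever \<open>\<theta>\<close> has a unimodular radial limit\<close>
  define h where "h k t = ((cmod (\<theta> (of_real (r k) * cis t)))\<^sup>2 - 1) * (cmod (p (of_real (r k) * cis t)))\<^sup>2" for k t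
  have cont_h: "continuous_on {0..2 * pi} (h k)" for k
    unfolding h_def by (intro continuous_intros cont \<theta>' p)
  have "(\<lambda>k. integral\<^sup>L circle_measure (h k)) \<longlonglongrightarrow> integral\<^sup>L circle_measure (\<lambda>_. 0)"
  proof (rule integral_dominated_convergence[where w = "\<lambda>_. (K\<^sup>2 + 1) * P\<^sup>2"])
    show "h k \<in> borel_measurable circle_measure" for k
      by (rule continuous_imp_measurable_on_sets_lebesgue[OF cont_h]) simp
    have "norm (h k t) \<le> (K\<^sup>2 + 1) * P\<^sup>2" for k t
    proof -
      have "\<bar>(cmod (\<theta> (of_real (r k) * cis t)))\<^sup>2 - 1\<bar> \<le> K\<^sup>2 + 1"
        using power_mono[OF K[OF disk] norm_ge_zero, of k t 2]
          zero_le_power2[of "cmod (\<theta> (of_real (r k) * cis t))"] by linarith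
      then show ?thesis
        unfolding h_def real_norm_def abs_mult
        by (intro mult_mono) (auto intro!: power_mono P disk)
    qed
    then show "AE t in circle_measure. norm (h k t) \<le> (K\<^sup>2 + 1) * P\<^sup>2" for k
      by simp
    have "AE t in circle_measure.
        \<exists>\<zeta>. ((\<lambda>r. \<theta> (of_real r * cis t)) \<longlongrightarrow> \<zeta>) (at_left 1) \<and> cmod \<zeta> = 1"
      using \<theta> by (simp add: inner_function_def)
    then show "AE t in circle_measure. (\<lambda>k. h k t) \<longlonglongrightarrow> 0"
    proof eventually_elim
      case (elim t)
      then obtain \<zeta> where \<zeta>: "((\<lambda>r. \<theta> (of_real r * cis t)) \<longlongrightarrow> \<zeta>) (at_left 1)" "cmod \<zeta> = 1"
        by blast
      have "filterlim r (at_left 1) sequentially"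
        using r(2) by (intro tendsto_imp_filterlim_at_left[OF r_lim]) auto
      then have "(\<lambda>k. \<theta> (of_real (r k) * cis t)) \<longlonglongrightarrow> \<zeta>"
        by (rule filterlim_compose[OF \<zeta>(1)])
      then have "(\<lambda>k. (cmod (\<theta> (of_real (r k) * cis t)))\<^sup>2 - 1) \<longlonglongrightarrow> (cmod \<zeta>)\<^sup>2 - 1"
        by (intro tendsto_intros)
      then have lim: "(\<lambda>k. (cmod (\<theta> (of_real (r k) * cis t)))\<^sup>2 - 1) \<longlonglongrightarrow> 0"
        by (simp add: \<zeta>)
      show ?case
      proof (rule Lim_null_comparison)
        show "\<forall>\<^sub>F k in sequentially. norm (h k t) \<le> \<bar>(cmod (\<theta> (of_real (r k) * cis t)))\<^sup>2 - 1\<bar> * P\<^sup>2"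
          unfolding h_def real_norm_def abs_mult
          by (intro always_eventually allI mult_left_mono) (auto intro!: power_mono P disk)
        show "(\<lambda>k. \<bar>(cmod (\<theta> (of_real (r k) * cis t)))\<^sup>2 - 1\<bar> * P\<^sup>2) \<longlonglongrightarrow> 0"
          using tendsto_mult[OF tendsto_rabs[OF lim] tendsto_const, of "P\<^sup>2"] by simp
      qed
    qed
  qed auto
  moreover have "integral\<^sup>L circle_measure (h k) = ?i ?q k - ?i p k" for k
  proof -
    have "integrable circle_measure (\<lambda>t. (cmod (g (of_real (r k) * cis t)))\<^sup>2)" if "bounded_analytic g" for g
      by (intro continuous_imp_integrable_real continuous_intros cont that)
    note int = this[OF bounded_analytic_mult[OF \<theta>' p]] this[OF p]
    show ?thesis
      unfolding h_def Bochner_Integration.integral_diff[OF int, symmetric]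
      by (simp add: norm_mult power_mult_distrib left_diff_distrib)
  qed
  ultimately have "(\<lambda>k. ?i ?q k - ?i p k) \<longlonglongrightarrow> 0"
    by simp
  then have "(\<lambda>k. (?i ?q k - ?i p k) / (2 * pi)) \<longlonglongrightarrow> 0 / (2 * pi)"
    by (intro tendsto_intros) auto
  moreover have "(\<lambda>k. (?i ?q k - ?i p k) / (2 * pi)) \<longlonglongrightarrow> ?S ?q - ?S p"
    unfolding diff_divide_distrib by (intro tendsto_diff mean bounded_analytic_mult \<theta>' p)
  ultimately show ?thesis
    using LIMSEQ_unique by fastforce
qed

section \<open>Multiplication operators on the Hardy space over the bidisk\<close>

text \<open>The coefficient of \<open>z\<^sup>m\<close> in the expansion of \<open>f\<close> in powers of the first variable, a function of the
  second variable.\<close>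

definition slice :: "hardy2 \<Rightarrow> nat \<Rightarrow> complex \<Rightarrow> complex"
  where "slice f m w = (\<Sum>\<^sub>\<infinity>n. hcoeff f (m, n) * w ^ n)"

lemma row_has_sum_norm: "((\<lambda>m. \<Sum>\<^sub>\<infinity>n. (cmod (hcoeff f (m, n)))\<^sup>2) has_sum (norm f)\<^sup>2) UNIV"
  and row_summable_norm: "(\<lambda>n. (cmod (hcoeff f (m, n)))\<^sup>2) summable_on UNIV"
proof -
  have 1: "((\<lambda>k. (cmod (hcoeff f k))\<^sup>2) has_sum (norm f)\<^sup>2) (UNIV \<times> UNIV)"
    using norm_has_sum[of f] by simp
  then have "(\<lambda>(m, n). (cmod (hcoeff f (m, n)))\<^sup>2) summable_on (UNIV \<times> UNIV)"
    by (auto simp: summable_on_def case_prod_unfold)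
  from summable_on_SigmaD1[OF this]
  show 2: "(\<lambda>n. (cmod (hcoeff f (m, n)))\<^sup>2) summable_on UNIV" for m
    by simp
  show "((\<lambda>m. \<Sum>\<^sub>\<infinity>n. (cmod (hcoeff f (m, n)))\<^sup>2) has_sum (norm f)\<^sup>2) UNIV"
    by (rule has_sum_SigmaD[OF 1]) (simp add: 2)
qed

lemma slice_has_sum:
  assumes w: "w \<in> \<bbbD>"
  shows "((\<lambda>n. hcoeff f (m, n) * w ^ n) has_sum slice f m w) UNIV"
proof -
  have "((\<lambda>(m, n). hcoeff f (m, n) * (1/2) ^ m * w ^ n) has_sum hfun f (1/2, w)) (UNIV \<times> UNIV)"
    using hfun_has_sum[of "1/2" w f] w by simp
  then have "(\<lambda>(m, n). hcoeff f (m, n) * (1/2) ^ m * w ^ n) summable_on (UNIV \<times> UNIV)"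
    by (auto simp: summable_on_def)
  from summable_on_SigmaD1[OF this, of m]
  have "(\<lambda>n. 2 ^ m * (hcoeff f (m, n) * (1/2) ^ m * w ^ n)) summable_on UNIV"
    by (intro summable_on_cmult_right) simp
  then have "(\<lambda>n. hcoeff f (m, n) * w ^ n) summable_on UNIV"
    by (simp add: power_divide)
  then show ?thesis
    unfolding slice_def by (rule has_sum_infsum)
qed

lemma slice_sums: "w \<in> \<bbbD> \<Longrightarrow> (\<lambda>n. hcoeff f (m, n) * w ^ n) sums slice f m w"
  by (intro has_sum_imp_sums slice_has_sum)

lemma slice_holomorphic: "slice f m holomorphic_on \<bbbD>"
  and taylor_coeff_slice: "taylor_coeff (slice f m) = (\<lambda>n. hcoeff f (m, n))"
  by (rule taylor_coeff_eqI[OF slice_sums]; assumption)+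

lemma hfun_slice_has_sum:
  assumes "z \<in> \<bbbD>" "w \<in> \<bbbD>"
  shows "((\<lambda>m. z ^ m * slice f m w) has_sum hfun f (z, w)) UNIV"
proof (rule has_sum_SigmaD)
  show "((\<lambda>(m, n). hcoeff f (m, n) * z ^ m * w ^ n) has_sum hfun f (z, w)) (UNIV \<times> UNIV)"
    using hfun_has_sum[OF assms] by simp
  show "((\<lambda>n. case (m, n) of (m, n) \<Rightarrow> hcoeff f (m, n) * z ^ m * w ^ n) has_sum (z ^ m * slice f m w)) UNIV" for m
    using has_sum_cmult_right[OF slice_has_sum[OF assms(2)], of "z ^ m" f m] by (simp add: mult_ac)
qed

text \<open>Multiplication by \<open>u(w)\<close> acts on each slice separately, so the bound for one variable can be summed
  over the slices.\<close>

lemma mult_snd: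
  assumes u: "bounded_analytic u"
  shows hfun_mult_snd: "z \<in> \<bbbD> \<Longrightarrow> w \<in> \<bbbD> \<Longrightarrow> hfun (mult_snd u f) (z, w) = u w * hfun f (z, w)"
    and hcoeff_mult_snd: "hcoeff (mult_snd u f) (m, n) = taylor_coeff (\<lambda>w. u w * slice f m w) n"
    and norm_mult_snd_le: "(\<And>w. w \<in> \<bbbD> \<Longrightarrow> cmod (u w) \<le> K) \<Longrightarrow> norm (mult_snd u f) \<le> K * norm f"
proof -
  define b where "b = (\<lambda>(m, n). taylor_coeff (\<lambda>w. u w * slice f m w) n)"
  have hol: "(\<lambda>w. u w * slice f m w) holomorphic_on \<bbbD>" for m
    by (intro holomorphic_intros slice_holomorphic bounded_analytic_holomorphic u)
  have bound: "(\<Sum>k\<in>F. (cmod (b k))\<^sup>2) \<le> (K * norm f)\<^sup>2"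
    if K: "\<And>w. w \<in> \<bbbD> \<Longrightarrow> cmod (u w) \<le> K" and F: "finite F" for K F
  proof -
    obtain N where N: "F \<subseteq> {..<N} \<times> {..<N}"
    proof -
      have "finite (fst ` F \<union> snd ` F)"
        using F by simp
      then obtain N where "fst ` F \<union> snd ` F \<subseteq> {..<N}"
        using finite_nat_iff_bounded by blast
      then show ?thesis
        by (intro that[of N]) force
    qed
    have "(\<Sum>k\<in>F. (cmod (b k))\<^sup>2) \<le> (\<Sum>k\<in>{..<N} \<times> {..<N}. (cmod (b k))\<^sup>2)"
      by (intro sum_mono2 N) auto
    also have "\<dots> = (\<Sum>m<N. \<Sum>n<N. (cmod (b (m, n)))\<^sup>2)"
      by (simp add: sum.cartesian_product)
    also have "\<dots> \<le> (\<Sum>m<N. K\<^sup>2 * (\<Sum>\<^sub>\<infinity>n. (cmod (hcoeff f (m, n)))\<^sup>2))"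
    proof (rule sum_mono)
      fix m
      have "((\<lambda>n. (cmod (taylor_coeff (slice f m) n))\<^sup>2) has_sum (\<Sum>\<^sub>\<infinity>n. (cmod (hcoeff f (m, n)))\<^sup>2)) UNIV"
        unfolding taylor_coeff_slice by (intro has_sum_infsum row_summable_norm)
      from mult_square_summable[OF bounded_analytic_holomorphic[OF u] K slice_holomorphic this]
      show "(\<Sum>n<N. (cmod (b (m, n)))\<^sup>2) \<le> K\<^sup>2 * (\<Sum>\<^sub>\<infinity>n. (cmod (hcoeff f (m, n)))\<^sup>2)"
        by (simp add: b_def)
    qed
    also have "\<dots> = K\<^sup>2 * (\<Sum>m<N. \<Sum>\<^sub>\<infinity>n. (cmod (hcoeff f (m, n)))\<^sup>2)"
      by (simp add: sum_distrib_left)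
    also have "\<dots> \<le> K\<^sup>2 * (norm f)\<^sup>2"
      by (intro mult_left_mono finite_sum_le_has_sum[OF row_has_sum_norm]) (auto intro!: infsum_nonneg)
    finally show ?thesis
      by (simp add: power_mult_distrib)
  qed
  have b: "square_summable b"
  proof -
    obtain K where "\<And>w. w \<in> \<bbbD> \<Longrightarrow> cmod (u w) \<le> K"
      using bounded_analyticE[OF u] by blast
    from bound[OF this] show ?thesis
      by (rule square_summable_of_finite_sums)
  qed
  then obtain g where g: "hcoeff g = b"
    by (rule hcoeff_surj)
  have hfun_g: "hfun g (z, w) = u w * hfun f (z, w)" if zw: "z \<in> \<bbbD>" "w \<in> \<bbbD>" for z w
  proof -
    have "slice g m w = u w * slice f m w" for m
      using slice_sums[OF zw(2), of g m] taylor_coeff_sums[OF hol zw(2), of m]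
      by (simp add: g b_def sums_unique2)
    then have "((\<lambda>m. u w * (z ^ m * slice f m w)) has_sum hfun g (z, w)) UNIV"
      using hfun_slice_has_sum[OF zw, of g] by (simp add: mult_ac)
    moreover have "((\<lambda>m. u w * (z ^ m * slice f m w)) has_sum (u w * hfun f (z, w))) UNIV"
      by (intro has_sum_cmult_right hfun_slice_has_sum zw)
    ultimately show ?thesis
      using has_sum_unique by blast
  qed
  have eq: "mult_snd u f = g"
    unfolding hmult_def by (rule hardy2_of_eqI) (simp add: hfun_g)
  show "z \<in> \<bbbD> \<Longrightarrow> w \<in> \<bbbD> \<Longrightarrow> hfun (mult_snd u f) (z, w) = u w * hfun f (z, w)"
    unfolding eq by (rule hfun_g)
  show "hcoeff (mult_snd u f) (m, n) = taylor_coeff (\<lambda>w. u w * slice f m w) n"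
    unfolding eq g b_def by simp
  assume K: "\<And>w. w \<in> \<bbbD> \<Longrightarrow> cmod (u w) \<le> K"
  have "K \<ge> 0"
    by (rule order_trans[OF norm_ge_zero K[of 0]]) simp
  moreover have "(norm g)\<^sup>2 \<le> (K * norm f)\<^sup>2"
    by (rule norm_le_of_finite_sums, unfold g, rule bound[OF K])
  ultimately show "norm (mult_snd u f) \<le> K * norm f"
    unfolding eq by (simp add: power2_le_iff_abs_le)
qed

lemma mult_fst_eq_swap:
  assumes "bounded_analytic u"
  shows "mult_fst u f = hswap (mult_snd u (hswap f))"
  unfolding hmult_def[of "\<lambda>(z, w). u z"]
  by (rule hardy2_of_eqI) (simp add: hfun_hswap hfun_mult_snd assms)

lemma hfun_mult_fst:
  "bounded_analytic u \<Longrightarrow> z \<in> \<bbbD> \<Longrightarrow> w \<in> \<bbbD> \<Longrightarrow> hfun (mult_fst u f) (z, w) = u z * hfun f (z, w)"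
  by (simp add: mult_fst_eq_swap hfun_hswap hfun_mult_snd)

lemma norm_mult_fst_le:
  assumes "bounded_analytic u" "\<And>w. w \<in> \<bbbD> \<Longrightarrow> cmod (u w) \<le> K"
  shows "norm (mult_fst u f) \<le> K * norm f"
  using norm_mult_snd_le[OF assms, of "hswap f"] assms by (simp add: mult_fst_eq_swap)

lemma mult_snd_eq_swap:
  assumes "bounded_analytic u"
  shows "mult_snd u f = hswap (mult_fst u (hswap f))"
  by (simp add: mult_fst_eq_swap assms)

lemma mult_linear:
  assumes "bounded_analytic u"
  shows "mult_fst u (f + g) = mult_fst u f + mult_fst u g" "mult_fst u (f - g) = mult_fst u f - mult_fst u g"
    "mult_fst u (c *\<^sub>C f) = c *\<^sub>C mult_fst u f"
    "mult_snd u (f + g) = mult_snd u f + mult_snd u g" "mult_snd u (f - g) = mult_snd u f - mult_snd u g"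
    "mult_snd u (c *\<^sub>C f) = c *\<^sub>C mult_snd u f"
  by (rule hardy2_eqI_hfun; simp add: hfun_mult_fst hfun_mult_snd assms algebra_simps)+

lemma bounded_linear_mult_fst:
  assumes "bounded_analytic u"
  shows "bounded_linear (mult_fst u)"
proof -
  obtain K where "\<And>z. z \<in> \<bbbD> \<Longrightarrow> cmod (u z) \<le> K"
    using bounded_analyticE[OF assms] by blast
  from norm_mult_fst_le[OF assms this] show ?thesis
    by (intro bounded_linear_intro[of _ K]) (simp_all add: mult_linear assms scaleR_scaleC mult.commute)
qed

lemma bounded_linear_mult_snd:
  assumes "bounded_analytic u"
  shows "bounded_linear (mult_snd u)"
proof -
  obtain K where "\<And>z. z \<in> \<bbbD> \<Longrightarrow> cmod (u z) \<le> K"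
    using bounded_analyticE[OF assms] by blast
  from norm_mult_snd_le[OF assms this] show ?thesis
    by (intro bounded_linear_intro[of _ K]) (simp_all add: mult_linear assms scaleR_scaleC mult.commute)
qed

lemma mult_fst_mult_fst:
  "bounded_analytic u \<Longrightarrow> bounded_analytic v \<Longrightarrow> mult_fst u (mult_fst v f) = mult_fst (\<lambda>z. u z * v z) f"
  by (rule hardy2_eqI_hfun) (simp add: hfun_mult_fst bounded_analytic_mult)

text \<open>Polarization, over the reals and then in the imaginary direction.\<close>

lemma cinner_isometry:
  fixes T :: "'a::complex_inner \<Rightarrow> 'b::complex_inner"
  assumes norm: "\<And>f. f \<in> M \<Longrightarrow> norm (T f) = norm f" and M: "csubspace M"
    and lin: "\<And>f g. f \<in> M \<Longrightarrow> g \<in> M \<Longrightarrow> T (f + g) = T f + T g" "\<And>c f. f \<in> M \<Longrightarrow> T (c *\<^sub>C f) = c *\<^sub>C T f"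
    and fg: "f \<in> M" "g \<in> M"
  shows "cinner (T f) (T g) = cinner f g"
proof -
  have inner: "inner (T f) (T g) = inner f g" if "f \<in> M" "g \<in> M" for f g
    using that norm[of f] norm[of g] norm[of "f + g"] csubspace_add[OF M that]
    by (simp add: dot_norm lin)
  have "inner (T (\<i> *\<^sub>C f)) (T g) = inner (\<i> *\<^sub>C f) g"
    by (intro inner csubspace_scale M fg)
  with inner[OF fg] show ?thesis
    by (simp add: complex_eq_iff lin fg inner_eq_Re_cinner cinner_scaleC_left)
qed

lemma bounded_analytic_cong:
  assumes "bounded_analytic u" "\<And>z. z \<in> \<bbbD> \<Longrightarrow> v z = u z"
  shows "bounded_analytic v"
proof -
  have "v holomorphic_on \<bbbD>"
    using holomorphic_transform[OF bounded_analytic_holomorphic[OF assms(1)]] assms(2) by metis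
  moreover have "v ` \<bbbD> = u ` \<bbbD>"
    using assms(2) by (intro image_cong) auto
  ultimately show ?thesis
    using assms(1) by (simp add: bounded_analytic_def)
qed

text \<open>For functions with finitely many Taylor coefficients the one-variable result applies to
  each slice; these functions are dense.\<close>

lemma inner_function_norm_mult_snd:
  assumes \<theta>: "inner_function \<theta>"
  shows "norm (mult_snd \<theta> f) = norm f"
proof -
  note \<theta>' = inner_function_bounded_analytic[OF \<theta>]
  let ?P = "{f. \<forall>m. bounded_analytic (slice f m)}"
  have isometric: "norm (mult_snd \<theta> f) = norm f" if "f \<in> ?P" for f
  proof -
    have "(\<Sum>\<^sub>\<infinity>n. (cmod (hcoeff (mult_snd \<theta> f) (m, n)))\<^sup>2) = (\<Sum>\<^sub>\<infinity>n. (cmod (hcoeff f (m, n)))\<^sup>2)" for m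
      using inner_function_mult_isometric[OF \<theta>, of "slice f m"] that
      by (simp add: hcoeff_mult_snd[OF \<theta>'] taylor_coeff_slice)
    then have "((\<lambda>m. \<Sum>\<^sub>\<infinity>n. (cmod (hcoeff f (m, n)))\<^sup>2) has_sum (norm (mult_snd \<theta> f))\<^sup>2) UNIV"
      using row_has_sum_norm[of "mult_snd \<theta> f"] by simp
    then have "(norm (mult_snd \<theta> f))\<^sup>2 = (norm f)\<^sup>2"
      by (rule has_sum_unique[OF _ row_has_sum_norm])
    then show ?thesis
      by (simp add: power2_eq_iff_nonneg)
  qed
  have "cspan (range hmonom) \<subseteq> ?P"
  proof (intro complex_vector.span_minimal csubspaceI)
    have "slice (hmonom k) m w = (if m = fst k then w ^ snd k else 0)" if "w \<in> \<bbbD>" for k m w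
    proof -
      have "((\<lambda>n. hcoeff (hmonom k) (m, n) * w ^ n) has_sum (if m = fst k then w ^ snd k else 0)) UNIV"
        by (rule has_sum_finite_neutralI[of "{snd k}"]) (cases k, auto simp: hcoeff_hmonom)+
      then show ?thesis
        using slice_has_sum[OF that] has_sum_unique by blast
    qed
    moreover have "bounded_analytic (\<lambda>w. if m = fst k then w ^ snd k else 0)" for k :: "nat \<times> nat" and m
    proof (cases "m = fst k")
      case True
      then show ?thesis
        using bounded_analytic_power[OF bounded_analytic_id, of "snd k"] by simp
    qed simp
    ultimately have "bounded_analytic (slice (hmonom k) m)" for k m
      using bounded_analytic_cong by blast
    then show "range hmonom \<subseteq> ?P"
      by blast
  next
    have "slice 0 m w = 0" for m w
      by (simp add: slice_def)
    then show "0 \<in> ?P"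
      by (auto intro: bounded_analytic_cong[OF bounded_analytic_const[of 0]])
  next
    fix f g assume fg: "f \<in> ?P" "g \<in> ?P"
    have "slice (f + g) m w = slice f m w + slice g m w" if "w \<in> \<bbbD>" for m w
      using has_sum_add[OF slice_has_sum[OF that, of f m] slice_has_sum[OF that, of g m]]
        slice_has_sum[OF that, of "f + g" m] has_sum_unique by (simp add: distrib_right) blast
    with fg show "f + g \<in> ?P"
      by (auto intro: bounded_analytic_cong[OF bounded_analytic_add])
  next
    fix c f assume f: "f \<in> ?P"
    have "slice (c *\<^sub>C f) m w = c * slice f m w" if "w \<in> \<bbbD>" for m w
      using has_sum_cmult_right[OF slice_has_sum[OF that, of f m], of c]
        slice_has_sum[OF that, of "c *\<^sub>C f" m] has_sum_unique by (simp add: mult.assoc) blast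
    with f show "c *\<^sub>C f \<in> ?P"
      by (auto intro: bounded_analytic_cong[OF bounded_analytic_mult[OF bounded_analytic_const[of c]]])
  qed
  with isometric have "cspan (range hmonom) \<subseteq> {f. norm (mult_snd \<theta> f) = norm f}"
    by auto
  moreover have "closed {f. norm (mult_snd \<theta> f) = norm f}"
    by (intro closed_Collect_eq continuous_intros
        bounded_linear.continuous_on[OF bounded_linear_mult_snd[OF \<theta>']])
  ultimately have "closed_cspan (range hmonom) \<subseteq> {f. norm (mult_snd \<theta> f) = norm f}"
    by (rule closure_minimal)
  then show ?thesis
    by (auto simp: hmonom_total)
qed

lemma inner_function_norm_mult_fst: "inner_function \<theta> \<Longrightarrow> norm (mult_fst \<theta> f) = norm f"
  by (simp add: mult_fst_eq_swap inner_function_bounded_analytic inner_function_norm_mult_snd)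

lemma inner_function_cinner_mult:
  assumes "inner_function \<theta>"
  shows "cinner (mult_fst \<theta> f) (mult_fst \<theta> g) = cinner f g"
    "cinner (mult_snd \<theta> f) (mult_snd \<theta> g) = cinner f g"
  by (rule cinner_isometry[where M = UNIV];
      simp add: inner_function_norm_mult_fst inner_function_norm_mult_snd assms mult_linear
        inner_function_bounded_analytic complex_vector.subspace_UNIV)+

text \<open>As multiplication by \<open>\<theta>\<^sup>n\<close> is isometric, the values \<open>|\<theta> w|\<^sup>n\<close> are bounded in \<open>n\<close>.\<close>

lemma inner_function_le_1:
  assumes \<theta>: "inner_function \<theta>" and w: "w \<in> \<bbbD>"
  shows "cmod (\<theta> w) \<le> 1"
proof (rule ccontr)
  assume "\<not> cmod (\<theta> w) \<le> 1"
  then have gt: "cmod (\<theta> w) > 1"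
    by simp
  note \<theta>' = inner_function_bounded_analytic[OF \<theta>]
  define F where "F n = (mult_snd \<theta> ^^ n) (hmonom (0, 0))" for n
  have F: "norm (F n) = norm (hmonom (0, 0))" "hfun (F n) (0, w) = \<theta> w ^ n" for n
    unfolding F_def
    by (induction n) (simp_all add: inner_function_norm_mult_snd \<theta> \<theta>' hfun_mult_snd hfun_hmonom w[simplified])
  obtain K where K: "\<And>f. hfun f (0, w) = cinner f K"
    using reproducing_kernel[of 0 w] w by auto
  have "cmod (\<theta> w) ^ n \<le> norm (hmonom (0, 0)) * norm K" for n
    using cinner_Cauchy_Schwarz[of "F n" K] F[of n] K[of "F n"] by (simp add: norm_power)
  moreover obtain n where "norm (hmonom (0, 0)) * norm K < cmod (\<theta> w) ^ n"
    using real_arch_pow[OF gt] by blast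
  ultimately show False
    by (simp add: not_less[symmetric])
qed

lemma inner_function_maps_disk:
  assumes \<theta>: "inner_function \<theta>" "\<not> \<theta> constant_on \<bbbD>" and w: "w \<in> \<bbbD>"
  shows "\<theta> w \<in> \<bbbD>"
proof (rule ccontr)
  assume "\<theta> w \<notin> \<bbbD>"
  then have "cmod (\<theta> z) \<le> cmod (\<theta> w)" if "z \<in> \<bbbD>" for z
    using inner_function_le_1[OF \<theta>(1) that] by simp
  then have "\<theta> constant_on \<bbbD>"
    by (intro maximum_modulus_principle[of \<theta> \<bbbD> \<bbbD> w])
      (use \<theta> w in \<open>auto simp: inner_function_def\<close>)
  with \<theta>(2) show False
    by blast
qed

section \<open>Invariant subspaces\<close>

lemma hfun_eq_0_imp_eq_0: "(\<And>z w. z \<in> \<bbbD> \<Longrightarrow> w \<in> \<bbbD> \<Longrightarrow> hfun f (z, w) = 0) \<Longrightarrow> f = 0"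
  by (rule hardy2_eqI_hfun) simp

text \<open>Pointwise convergence of a bounded sequence is weak convergence, because the reproducing
  kernels are total; and a closed subspace is weakly closed.\<close>

lemma bounded_pointwise_limit_in_closed_subspace:
  assumes L: "closed L" "csubspace L" and X: "\<And>k. X k \<in> L" "\<And>k. norm (X k) \<le> B"
    and lim: "\<And>z w. z \<in> \<bbbD> \<Longrightarrow> w \<in> \<bbbD> \<Longrightarrow> (\<lambda>k. hfun (X k) (z, w)) \<longlonglongrightarrow> hfun f (z, w)"
  shows "f \<in> L"
proof -
  define G where "G = {g. (\<lambda>k. cinner g (X k)) \<longlonglongrightarrow> cinner g f}"
  define S where "S = {K. \<exists>z\<in>\<bbbD>. \<exists>w\<in>\<bbbD>. \<forall>f. hfun f (z, w) = cinner f K}"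
  have S_G: "S \<subseteq> G"
  proof
    fix K assume "K \<in> S"
    then obtain z w where zw: "z \<in> \<bbbD>" "w \<in> \<bbbD>" and K: "\<And>f. hfun f (z, w) = cinner f K"
      unfolding S_def by blast
    have "(\<lambda>k. cnj (cinner (X k) K)) \<longlonglongrightarrow> cnj (cinner f K)"
      unfolding K[symmetric] by (intro tendsto_intros lim zw)
    then show "K \<in> G"
      unfolding G_def mem_Collect_eq cinner_commute[of K] .
  qed
  have G_sub: "csubspace G"
    unfolding G_def by (rule csubspaceI) (simp_all add: cinner_simps tendsto_add tendsto_mult_left)
  have "closed G"
    unfolding closed_sequential_limits
  proof (intro allI impI, elim conjE)
    fix g l assume "\<forall>n. g n \<in> G" and g2: "g \<longlonglongrightarrow> l"
    note g = \<open>\<forall>n. g n \<in> G\<close>[rule_format] g2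
    define C where "C = \<bar>B\<bar> + norm f + 1"
    have C: "C > 0"
      by (simp add: C_def add_nonneg_pos)
    have "(\<lambda>k. cinner l (X k)) \<longlonglongrightarrow> cinner l f"
    proof (rule metric_LIMSEQ_I)
      fix e :: real assume e: "e > 0"
      then have "e / (2 * C) > 0"
        using C by simp
      then obtain n where n: "norm (l - g n) < e / (2 * C)"
        using g(2) by (metis LIMSEQ_D norm_minus_commute order_refl)
      have "(\<lambda>k. cinner (g n) (X k)) \<longlonglongrightarrow> cinner (g n) f" "0 < e / 2"
        using g(1)[of n] e by (simp_all add: G_def)
      from LIMSEQ_D[OF this] obtain N
        where N: "\<And>k. k \<ge> N \<Longrightarrow> cmod (cinner (g n) (X k) - cinner (g n) f) < e / 2"
        by blast
      have "dist (cinner l (X k)) (cinner l f) < e" if "k \<ge> N" for k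
      proof -
        have "norm (X k - f) \<le> C"
          using norm_triangle_ineq4[of "X k" f] X(2)[of k] unfolding C_def by linarith
        then have "cmod (cinner (l - g n) (X k - f)) \<le> norm (l - g n) * C"
          using cinner_Cauchy_Schwarz[of "l - g n" "X k - f"]
          by (meson mult_left_mono norm_ge_zero order_trans)
        also have "\<dots> < e / 2"
          using n C by (simp add: field_simps)
        finally have 1: "cmod (cinner (l - g n) (X k - f)) < e / 2" .
        have "cinner l (X k) - cinner l f
            = cinner (l - g n) (X k - f) + (cinner (g n) (X k) - cinner (g n) f)"
          by (simp add: cinner_simps)
        then show ?thesis
          using norm_triangle_lt[of "cinner (l - g n) (X k - f)" _ e] 1 N[OF that]
          unfolding dist_norm by simp
      qed
      then show "\<exists>N. \<forall>k\<ge>N. dist (cinner l (X k)) (cinner l f) < e"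
        by blast
    qed
    then show "l \<in> G"
      by (simp add: G_def)
  qed
  moreover have "closed_cspan S = UNIV"
  proof (rule orthogonal_trivial_imp_total[OF complete_hardy2])
    fix x assume x: "\<And>y. y \<in> S \<Longrightarrow> cinner y x = 0"
    show "x = 0"
    proof (rule hfun_eq_0_imp_eq_0)
      fix z w :: complex assume zw: "z \<in> \<bbbD>" "w \<in> \<bbbD>"
      obtain K where K: "\<And>f. hfun f (z, w) = cinner f K"
        using reproducing_kernel[OF zw] by blast
      then have "K \<in> S"
        unfolding S_def using zw by blast
      from x[OF this] show "hfun x (z, w) = 0"
        using cinner_commute[of x K] by (simp add: K)
    qed
  qed
  ultimately have G: "g \<in> G" for g
    using closed_cspan_minimal[OF S_G G_sub] by blast
  obtain p where p: "p \<in> L" "\<And>h. h \<in> L \<Longrightarrow> cinner h f = cinner h p"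
  proof (rule riesz_representation[OF closed_imp_complete_hardy2[OF L(1)] L(2), of "\<lambda>h. cinner h f" "norm f"])
    show "cmod (cinner h f) \<le> norm f * norm h" for h
      using cinner_Cauchy_Schwarz[of h f] by (simp add: mult.commute)
  qed (auto simp: cinner_simps)
  have orth: "cinner (f - p) h = 0" if "h \<in> L" for h
    using p(2)[OF that] cinner_commute[of "f - p" h] by (simp add: cinner_simps)
  have "(\<lambda>k. cinner (f - p) (X k)) \<longlonglongrightarrow> cinner (f - p) f"
    using G[of "f - p"] by (simp add: G_def)
  then have "cinner (f - p) f = 0"
    by (simp add: orth X LIMSEQ_const_iff)
  then have "cinner (f - p) (f - p) = 0"
    using orth[OF p(1)] by (simp add: cinner_diff_right)
  then have "f = p"
    by (simp add: cinner_self)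
  with p(1) show ?thesis
    by simp
qed

text \<open>The partial sums of \<open>\<Sum>c\<^sub>n u\<^sup>n\<close> are bounded by \<open>\<Sum>|c\<^sub>n|\<close> and converge pointwise to \<open>v\<close>.\<close>

lemma mult_fst_power_series_invariant:
  assumes L: "closed L" "csubspace L" and u: "bounded_analytic u" "\<And>z. z \<in> \<bbbD> \<Longrightarrow> cmod (u z) \<le> 1"
    and inv: "\<And>f. f \<in> L \<Longrightarrow> mult_fst u f \<in> L"
    and c: "summable (\<lambda>n. cmod (c n))"
    and v: "bounded_analytic v" "\<And>z. z \<in> \<bbbD> \<Longrightarrow> (\<lambda>n. c n * u z ^ n) sums v z"
    and f: "f \<in> L"
  shows "mult_fst v f \<in> L"
proof -
  define s where "s N = (\<lambda>z. \<Sum>n<N. c n * u z ^ n)" for N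
  have s: "bounded_analytic (s N)" for N
    unfolding s_def
    by (induction N) (simp_all add: u bounded_analytic_add bounded_analytic_mult bounded_analytic_power)
  have s_bound: "cmod (s N z) \<le> (\<Sum>n. cmod (c n))" if "z \<in> \<bbbD>" for N z
  proof -
    have "cmod (s N z) \<le> (\<Sum>n<N. cmod (c n) * 1)"
      unfolding s_def using u(2)[OF that]
      by (intro order_trans[OF norm_sum] sum_mono) (auto simp: norm_mult norm_power intro!: mult_left_le power_le_one)
    also have "\<dots> \<le> (\<Sum>n. cmod (c n))"
      using c by (simp add: sum_le_suminf)
    finally show ?thesis .
  qed
  have pow: "mult_fst (\<lambda>z. u z ^ n) f \<in> L" for n
  proof (induction n)
    case 0
    have "mult_fst (\<lambda>z. u z ^ 0) f = f"
      by (rule hardy2_eqI_hfun) (simp add: hfun_mult_fst)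
    with f show ?case
      by (simp only:)
  next
    case (Suc n)
    have "mult_fst (\<lambda>z. u z ^ Suc n) f = mult_fst u (mult_fst (\<lambda>z. u z ^ n) f)"
      using u(1) by (simp add: mult_fst_mult_fst bounded_analytic_power)
    with inv[OF Suc] show ?case
      by (simp only:)
  qed
  show ?thesis
  proof (rule bounded_pointwise_limit_in_closed_subspace[OF L])
    fix N
    show "mult_fst (s N) f \<in> L"
    proof (induction N)
      case 0
      have "mult_fst (s 0) f = 0"
        by (rule hardy2_eqI_hfun) (simp add: hfun_mult_fst s, simp add: s_def)
      then show ?case
        using csubspace_0[OF L(2)] by simp
    next
      case (Suc N)
      have "mult_fst (s (Suc N)) f = mult_fst (s N) f + c N *\<^sub>C mult_fst (\<lambda>z. u z ^ N) f"
        by (rule hardy2_eqI_hfun)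
          (simp add: hfun_mult_fst s bounded_analytic_power u(1), simp add: s_def algebra_simps)
      with Suc pow show ?case
        by (simp add: csubspace_add csubspace_scale L)
    qed
    show "norm (mult_fst (s N) f) \<le> (\<Sum>n. cmod (c n)) * norm f"
      by (rule norm_mult_fst_le[OF s s_bound])
  next
    fix z w :: complex assume zw: "z \<in> \<bbbD>" "w \<in> \<bbbD>"
    show "(\<lambda>N. hfun (mult_fst (s N) f) (z, w)) \<longlonglongrightarrow> hfun (mult_fst v f) (z, w)"
      using v(2)[OF zw(1)] unfolding sums_def
      by (simp add: hfun_mult_fst zw[simplified] s v(1)) (auto simp: s_def intro!: tendsto_intros)
  qed
qed

text \<open>The dilations \<open>u (r z)\<close> have absolutely summable Taylor coefficients and converge boundedly
  to \<open>u\<close>.\<close>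

lemma mult_fst_invariant:
  assumes L: "closed L" "csubspace L" and inv: "\<And>f. f \<in> L \<Longrightarrow> mult_fst (\<lambda>z. z) f \<in> L"
    and u: "bounded_analytic u" and f: "f \<in> L"
  shows "mult_fst u f \<in> L"
proof -
  define r where "r k = 1 - 1 / (real k + 2)" for k :: nat
  have r: "0 \<le> r k" "r k < 1" for k
    by (auto simp: r_def field_simps)
  have r_lim: "r \<longlonglongrightarrow> 1"
    unfolding r_def by real_asymp
  note hol = bounded_analytic_holomorphic[OF u]
  obtain K where K: "\<And>z. z \<in> \<bbbD> \<Longrightarrow> cmod (u z) \<le> K"
    using bounded_analyticE[OF u] by blast
  define v where "v k = (\<lambda>z. u (of_real (r k) * z))" for k
  have disk: "of_real (r k) * z \<in> \<bbbD>" if "z \<in> \<bbbD>" for k z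
    using r[of k] that mult_left_le_one_le[of "cmod z" "r k"] by (simp add: norm_mult)
  have v: "bounded_analytic (v k)" for k
  proof (rule bounded_analyticI)
    have "(u \<circ> (\<lambda>z. of_real (r k) * z)) holomorphic_on \<bbbD>"
      by (rule holomorphic_on_compose_gen[OF _ hol]) (use disk in \<open>auto intro!: holomorphic_intros\<close>)
    then show "v k holomorphic_on \<bbbD>"
      by (simp add: v_def comp_def)
    show "cmod (v k z) \<le> K" if "z \<in> \<bbbD>" for z
      unfolding v_def by (intro K disk that)
  qed
  show ?thesis
  proof (rule bounded_pointwise_limit_in_closed_subspace[OF L])
    fix k
    show "mult_fst (v k) f \<in> L"
    proof (rule mult_fst_power_series_invariant[OF L _ _ inv _ v _ f, of "\<lambda>n. taylor_coeff u n * of_real (r k ^ n)"])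
      have "summable (\<lambda>n. cmod (taylor_coeff u n) * r k ^ n)"
        by (rule power_series_abs_summable[OF sums_summable[OF taylor_coeff_sums[OF hol]] r])
      then show "summable (\<lambda>n. cmod (taylor_coeff u n * of_real (r k ^ n)))"
        using r[of k] by (simp add: norm_mult norm_power)
      show "(\<lambda>n. taylor_coeff u n * of_real (r k ^ n) * z ^ n) sums v k z" if "z \<in> \<bbbD>" for z
        using taylor_coeff_sums[OF hol disk[OF that], of k] by (simp add: v_def power_mult_distrib mult.assoc)
    qed (auto intro: less_imp_le)
    show "norm (mult_fst (v k) f) \<le> K * norm f"
      by (rule norm_mult_fst_le[OF v], unfold v_def, intro K disk)
  next
    fix z w :: complex assume zw: "z \<in> \<bbbD>" "w \<in> \<bbbD>"
    have "isCont u z"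
      using holomorphic_on_imp_continuous_on[OF hol] zw(1) by (simp add: continuous_on_eq_continuous_at)
    moreover have "(\<lambda>k. of_real (r k) * z) \<longlonglongrightarrow> of_real 1 * z"
      by (intro tendsto_intros r_lim)
    ultimately have "(\<lambda>k. v k z) \<longlonglongrightarrow> u z"
      unfolding v_def using isCont_tendsto_compose[of z u] by simp
    then show "(\<lambda>k. hfun (mult_fst (v k) f) (z, w)) \<longlonglongrightarrow> hfun (mult_fst u f) (z, w)"
      by (simp add: hfun_mult_fst zw[simplified] v u) (intro tendsto_intros)
  qed
qed

lemma hswap_image_iff: "f \<in> hswap ` L \<longleftrightarrow> hswap f \<in> L"
  by (metis hswap_hswap image_iff)

lemma closed_hswap_image: "closed L \<Longrightarrow> closed (hswap ` L)"
proof -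
  assume L: "closed L"
  have "bounded_linear hswap"
    by (rule bounded_linear_intro[of _ 1]) (simp_all add: hswap_add hswap_scaleC scaleR_scaleC)
  then have "closed (hswap -` L)"
    by (intro closed_vimage L linear_continuous_on)
  moreover have "hswap ` L = hswap -` L"
    using hswap_image_iff by blast
  ultimately show ?thesis
    by simp
qed

lemma csubspace_hswap_image: "csubspace L \<Longrightarrow> csubspace (hswap ` L)"
proof -
  have "hswap 0 = 0"
    by (rule hardy2_eqI_hfun) (simp add: hfun_hswap)
  then show "csubspace L \<Longrightarrow> csubspace (hswap ` L)"
    by (intro csubspaceI)
      (simp_all add: hswap_image_iff hswap_add hswap_scaleC csubspace_0 csubspace_add csubspace_scale)
qed

lemma mult_snd_invariant:
  assumes L: "closed L" "csubspace L" and inv: "\<And>f. f \<in> L \<Longrightarrow> mult_snd (\<lambda>w. w) f \<in> L"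
    and u: "bounded_analytic u" and f: "f \<in> L"
  shows "mult_snd u f \<in> L"
proof -
  have "mult_fst u (hswap f) \<in> hswap ` L"
  proof (rule mult_fst_invariant[OF closed_hswap_image[OF L(1)] csubspace_hswap_image[OF L(2)] _ u])
    show "hswap f \<in> hswap ` L"
      using f by blast
    fix g assume "g \<in> hswap ` L"
    then show "mult_fst (\<lambda>z. z) g \<in> hswap ` L"
      by (simp add: hswap_image_iff inv mult_fst_eq_swap)
  qed
  then show ?thesis
    by (simp add: hswap_image_iff mult_snd_eq_swap u)
qed

subsection \<open>Disk automorphisms\<close>

lemma disk_denominator_nonzero: "cmod a < 1 \<Longrightarrow> cmod z \<le> 1 \<Longrightarrow> 1 - cnj a * z \<noteq> 0"
proof
  assume a: "cmod a < 1" and z: "cmod z \<le> 1" and "1 - cnj a * z = 0"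
  then have "cmod (cnj a * z) = 1"
    by simp
  moreover have "cmod (cnj a * z) \<le> cmod a"
    using mult_left_le[OF z norm_ge_zero[of a]] by (simp add: norm_mult)
  ultimately show False
    using a by simp
qed

lemma disk_aut_in_disk:
  assumes "a \<in> \<bbbD>" "z \<in> \<bbbD>"
  shows "disk_aut a z \<in> \<bbbD>"
proof -
  have "cmod (disk_aut a z) = cmod (Moebius_function 0 a z)"
    by (simp add: disk_aut_def Moebius_function_simple norm_divide norm_minus_commute)
  then show ?thesis
    using Moebius_function_norm_lt_1[of a z 0] assms by simp
qed

lemma disk_aut_self [simp]: "disk_aut a a = 0"
  by (simp add: disk_aut_def)

lemma disk_aut_holomorphic: "a \<in> \<bbbD> \<Longrightarrow> disk_aut a holomorphic_on \<bbbD>"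
  unfolding disk_aut_def
  by (intro holomorphic_intros) (use disk_denominator_nonzero in \<open>auto intro: less_imp_le\<close>)

lemma disk_aut_involution:
  assumes "a \<in> \<bbbD>" "z \<in> \<bbbD>"
  shows "(a - disk_aut a z) / (1 - cnj a * disk_aut a z) = z"
proof -
  have nz: "1 - cnj a * z \<noteq> 0" "1 - cnj a * a \<noteq> 0"
    using assms disk_denominator_nonzero by (auto intro: less_imp_le)
  have "a - disk_aut a z = z * (1 - cnj a * a) / (1 - cnj a * z)"
    "1 - cnj a * disk_aut a z = (1 - cnj a * a) / (1 - cnj a * z)"
    using nz by (simp_all add: disk_aut_def field_simps)
  then show ?thesis
    using nz by simp
qed

lemma inner_function_disk_aut_comp:
  assumes a: "a \<in> \<bbbD>" and \<theta>: "inner_function \<theta>" and disk: "\<And>z. z \<in> \<bbbD> \<Longrightarrow> \<theta> z \<in> \<bbbD>"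
  shows "inner_function (\<lambda>z. disk_aut a (\<theta> z))"
  unfolding inner_function_def
proof (intro conjI)
  have "(disk_aut a \<circ> \<theta>) holomorphic_on \<bbbD>"
    using \<theta> disk by (intro holomorphic_on_compose_gen[OF _ disk_aut_holomorphic[OF a]])
      (auto simp: inner_function_def)
  then show "(\<lambda>z. disk_aut a (\<theta> z)) holomorphic_on \<bbbD>"
    by (simp add: comp_def)
  show "bounded ((\<lambda>z. disk_aut a (\<theta> z)) ` \<bbbD>)"
    using disk_aut_in_disk[OF a disk] unfolding bounded_iff by (intro exI[of _ 1]) (auto intro: less_imp_le)
  have "AE t in circle_measure.
      \<exists>\<zeta>. ((\<lambda>r. \<theta> (of_real r * cis t)) \<longlongrightarrow> \<zeta>) (at_left 1) \<and> cmod \<zeta> = 1"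
    using \<theta> by (simp add: inner_function_def)
  then show "AE t in circle_measure.
      \<exists>\<zeta>. ((\<lambda>r. disk_aut a (\<theta> (of_real r * cis t))) \<longlongrightarrow> \<zeta>) (at_left 1) \<and> cmod \<zeta> = 1"
  proof eventually_elim
    case (elim t)
    then obtain \<zeta> where \<zeta>: "((\<lambda>r. \<theta> (of_real r * cis t)) \<longlongrightarrow> \<zeta>) (at_left 1)" "cmod \<zeta> = 1"
      by blast
    have nz: "1 - cnj a * \<zeta> \<noteq> 0"
      using a \<zeta>(2) by (intro disk_denominator_nonzero) auto
    have "((\<lambda>r. disk_aut a (\<theta> (of_real r * cis t))) \<longlongrightarrow> disk_aut a \<zeta>) (at_left 1)"
      unfolding disk_aut_def by (intro tendsto_intros \<zeta>(1) nz)
    moreover have "cmod (disk_aut a \<zeta>) = 1"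
    proof -
      have "\<zeta> * cnj \<zeta> = 1"
        using \<zeta>(2) complex_norm_square[of \<zeta>] by simp
      then have "1 - cnj a * \<zeta> = \<zeta> * cnj (\<zeta> - a)"
        by (simp add: algebra_simps)
      then have "cmod (1 - cnj a * \<zeta>) = cmod (\<zeta> - a)"
        by (simp add: norm_mult \<zeta>(2) del: complex_cnj_diff)
      moreover have "\<zeta> \<noteq> a"
        using a \<zeta>(2) by auto
      ultimately show ?thesis
        by (simp add: disk_aut_def norm_divide norm_minus_commute)
    qed
    ultimately show ?case
      by blast
  qed
qed

lemma inner_function_id: "inner_function (\<lambda>z. z)"
  unfolding inner_function_def
proof (intro conjI)
  have "((\<lambda>r. of_real r * cis t) \<longlongrightarrow> of_real 1 * cis t) (at_left 1)" for t
    by (intro tendsto_intros)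
  then have "\<exists>\<zeta>. ((\<lambda>r. of_real r * cis t) \<longlongrightarrow> \<zeta>) (at_left 1) \<and> cmod \<zeta> = 1" for t
    by (intro exI[of _ "cis t"]) simp
  then show "AE t in circle_measure. \<exists>\<zeta>. ((\<lambda>r. of_real r * cis t) \<longlongrightarrow> \<zeta>) (at_left 1) \<and> cmod \<zeta> = 1"
    by simp
qed auto

lemma inner_function_disk_aut: "a \<in> \<bbbD> \<Longrightarrow> inner_function (disk_aut a)"
  using inner_function_disk_aut_comp[OF _ inner_function_id] by simp

lemma bounded_analytic_disk_aut [intro]: "a \<in> \<bbbD> \<Longrightarrow> bounded_analytic (disk_aut a)"
  by (intro inner_function_bounded_analytic inner_function_disk_aut)

lemma bounded_analytic_inverse_linear:
  assumes a: "a \<in> \<bbbD>" and u: "bounded_analytic u" "\<And>z. z \<in> \<bbbD> \<Longrightarrow> cmod (u z) \<le> 1"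
  shows "bounded_analytic (\<lambda>z. 1 / (1 - cnj a * u z))"
proof (rule bounded_analyticI)
  have nz: "1 - cnj a * u z \<noteq> 0" if "z \<in> \<bbbD>" for z
    using a u(2)[OF that] by (intro disk_denominator_nonzero) auto
  show "(\<lambda>z. 1 / (1 - cnj a * u z)) holomorphic_on \<bbbD>"
    by (intro holomorphic_intros bounded_analytic_holomorphic u nz)
  fix z :: complex assume z: "z \<in> \<bbbD>"
  have "cmod (cnj a * u z) \<le> cmod a"
    using mult_left_le[OF u(2)[OF z] norm_ge_zero[of a]] by (simp add: norm_mult)
  then have "1 - cmod a \<le> cmod (1 - cnj a * u z)"
    using norm_triangle_ineq2[of 1 "cnj a * u z"] by simp
  then show "cmod (1 / (1 - cnj a * u z)) \<le> 1 / (1 - cmod a)"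
    using a unfolding norm_divide by (intro divide_mono) auto
qed

text \<open>With \<open>u = disk_aut a z\<close> one has \<open>z = (a - u) / (1 - cnj a * u)\<close>, a geometric series in \<open>u\<close>.\<close>

lemma mult_fst_disk_aut_invariant:
  assumes L: "closed L" "csubspace L" and a: "a \<in> \<bbbD>"
    and inv: "\<And>f. f \<in> L \<Longrightarrow> mult_fst (disk_aut a) f \<in> L" and f: "f \<in> L"
  shows "mult_fst (\<lambda>z. z) f \<in> L"
proof -
  let ?v = "\<lambda>z. 1 / (1 - cnj a * disk_aut a z)"
  have le: "cmod (disk_aut a z) \<le> 1" if "z \<in> \<bbbD>" for z
    using disk_aut_in_disk[OF a that] by simp
  have v: "bounded_analytic ?v"
    by (intro bounded_analytic_inverse_linear a bounded_analytic_disk_aut le)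
  have g: "mult_fst ?v f \<in> L"
  proof (rule mult_fst_power_series_invariant[OF L bounded_analytic_disk_aut[OF a] le inv _ v _ f,
        of "\<lambda>n. cnj a ^ n"])
    show "summable (\<lambda>n. cmod (cnj a ^ n))"
      using a by (simp add: norm_power summable_geometric)
    fix z :: complex assume z: "z \<in> \<bbbD>"
    have "cmod (cnj a * disk_aut a z) < 1"
      using a mult_left_le[OF le[OF z] norm_ge_zero[of a]] by (simp add: norm_mult)
    from geometric_sums[OF this] show "(\<lambda>n. cnj a ^ n * disk_aut a z ^ n) sums ?v z"
      by (simp add: power_mult_distrib)
  qed
  have "mult_fst (\<lambda>z. z) f = a *\<^sub>C mult_fst ?v f - mult_fst (disk_aut a) (mult_fst ?v f)"
  proof (rule hardy2_eqI_hfun)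
    fix z w :: complex assume zw: "z \<in> \<bbbD>" "w \<in> \<bbbD>"
    have eq: "z = a * ?v z - disk_aut a z * ?v z"
      using disk_aut_involution[OF a zw(1)] by (simp add: diff_divide_distrib)
    have "z * hfun f (z, w) = a * (?v z * hfun f (z, w)) - disk_aut a z * (?v z * hfun f (z, w))"
      using arg_cong[OF eq, of "\<lambda>x. x * hfun f (z, w)"] by (simp only: left_diff_distrib mult.assoc)
    then show "hfun (mult_fst (\<lambda>z. z) f) (z, w)
        = hfun (a *\<^sub>C mult_fst ?v f - mult_fst (disk_aut a) (mult_fst ?v f)) (z, w)"
      by (simp only: hfun_mult_fst[OF _ zw] v bounded_analytic_disk_aut[OF a] bounded_analytic_id
          hfun_simps)
  qed
  then show ?thesis
    using g by (simp add: csubspace_diff csubspace_scale L inv)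
qed

section \<open>Elementary tensors and the inner product of one variable\<close>

text \<open>The inner product of the Hardy space over the disk, in terms of Taylor coefficients.\<close>

definition hardy_inner :: "(complex \<Rightarrow> complex) \<Rightarrow> (complex \<Rightarrow> complex) \<Rightarrow> complex"
  where "hardy_inner u v = (\<Sum>\<^sub>\<infinity>n. taylor_coeff u n * cnj (taylor_coeff v n))"

definition htensor :: "(complex \<Rightarrow> complex) \<Rightarrow> (complex \<Rightarrow> complex) \<Rightarrow> hardy2"
  where "htensor u v = hardy2_of (\<lambda>(z, w). u z * v w)"

lemma htensor_eq:
  assumes "bounded_analytic u" "bounded_analytic v"
  shows "htensor u v = mult_fst u (mult_snd v (hmonom (0, 0)))"
  unfolding htensor_def
  by (rule hardy2_of_eqI) (simp add: hfun_mult_fst hfun_mult_snd hfun_hmonom assms)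

lemma hfun_htensor:
  assumes "bounded_analytic u" "bounded_analytic v" "z \<in> \<bbbD>" "w \<in> \<bbbD>"
  shows "hfun (htensor u v) (z, w) = u z * v w"
  using assms by (simp add: htensor_eq hfun_mult_fst hfun_mult_snd hfun_hmonom)

lemma taylor_coeff_abs_summable:
  assumes "u holomorphic_on \<bbbD>" "z \<in> \<bbbD>"
  shows "(\<lambda>n. norm (taylor_coeff u n * z ^ n)) summable_on UNIV"
    "(\<Sum>\<^sub>\<infinity>n. taylor_coeff u n * z ^ n) = u z"
proof -
  have "summable (\<lambda>n. cmod (taylor_coeff u n) * cmod z ^ n)"
    by (rule power_series_abs_summable[OF sums_summable[OF taylor_coeff_sums[OF assms(1)]]])
      (use assms in auto)
  then have 1: "summable (\<lambda>n. norm (taylor_coeff u n * z ^ n))"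
    by (simp add: norm_mult norm_power)
  show "(\<Sum>\<^sub>\<infinity>n. taylor_coeff u n * z ^ n) = u z"
    by (rule infsumI, rule norm_summable_imp_has_sum[OF 1 taylor_coeff_sums[OF assms]])
  show "(\<lambda>n. norm (taylor_coeff u n * z ^ n)) summable_on UNIV"
    using norm_summable_imp_summable_on[of "\<lambda>n. norm (taylor_coeff u n * z ^ n)"] 1 by simp
qed

lemma hcoeff_htensor:
  assumes "bounded_analytic u" "bounded_analytic v"
  shows "hcoeff (htensor u v) = (\<lambda>(m, n). taylor_coeff u m * taylor_coeff v n)"
proof (rule hcoeff_eqI)
  note hol = assms[THEN bounded_analytic_holomorphic]
  show "power_series_on_bidisk (hfun (htensor u v)) (\<lambda>(m, n). taylor_coeff u m * taylor_coeff v n)"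
    unfolding power_series_on_bidisk_def
  proof (intro ballI)
    fix z w :: complex assume zw: "z \<in> \<bbbD>" "w \<in> \<bbbD>"
    show "((\<lambda>(m, n). (case (m, n) of (m, n) \<Rightarrow> taylor_coeff u m * taylor_coeff v n) * z ^ m * w ^ n)
        has_sum hfun (htensor u v) (z, w)) UNIV"
      using has_sum_product(1)[OF taylor_coeff_abs_summable(1)[OF hol(1) zw(1)]
          taylor_coeff_abs_summable(1)[OF hol(2) zw(2)]]
      unfolding taylor_coeff_abs_summable(2)[OF hol(1) zw(1)]
        taylor_coeff_abs_summable(2)[OF hol(2) zw(2)] hfun_htensor[OF assms zw]
      by (simp add: mult_ac)
  qed
qed

lemma hardy_inner_abs_summable:
  assumes "bounded_analytic u" "bounded_analytic v"
  shows "(\<lambda>n. norm (taylor_coeff u n * cnj (taylor_coeff v n))) summable_on UNIV"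
proof (rule Infinite_Sum.abs_summable_on_comparison_test')
  show "(\<lambda>n. (cmod (taylor_coeff u n))\<^sup>2 + (cmod (taylor_coeff v n))\<^sup>2) summable_on UNIV"
    by (intro summable_on_add bounded_analytic_square_summable assms)
  fix n
  have "2 * (cmod (taylor_coeff u n) * cmod (taylor_coeff v n))
      \<le> (cmod (taylor_coeff u n))\<^sup>2 + (cmod (taylor_coeff v n))\<^sup>2"
    using sum_squares_bound[of "cmod (taylor_coeff u n)" "cmod (taylor_coeff v n)"] by simp
  moreover have "0 \<le> cmod (taylor_coeff u n) * cmod (taylor_coeff v n)"
    by simp
  ultimately show "norm (taylor_coeff u n * cnj (taylor_coeff v n))
      \<le> (cmod (taylor_coeff u n))\<^sup>2 + (cmod (taylor_coeff v n))\<^sup>2"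
    unfolding norm_mult complex_mod_cnj by linarith
qed

lemma cinner_htensor:
  assumes "bounded_analytic u" "bounded_analytic v" "bounded_analytic u'" "bounded_analytic v'"
  shows "cinner (htensor u v) (htensor u' v') = hardy_inner u u' * hardy_inner v v'"
proof -
  have "((\<lambda>(m, n). (taylor_coeff u m * cnj (taylor_coeff u' m))
      * (taylor_coeff v n * cnj (taylor_coeff v' n))) has_sum hardy_inner u u' * hardy_inner v v') UNIV"
    unfolding hardy_inner_def by (intro has_sum_product(1) hardy_inner_abs_summable assms)
  then have "((\<lambda>k. hcoeff (htensor u v) k * cnj (hcoeff (htensor u' v') k))
      has_sum hardy_inner u u' * hardy_inner v v') UNIV"
    unfolding hcoeff_htensor[OF assms(1,2)] hcoeff_htensor[OF assms(3,4)]
    by (simp add: case_prod_unfold mult_ac)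
  with cinner_has_sum show ?thesis
    by (rule has_sum_unique)
qed

lemma hardy_inner_eq_cinner:
  assumes "bounded_analytic u" "bounded_analytic v"
  shows "hardy_inner u v = cinner (htensor u (\<lambda>_. 1)) (htensor v (\<lambda>_. 1))"
proof -
  have "hardy_inner (\<lambda>_. 1) (\<lambda>_. 1) = 1"
    unfolding hardy_inner_def taylor_coeff_one
    by (rule infsumI, rule has_sum_finite_neutralI[of "{0}"]) auto
  then show ?thesis
    using assms by (simp add: cinner_htensor)
qed

lemma hardy_inner_commute:
  "bounded_analytic u \<Longrightarrow> bounded_analytic v \<Longrightarrow> hardy_inner u v = cnj (hardy_inner v u)"
  using cinner_commute by (simp add: hardy_inner_eq_cinner)

lemma hardy_inner_cong:
  assumes "bounded_analytic u" "bounded_analytic v"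
    "\<And>z. z \<in> \<bbbD> \<Longrightarrow> u' z = u z" "\<And>z. z \<in> \<bbbD> \<Longrightarrow> v' z = v z"
  shows "hardy_inner u' v' = hardy_inner u v"
  using taylor_coeff_cong[OF bounded_analytic_holomorphic] assms unfolding hardy_inner_def by metis

lemma htensor_linear:
  assumes "bounded_analytic u" "bounded_analytic v" "bounded_analytic w"
  shows "htensor (\<lambda>z. u z + v z) w = htensor u w + htensor v w"
    "htensor (\<lambda>z. u z - v z) w = htensor u w - htensor v w"
  by (rule hardy2_eqI_hfun; simp add: hfun_htensor bounded_analytic_add bounded_analytic_diff
      assms algebra_simps)+

lemma htensor_scale:
  assumes "bounded_analytic u" "bounded_analytic w"
  shows "htensor (\<lambda>z. c * u z) w = c *\<^sub>C htensor u w"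
  by (rule hardy2_eqI_hfun) (simp add: hfun_htensor bounded_analytic_mult assms)

lemma hardy_inner_linear:
  assumes "bounded_analytic u" "bounded_analytic v" "bounded_analytic w"
  shows "hardy_inner (\<lambda>z. u z + v z) w = hardy_inner u w + hardy_inner v w"
    "hardy_inner (\<lambda>z. u z - v z) w = hardy_inner u w - hardy_inner v w"
    "hardy_inner w (\<lambda>z. u z + v z) = hardy_inner w u + hardy_inner w v"
    "hardy_inner w (\<lambda>z. u z - v z) = hardy_inner w u - hardy_inner w v"
  using assms
  by (simp_all add: hardy_inner_eq_cinner bounded_analytic_add bounded_analytic_diff
      htensor_linear cinner_simps)

lemma hardy_inner_scale:
  assumes "bounded_analytic u" "bounded_analytic w"
  shows "hardy_inner (\<lambda>z. c * u z) w = c * hardy_inner u w"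
    "hardy_inner w (\<lambda>z. c * u z) = cnj c * hardy_inner w u"
  using assms
  by (simp_all add: hardy_inner_eq_cinner bounded_analytic_mult htensor_scale cinner_simps)

lemma hardy_inner_mult_inner:
  assumes "inner_function \<tau>" "bounded_analytic u" "bounded_analytic v"
  shows "hardy_inner (\<lambda>z. \<tau> z * u z) (\<lambda>z. \<tau> z * v z) = hardy_inner u v"
proof -
  note \<tau> = inner_function_bounded_analytic[OF assms(1)]
  have "htensor (\<lambda>z. \<tau> z * u z) (\<lambda>_. 1) = mult_fst \<tau> (htensor u (\<lambda>_. 1))" if "bounded_analytic u" for u
    by (rule hardy2_eqI_hfun) (simp add: hfun_htensor hfun_mult_fst \<tau> that bounded_analytic_mult)
  then show ?thesis
    using assms by (simp add: hardy_inner_eq_cinner \<tau> bounded_analytic_mult inner_function_cinner_mult)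
qed

subsection \<open>Normalized Szego kernels\<close>

definition szego :: "complex \<Rightarrow> complex \<Rightarrow> complex"
  where "szego a z = of_real (sqrt (1 - (cmod a)\<^sup>2)) / (1 - cnj a * z)"

lemma szego_analytic:
  assumes "a \<in> \<bbbD>"
  shows "bounded_analytic (szego a)"
proof -
  have "bounded_analytic (\<lambda>z. 1 / (1 - cnj a * z))"
    by (rule bounded_analytic_inverse_linear[OF assms bounded_analytic_id]) (simp add: less_imp_le)
  from bounded_analytic_mult[OF bounded_analytic_const this] show ?thesis
    by (simp add: szego_def[abs_def])
qed

lemma szego_nonzero: "a \<in> \<bbbD> \<Longrightarrow> z \<in> \<bbbD> \<Longrightarrow> szego a z \<noteq> 0"
  using disk_denominator_nonzero[of a z] by (auto simp: szego_def power_less_one_iff abs_square_eq_1 less_imp_le)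

lemma szego_self:
  assumes "a \<in> \<bbbD>"
  shows "of_real (sqrt (1 - (cmod a)\<^sup>2)) * szego a a = 1"
proof -
  have pos: "1 - (cmod a)\<^sup>2 > 0"
    using assms by (simp add: power_less_one_iff)
  have eq: "1 - cnj a * a = complex_of_real (1 - (cmod a)\<^sup>2)"
    unfolding of_real_diff complex_norm_square by (simp add: mult.commute)
  have "of_real (sqrt (1 - (cmod a)\<^sup>2)) * szego a a
      = complex_of_real (sqrt (1 - (cmod a)\<^sup>2) * sqrt (1 - (cmod a)\<^sup>2) / (1 - (cmod a)\<^sup>2))"
    unfolding szego_def eq by (simp only: of_real_mult of_real_divide times_divide_eq_right)
  also have "\<dots> = 1"
    using pos by simp
  finally show ?thesis .
qed

lemma hardy_inner_szego:
  assumes a: "a \<in> \<bbbD>" and u: "bounded_analytic u"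
  shows "hardy_inner u (szego a) = of_real (sqrt (1 - (cmod a)\<^sup>2)) * u a"
proof -
  let ?c = "complex_of_real (sqrt (1 - (cmod a)\<^sup>2))"
  have tc: "taylor_coeff (szego a) = (\<lambda>n. ?c * cnj a ^ n)"
  proof (rule taylor_coeff_eqI(2))
    fix z :: complex assume "z \<in> \<bbbD>"
    then have "cmod (cnj a * z) < 1"
      using a mult_strict_mono'[of "cmod a" 1 "cmod z" 1] by (simp add: norm_mult)
    from sums_mult[OF geometric_sums[OF this], of ?c]
    show "(\<lambda>n. ?c * cnj a ^ n * z ^ n) sums szego a z"
      by (simp add: szego_def power_mult_distrib mult.assoc)
  qed
  have "hardy_inner u (szego a) = (\<Sum>\<^sub>\<infinity>n. ?c * (taylor_coeff u n * a ^ n))"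
    unfolding hardy_inner_def tc by (simp add: mult_ac)
  also have "\<dots> = ?c * (\<Sum>\<^sub>\<infinity>n. taylor_coeff u n * a ^ n)"
    by (rule infsum_cmult_right')
  also have "(\<Sum>\<^sub>\<infinity>n. taylor_coeff u n * a ^ n) = u a"
    by (rule taylor_coeff_abs_summable(2)[OF bounded_analytic_holomorphic[OF u] a])
  finally show ?thesis .
qed

subsection \<open>Division by a Blaschke factor\<close>

text \<open>The function \<open>(g - g a) / disk_aut a\<close>, with its removable singularity at \<open>a\<close> filled in.\<close>

definition blaschke_quotient :: "complex \<Rightarrow> (complex \<Rightarrow> complex) \<Rightarrow> complex \<Rightarrow> complex"
  where "blaschke_quotient a g z
    = - (1 - cnj a * z) * (if z = a then deriv g a else (g z - g a) / (z - a))"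

lemma blaschke_quotient:
  assumes a: "a \<in> \<bbbD>" and g: "bounded_analytic g"
  shows blaschke_quotient_analytic: "bounded_analytic (blaschke_quotient a g)"
    and disk_aut_mult_blaschke_quotient:
      "z \<in> \<bbbD> \<Longrightarrow> disk_aut a z * blaschke_quotient a g z = g z - g a"
proof -
  let ?d = "\<lambda>z. if z = a then deriv g a else (g z - g a) / (z - a)"
  have hol: "?d holomorphic_on \<bbbD>"
    by (rule pole_lemma_open[OF bounded_analytic_holomorphic[OF g]]) simp
  obtain K where K: "\<And>z. z \<in> \<bbbD> \<Longrightarrow> cmod (g z) \<le> K" "K \<ge> 0"
    using bounded_analyticE[OF g] by blast
  obtain r where r: "r > 0" "cball a r \<subseteq> \<bbbD>"
    using a open_contains_cball_eq[of \<bbbD>] by auto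
  have "compact (?d ` cball a r)"
    by (intro compact_continuous_image continuous_on_subset[OF holomorphic_on_imp_continuous_on[OF hol]] r)
      simp
  from compact_imp_bounded[OF this] obtain C where "\<forall>y\<in>?d ` cball a r. cmod y \<le> C"
    unfolding bounded_iff by blast
  then have C: "cmod (?d z) \<le> C" if "z \<in> cball a r" for z
    using that by blast
  have "bounded_analytic ?d"
  proof (rule bounded_analyticI[OF hol])
    fix z :: complex assume z: "z \<in> \<bbbD>"
    show "cmod (?d z) \<le> max C (2 * K / r)"
    proof (cases "z \<in> cball a r")
      case True
      from C[OF this] show ?thesis
        by (rule max.coboundedI1)
    next
      case False
      then have "r \<le> cmod (z - a)" "z \<noteq> a"
        using r by (auto simp: dist_norm norm_minus_commute)
      moreover have "cmod (g z - g a) \<le> 2 * K"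
        using norm_triangle_ineq4[of "g z" "g a"] K(1)[OF z] K(1)[OF a] by linarith
      ultimately have "cmod (?d z) \<le> 2 * K / r"
        using r(1) K(2) by (simp add: norm_divide frac_le)
      then show ?thesis
        by simp
    qed
  qed
  moreover have "bounded_analytic (\<lambda>z. - (1 - cnj a * z))"
    using bounded_analytic_diff[OF bounded_analytic_mult[OF bounded_analytic_const bounded_analytic_id] bounded_analytic_const, of "cnj a" 1]
    by simp
  ultimately show "bounded_analytic (blaschke_quotient a g)"
    unfolding blaschke_quotient_def[abs_def] by (rule bounded_analytic_mult[rotated])
  assume "z \<in> \<bbbD>"
  then have "1 - cnj a * z \<noteq> 0"
    using a by (intro disk_denominator_nonzero) auto
  moreover have "(- y) / d * (- d * (x / y)) = x" if "d \<noteq> 0" "y \<noteq> 0" for d x y :: complex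
    using that by simp
  ultimately have "z \<noteq> a \<Longrightarrow> (- (z - a)) / (1 - cnj a * z) * (- (1 - cnj a * z) * ((g z - g a) / (z - a))) = g z - g a"
    by (metis eq_iff_diff_eq_0)
  then show "disk_aut a z * blaschke_quotient a g z = g z - g a"
    by (cases "z = a") (simp_all only: disk_aut_def blaschke_quotient_def minus_diff_eq if_False
        simp_thms, simp)
qed

section \<open>The model space of an inner function\<close>

text \<open>The model space \<open>K = H\<^sup>2 \<ominus> \<tau> H\<^sup>2\<close> contains the normalized Szego kernel \<open>k\<close> at the zero \<open>a\<close> of \<open>\<tau>\<close>.
  Its elements are written as \<open>e k\<close>, so that \<open>k\<close> itself corresponds to the constant 1 and all
  operations below are multiplications. Bounded \<open>e\<close> suffice.\<close>

locale inner_with_zero =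
  fixes a :: complex and \<tau> :: "complex \<Rightarrow> complex"
  assumes a: "a \<in> \<bbbD>" and \<tau>: "inner_function \<tau>" and \<tau>_a: "\<tau> a = 0"
begin

definition kernel_inner :: "(complex \<Rightarrow> complex) \<Rightarrow> (complex \<Rightarrow> complex) \<Rightarrow> complex"
  where "kernel_inner e u = hardy_inner (\<lambda>z. e z * szego a z) (\<lambda>z. u z * szego a z)"

text \<open>The condition is that \<open>e k\<close> is orthogonal to \<open>\<tau> H\<^sup>2\<close>; it is tested on bounded \<open>h\<close> only, so that all
  products are in the domain of \<open>hardy_inner\<close>.\<close>

definition multipliers :: "(complex \<Rightarrow> complex) set"
  where "multipliers = {e. bounded_analytic e \<and>
    (\<forall>h. bounded_analytic h \<longrightarrow> hardy_inner (\<lambda>z. e z * szego a z) (\<lambda>z. \<tau> z * h z) = 0)}"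

text \<open>The inner function \<open>q\<close> with \<open>\<tau> = disk_aut a * q\<close>.\<close>

definition quotient :: "complex \<Rightarrow> complex"
  where "quotient = blaschke_quotient a \<tau>"

text \<open>The component of \<open>disk_aut a * e\<close> in the model space. Multiplication by the Blaschke factor maps
  the model space into \<open>K \<oplus> \<tau> k \<complex>\<close>; the coefficient of \<open>\<tau> k\<close> is
  \<open>kernel_inner e quotient\<close> by \<open>kernel_inner_quotient\<close> below.\<close>

definition forward :: "(complex \<Rightarrow> complex) \<Rightarrow> complex \<Rightarrow> complex"
  where "forward e = (\<lambda>z. disk_aut a z * e z - kernel_inner e quotient * \<tau> z)"

lemma analytic:
  "bounded_analytic \<tau>" "bounded_analytic (szego a)" "bounded_analytic (disk_aut a)"
  "bounded_analytic quotient"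
  unfolding quotient_def
  by (intro inner_function_bounded_analytic \<tau> szego_analytic a bounded_analytic_disk_aut
      blaschke_quotient_analytic)+

lemma disk_aut_mult_quotient: "z \<in> \<bbbD> \<Longrightarrow> disk_aut a z * quotient z = \<tau> z"
  unfolding quotient_def using disk_aut_mult_blaschke_quotient[OF a analytic(1)] by (simp add: \<tau>_a)

lemmas ba = analytic bounded_analytic_mult bounded_analytic_diff bounded_analytic_add
  bounded_analytic_power blaschke_quotient_analytic[OF a]

lemma multipliersD:
  assumes "e \<in> multipliers"
  shows "bounded_analytic e"
    "bounded_analytic h \<Longrightarrow> hardy_inner (\<lambda>z. e z * szego a z) (\<lambda>z. \<tau> z * h z) = 0"
    "bounded_analytic h \<Longrightarrow> hardy_inner (\<lambda>z. \<tau> z * h z) (\<lambda>z. e z * szego a z) = 0"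
proof -
  show 1: "bounded_analytic e"
    and 2: "bounded_analytic h \<Longrightarrow> hardy_inner (\<lambda>z. e z * szego a z) (\<lambda>z. \<tau> z * h z) = 0"
    using assms by (auto simp: multipliers_def)
  then show "bounded_analytic h \<Longrightarrow> hardy_inner (\<lambda>z. \<tau> z * h z) (\<lambda>z. e z * szego a z) = 0"
    using hardy_inner_commute[of "\<lambda>z. \<tau> z * h z" "\<lambda>z. e z * szego a z"] by (simp add: ba)
qed

lemma isometric_disk_aut:
  "bounded_analytic u \<Longrightarrow> bounded_analytic v \<Longrightarrow>
    hardy_inner (\<lambda>z. disk_aut a z * u z) (\<lambda>z. disk_aut a z * v z) = hardy_inner u v"
  by (rule hardy_inner_mult_inner[OF inner_function_disk_aut[OF a]])

lemma kernel_orthogonal: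
  assumes "bounded_analytic h" "h a = 0"
  shows "hardy_inner h (szego a) = 0" "hardy_inner (szego a) h = 0"
proof -
  show 1: "hardy_inner h (szego a) = 0"
    using hardy_inner_szego[OF a assms(1)] assms(2) by simp
  then show "hardy_inner (szego a) h = 0"
    using hardy_inner_commute[OF analytic(2) assms(1)] by simp
qed

lemma one_multiplier: "(\<lambda>_. 1) \<in> multipliers"
  by (simp add: multipliers_def kernel_orthogonal ba \<tau>_a)

lemma quotient_multiplier: "quotient \<in> multipliers"
  unfolding multipliers_def
proof (intro CollectI conjI allI impI analytic)
  fix h assume h: "bounded_analytic h"
  have "hardy_inner (\<lambda>z. quotient z * szego a z) (\<lambda>z. \<tau> z * h z)
      = hardy_inner (\<lambda>z. disk_aut a z * (quotient z * szego a z)) (\<lambda>z. disk_aut a z * (\<tau> z * h z))"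
    by (intro isometric_disk_aut[symmetric] ba h)
  also have "\<dots> = hardy_inner (\<lambda>z. \<tau> z * szego a z) (\<lambda>z. \<tau> z * (disk_aut a z * h z))"
  proof (intro hardy_inner_cong ba h)
    show "disk_aut a z * (quotient z * szego a z) = \<tau> z * szego a z" if "z \<in> \<bbbD>" for z
      using disk_aut_mult_quotient[OF that] by (simp flip: mult.assoc)
  qed simp
  also have "\<dots> = hardy_inner (szego a) (\<lambda>z. disk_aut a z * h z)"
    by (intro hardy_inner_mult_inner \<tau> ba h)
  also have "\<dots> = 0"
    by (intro kernel_orthogonal ba h) simp
  finally show "hardy_inner (\<lambda>z. quotient z * szego a z) (\<lambda>z. \<tau> z * h z) = 0" .
qed

lemma kernel_inner_one:
  assumes "bounded_analytic e"
  shows "kernel_inner e (\<lambda>_. 1) = e a"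
proof -
  have "kernel_inner e (\<lambda>_. 1) = of_real (sqrt (1 - (cmod a)\<^sup>2)) * (e a * szego a a)"
    using hardy_inner_szego[OF a, of "\<lambda>z. e z * szego a z"] assms by (simp add: kernel_inner_def ba)
  also have "\<dots> = e a"
    using szego_self[OF a] by (simp add: mult_ac)
  finally show ?thesis .
qed

lemma kernel_inner_commute:
  "bounded_analytic e \<Longrightarrow> bounded_analytic u \<Longrightarrow> kernel_inner e u = cnj (kernel_inner u e)"
  unfolding kernel_inner_def by (intro hardy_inner_commute ba)

text \<open>Multiplication by the Blaschke factor is isometric and turns \<open>quotient\<close> into \<open>\<tau>\<close>.\<close>

lemma kernel_inner_quotient:
  assumes "bounded_analytic e"
  shows "kernel_inner e quotient
    = hardy_inner (\<lambda>z. disk_aut a z * (e z * szego a z)) (\<lambda>z. \<tau> z * szego a z)"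
proof -
  have "kernel_inner e quotient
      = hardy_inner (\<lambda>z. disk_aut a z * (e z * szego a z)) (\<lambda>z. disk_aut a z * (quotient z * szego a z))"
    unfolding kernel_inner_def by (intro isometric_disk_aut[symmetric] ba assms)
  also have "\<dots> = hardy_inner (\<lambda>z. disk_aut a z * (e z * szego a z)) (\<lambda>z. \<tau> z * szego a z)"
  proof (intro hardy_inner_cong ba assms)
    show "disk_aut a z * (quotient z * szego a z) = \<tau> z * szego a z" if "z \<in> \<bbbD>" for z
      using disk_aut_mult_quotient[OF that] by (simp flip: mult.assoc)
  qed simp
  finally show ?thesis .
qed

lemma kernel_inner_quotient_quotient: "kernel_inner quotient quotient = 1"
proof -
  have "kernel_inner quotient quotient = hardy_inner (\<lambda>z. \<tau> z * szego a z) (\<lambda>z. \<tau> z * szego a z)"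
    unfolding kernel_inner_quotient[OF analytic(4)]
  proof (intro hardy_inner_cong ba)
    show "disk_aut a z * (quotient z * szego a z) = \<tau> z * szego a z" if "z \<in> \<bbbD>" for z
      using disk_aut_mult_quotient[OF that] by (simp flip: mult.assoc)
  qed simp
  also have "\<dots> = hardy_inner (szego a) (szego a)"
    by (intro hardy_inner_mult_inner \<tau> ba)
  also have "\<dots> = 1"
    using hardy_inner_szego[OF a analytic(2)] szego_self[OF a] by simp
  finally show ?thesis .
qed

text \<open>Write \<open>h = s k + disk_aut a * g\<close>. The term with \<open>g\<close> contributes 0 because \<open>e k\<close> is orthogonal to
  \<open>\<tau> g\<close>, and the multiple of \<open>\<tau>\<close> in \<open>forward e\<close> is chosen to cancel the term with \<open>s\<close>.\<close>

lemma forward_multiplier: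
  assumes e: "e \<in> multipliers"
  shows "forward e \<in> multipliers"
  unfolding multipliers_def
proof (intro CollectI conjI allI impI)
  note e' = multipliersD(1)[OF e]
  show "bounded_analytic (forward e)"
    unfolding forward_def by (intro ba e' bounded_analytic_const)
  fix h assume h: "bounded_analytic h"
  let ?c = "kernel_inner e quotient" and ?k = "szego a" and ?\<phi> = "disk_aut a"
  define s where "s = of_real (sqrt (1 - (cmod a)\<^sup>2)) * h a"
  define h' where "h' = (\<lambda>z. h z - s * ?k z)"
  have h': "bounded_analytic h'" "h' a = 0"
    unfolding h'_def using szego_self[OF a] h by (simp_all add: ba s_def mult_ac)
  let ?g = "blaschke_quotient a h'"
  have g: "bounded_analytic ?g"
    by (intro ba h')
  have 1: "hardy_inner (\<lambda>z. ?\<phi> z * (e z * ?k z)) (\<lambda>z. \<tau> z * h z) = cnj s * ?c"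
  proof -
    have "hardy_inner (\<lambda>z. ?\<phi> z * (e z * ?k z)) (\<lambda>z. \<tau> z * h z)
        = hardy_inner (\<lambda>z. ?\<phi> z * (e z * ?k z)) (\<lambda>z. s * (\<tau> z * ?k z) + ?\<phi> z * (\<tau> z * ?g z))"
    proof (intro hardy_inner_cong ba e' g h' bounded_analytic_const)
      fix z :: complex assume "z \<in> \<bbbD>"
      then have "h z = s * ?k z + ?\<phi> z * ?g z"
        using disk_aut_mult_blaschke_quotient[OF a h'(1)] h'(2) by (simp add: h'_def)
      then show "\<tau> z * h z = s * (\<tau> z * ?k z) + ?\<phi> z * (\<tau> z * ?g z)"
        by (simp add: algebra_simps)
    qed simp
    also have "\<dots> = cnj s * hardy_inner (\<lambda>z. ?\<phi> z * (e z * ?k z)) (\<lambda>z. \<tau> z * ?k z)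
        + hardy_inner (\<lambda>z. ?\<phi> z * (e z * ?k z)) (\<lambda>z. ?\<phi> z * (\<tau> z * ?g z))"
      by (simp add: hardy_inner_linear hardy_inner_scale ba e' g)
    also have "hardy_inner (\<lambda>z. ?\<phi> z * (e z * ?k z)) (\<lambda>z. ?\<phi> z * (\<tau> z * ?g z)) = 0"
      using multipliersD(2)[OF e g] by (simp add: isometric_disk_aut ba e' g)
    finally show ?thesis
      by (simp add: kernel_inner_quotient e')
  qed
  have 2: "hardy_inner (\<lambda>z. \<tau> z * ?k z) (\<lambda>z. \<tau> z * h z) = cnj s"
    using hardy_inner_mult_inner[OF \<tau> analytic(2) h] hardy_inner_commute[OF analytic(2) h]
      hardy_inner_szego[OF a h] by (simp add: s_def)
  have "hardy_inner (\<lambda>z. forward e z * ?k z) (\<lambda>z. \<tau> z * h z)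
      = hardy_inner (\<lambda>z. ?\<phi> z * (e z * ?k z) - ?c * (\<tau> z * ?k z)) (\<lambda>z. \<tau> z * h z)"
    by (simp add: forward_def algebra_simps)
  also have "\<dots> = hardy_inner (\<lambda>z. ?\<phi> z * (e z * ?k z)) (\<lambda>z. \<tau> z * h z)
      - ?c * hardy_inner (\<lambda>z. \<tau> z * ?k z) (\<lambda>z. \<tau> z * h z)"
    by (simp add: hardy_inner_linear hardy_inner_scale ba e' h)
  also have "\<dots> = cnj s * ?c - ?c * cnj s"
    by (simp only: 1 2)
  finally show "hardy_inner (\<lambda>z. forward e z * ?k z) (\<lambda>z. \<tau> z * h z) = 0"
    by simp
qed

lemma backward_multiplier:
  assumes e: "e \<in> multipliers"
  shows "blaschke_quotient a e \<in> multipliers"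
  unfolding multipliers_def
proof (intro CollectI conjI allI impI)
  note e' = multipliersD(1)[OF e]
  let ?b = "blaschke_quotient a e" and ?k = "szego a" and ?\<phi> = "disk_aut a"
  show "bounded_analytic ?b"
    by (intro ba e')
  fix h assume h: "bounded_analytic h"
  have "hardy_inner (\<lambda>z. ?b z * ?k z) (\<lambda>z. \<tau> z * h z)
      = hardy_inner (\<lambda>z. ?\<phi> z * (?b z * ?k z)) (\<lambda>z. ?\<phi> z * (\<tau> z * h z))"
    by (intro isometric_disk_aut[symmetric] ba e' h)
  also have "\<dots> = hardy_inner (\<lambda>z. e z * ?k z - e a * ?k z) (\<lambda>z. \<tau> z * (?\<phi> z * h z))"
  proof (intro hardy_inner_cong ba e' h bounded_analytic_const)
    show "?\<phi> z * (?b z * ?k z) = e z * ?k z - e a * ?k z" if "z \<in> \<bbbD>" for z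
      using disk_aut_mult_blaschke_quotient[OF a e' that]
      by (simp flip: mult.assoc left_diff_distrib)
  qed simp
  also have "\<dots> = hardy_inner (\<lambda>z. e z * ?k z) (\<lambda>z. \<tau> z * (?\<phi> z * h z))
      - e a * hardy_inner ?k (\<lambda>z. \<tau> z * (?\<phi> z * h z))"
    by (simp add: hardy_inner_linear hardy_inner_scale ba e' h)
  also have "\<dots> = 0"
    using multipliersD(2)[OF e, of "\<lambda>z. ?\<phi> z * h z"] kernel_orthogonal(2)[of "\<lambda>z. \<tau> z * (?\<phi> z * h z)"]
    by (simp add: ba h)
  finally show "hardy_inner (\<lambda>z. ?b z * ?k z) (\<lambda>z. \<tau> z * h z) = 0" .
qed

text \<open>\<open>forward\<close> and \<open>blaschke_quotient a\<close> are the compressed shift of the model space and its adjoint.\<close>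

lemma kernel_inner_forward:
  assumes e: "e \<in> multipliers" and u: "u \<in> multipliers"
  shows "kernel_inner (forward u) e = kernel_inner u (blaschke_quotient a e)"
proof -
  note e' = multipliersD(1)[OF e] and u' = multipliersD(1)[OF u]
  let ?b = "blaschke_quotient a e" and ?k = "szego a" and ?\<phi> = "disk_aut a"
  let ?c = "kernel_inner u quotient"
  have "kernel_inner (forward u) e = hardy_inner (\<lambda>z. ?\<phi> z * (u z * ?k z) - ?c * (\<tau> z * ?k z)) (\<lambda>z. e z * ?k z)"
    by (simp add: kernel_inner_def forward_def algebra_simps)
  also have "\<dots> = hardy_inner (\<lambda>z. ?\<phi> z * (u z * ?k z)) (\<lambda>z. e z * ?k z)"
    using multipliersD(3)[OF e analytic(2)] by (simp add: hardy_inner_linear hardy_inner_scale ba e' u')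
  also have "\<dots> = hardy_inner (\<lambda>z. ?\<phi> z * (u z * ?k z)) (\<lambda>z. e a * ?k z + ?\<phi> z * (?b z * ?k z))"
  proof (intro hardy_inner_cong ba e' u' bounded_analytic_const)
    show "e z * ?k z = e a * ?k z + ?\<phi> z * (?b z * ?k z)" if "z \<in> \<bbbD>" for z
      using disk_aut_mult_blaschke_quotient[OF a e' that]
      by (simp flip: mult.assoc distrib_right)
  qed simp
  also have "\<dots> = cnj (e a) * hardy_inner (\<lambda>z. ?\<phi> z * (u z * ?k z)) ?k
      + hardy_inner (\<lambda>z. ?\<phi> z * (u z * ?k z)) (\<lambda>z. ?\<phi> z * (?b z * ?k z))"
    by (simp add: hardy_inner_linear hardy_inner_scale ba e' u')
  also have "\<dots> = kernel_inner u ?b"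
    by (simp add: kernel_orthogonal isometric_disk_aut ba e' u' kernel_inner_def)
  finally show ?thesis .
qed

text \<open>Multiplication by \<open>\<tau>\<^sup>n\<close> is isometric, so a common power of \<open>\<tau>\<close> cancels; any remaining factor \<open>\<tau>\<close>
  makes one argument orthogonal to the model space.\<close>

lemma hardy_inner_power:
  assumes e: "e \<in> multipliers" and u: "u \<in> multipliers"
  shows "hardy_inner (\<lambda>z. e z * (\<tau> z ^ m * szego a z)) (\<lambda>z. u z * (\<tau> z ^ n * szego a z))
    = (if m = n then kernel_inner e u else 0)"
proof -
  note e' = multipliersD(1)[OF e] and u' = multipliersD(1)[OF u]
  let ?k = "szego a"
  have pow: "hardy_inner (\<lambda>z. \<tau> z ^ n * f z) (\<lambda>z. \<tau> z ^ n * g z) = hardy_inner f g"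
    if "bounded_analytic f" "bounded_analytic g" for n f g
  proof (induction n)
    case (Suc n)
    then show ?case
      using hardy_inner_mult_inner[OF \<tau>, of "\<lambda>z. \<tau> z ^ n * f z" "\<lambda>z. \<tau> z ^ n * g z"] that
      by (simp add: ba mult.assoc)
  qed simp
  have swap: "(\<lambda>z. f z * (\<tau> z ^ n * ?k z)) = (\<lambda>z. \<tau> z ^ n * (f z * ?k z))" for f n
    by (simp add: mult_ac)
  have add: "(\<lambda>z. \<tau> z ^ (m + Suc l) * (f z * ?k z)) = (\<lambda>z. \<tau> z ^ m * (\<tau> z * (\<tau> z ^ l * (f z * ?k z))))" for f m l
    by (simp add: power_add mult_ac)
  consider "m = n" | l where "n = m + Suc l" | l where "m = n + Suc l"
    using less_imp_Suc_add[of m n] less_imp_Suc_add[of n m] by (cases m n rule: linorder_cases) auto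
  then show ?thesis
  proof cases
    case 1
    then show ?thesis
      unfolding swap by (simp add: pow ba e' u' kernel_inner_def)
  next
    case 2
    then show ?thesis
      unfolding swap using multipliersD(2)[OF e, of "\<lambda>z. \<tau> z ^ l * (u z * ?k z)"]
      by (simp only: add) (simp add: pow ba e' u')
  next
    case 3
    then show ?thesis
      unfolding swap using multipliersD(3)[OF u, of "\<lambda>z. \<tau> z ^ l * (e z * ?k z)"]
      by (simp only: add) (simp add: pow ba e' u')
  qed
qed

end

section \<open>Submodules\<close>

lemma closed_cspan_map_into:
  assumes T: "bounded_linear T" "\<And>c f. T (c *\<^sub>C f) = c *\<^sub>C T f"
    and L: "closed L" "csubspace L" and gen: "\<And>f. f \<in> S \<Longrightarrow> T f \<in> L" and f: "f \<in> closed_cspan S"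
  shows "T f \<in> L"
proof -
  interpret T: bounded_linear T
    by (rule T)
  have "closed (T -` L)"
    by (intro closed_vimage L linear_continuous_on T)
  moreover have "csubspace (T -` L)"
    by (rule csubspaceI) (simp_all add: T.add T.zero T(2) csubspace_0 csubspace_add csubspace_scale L)
  ultimately have "closed_cspan S \<subseteq> T -` L"
    using gen by (intro closed_cspan_minimal) auto
  with f show ?thesis
    by blast
qed

lemma mult_snd_disk_aut_invariant:
  assumes L: "closed L" "csubspace L" and a: "a \<in> \<bbbD>"
    and inv: "\<And>f. f \<in> L \<Longrightarrow> mult_snd (disk_aut a) f \<in> L" and f: "f \<in> L"
  shows "mult_snd (\<lambda>w. w) f \<in> L"
proof -
  have "mult_fst (\<lambda>z. z) (hswap f) \<in> hswap ` L"
  proof (rule mult_fst_disk_aut_invariant[OF closed_hswap_image[OF L(1)] csubspace_hswap_image[OF L(2)] a])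
    show "hswap f \<in> hswap ` L"
      using f by blast
    fix g assume "g \<in> hswap ` L"
    then show "mult_fst (disk_aut a) g \<in> hswap ` L"
      using a by (simp add: hswap_image_iff inv mult_fst_eq_swap bounded_analytic_disk_aut)
  qed
  then show ?thesis
    by (simp add: hswap_image_iff mult_snd_eq_swap)
qed

lemma submoduleD:
  assumes "submodule M"
  shows "closed M" "csubspace M" "f \<in> M \<Longrightarrow> bounded_analytic u \<Longrightarrow> mult_fst u f \<in> M"
    "f \<in> M \<Longrightarrow> bounded_analytic u \<Longrightarrow> mult_snd u f \<in> M"
  using assms mult_fst_invariant[of M u f] mult_snd_invariant[of M u f] unfolding submodule_def by auto

lemma bounded_analytic_poly: "bounded_analytic (poly p)"
proof (induction p)
  case (pCons c p)
  have "bounded_analytic (\<lambda>z. c + z * poly p z)"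
    by (intro bounded_analytic_add bounded_analytic_mult pCons.IH bounded_analytic_const bounded_analytic_id)
  moreover have "poly (pCons c p) = (\<lambda>z. c + z * poly p z)"
    by (simp add: fun_eq_iff)
  ultimately show ?case
    by simp
next
  case 0
  have "poly 0 = (\<lambda>_ :: complex. 0 :: complex)"
    by (simp add: fun_eq_iff)
  then show ?case
    by simp
qed

lemma poly2_pCons: "poly2 (pCons c p) (z, w) = poly c z + w * poly2 p (z, w)"
  by (simp add: poly2_def)

lemma poly2_smult: "poly2 (smult c p) (z, w) = poly c z * poly2 p (z, w)"
  and poly2_one: "poly2 1 (z, w) = 1"
  by (simp_all add: poly2_def)

lemma hmult_poly2_exists:
  "\<exists>g. (\<forall>z\<in>\<bbbD>. \<forall>w\<in>\<bbbD>. hfun g (z, w) = poly2 p (z, w) * hfun f (z, w)) \<and>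
    (\<forall>L. submodule L \<longrightarrow> f \<in> L \<longrightarrow> g \<in> L)"
proof (induction p)
  case 0
  show ?case
    by (intro exI[of _ 0]) (auto simp: poly2_def submodule_def csubspace_0)
next
  case (pCons c p)
  then obtain g where g: "\<And>z w. z \<in> \<bbbD> \<Longrightarrow> w \<in> \<bbbD> \<Longrightarrow> hfun g (z, w) = poly2 p (z, w) * hfun f (z, w)"
    "\<And>L. submodule L \<Longrightarrow> f \<in> L \<Longrightarrow> g \<in> L"
    by blast
  show ?case
  proof (intro exI conjI allI impI ballI)
    show "hfun (mult_fst (poly c) f + mult_snd (\<lambda>w. w) g) (z, w) = poly2 (pCons c p) (z, w) * hfun f (z, w)"
      if "z \<in> \<bbbD>" "w \<in> \<bbbD>" for z w
      using that by (simp only: hfun_simps hfun_mult_fst[OF bounded_analytic_poly]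
          hfun_mult_snd[OF bounded_analytic_id] g poly2_pCons) (simp add: algebra_simps)
    show "mult_fst (poly c) f + mult_snd (\<lambda>w. w) g \<in> L" if "submodule L" "f \<in> L" for L
      using that by (intro csubspace_add submoduleD(2-4)[OF that(1)] g bounded_analytic_poly bounded_analytic_id)
  qed
qed

lemma hfun_hmult_poly2:
  "z \<in> \<bbbD> \<Longrightarrow> w \<in> \<bbbD> \<Longrightarrow> hfun (hmult (poly2 p) f) (z, w) = poly2 p (z, w) * hfun f (z, w)"
  and hmult_poly2_in_submodule: "submodule L \<Longrightarrow> f \<in> L \<Longrightarrow> hmult (poly2 p) f \<in> L"
proof -
  obtain g where g: "\<And>z w. z \<in> \<bbbD> \<Longrightarrow> w \<in> \<bbbD> \<Longrightarrow> hfun g (z, w) = poly2 p (z, w) * hfun f (z, w)"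
    "\<And>L. submodule L \<Longrightarrow> f \<in> L \<Longrightarrow> g \<in> L"
    using hmult_poly2_exists[of p f] by blast
  have "hmult (poly2 p) f = g"
    unfolding hmult_def by (rule hardy2_of_eqI) (simp add: g)
  with g show "z \<in> \<bbbD> \<Longrightarrow> w \<in> \<bbbD> \<Longrightarrow> hfun (hmult (poly2 p) f) (z, w) = poly2 p (z, w) * hfun f (z, w)"
    "submodule L \<Longrightarrow> f \<in> L \<Longrightarrow> hmult (poly2 p) f \<in> L"
    by auto
qed

lemma submodule_submodule_generated: "submodule (submodule_generated X)"
proof -
  let ?G = "{hmult (poly2 p) f | p f. f \<in> X}"
  have L: "closed (closed_cspan ?G)" "csubspace (closed_cspan ?G)"
    by (simp_all add: csubspace_closed_cspan)
  have "mult_fst (\<lambda>z. z) g \<in> closed_cspan ?G" if "g \<in> closed_cspan ?G" for g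
  proof (rule closed_cspan_map_into[OF bounded_linear_mult_fst _ L _ that])
    fix g assume "g \<in> ?G"
    then obtain p f where f: "f \<in> X" and g: "g = hmult (poly2 p) f"
      by blast
    have "mult_fst (\<lambda>z. z) g = hmult (poly2 (smult [:0, 1:] p)) f"
      by (rule hardy2_eqI_hfun)
        (simp add: g hfun_mult_fst[OF bounded_analytic_id] hfun_hmult_poly2 poly2_smult)
    then show "mult_fst (\<lambda>z. z) g \<in> closed_cspan ?G"
      using f by (intro closed_cspan_superset) auto
  qed (simp_all add: mult_linear)
  moreover have "mult_snd (\<lambda>w. w) g \<in> closed_cspan ?G" if "g \<in> closed_cspan ?G" for g
  proof (rule closed_cspan_map_into[OF bounded_linear_mult_snd _ L _ that])
    fix g assume "g \<in> ?G"
    then obtain p f where f: "f \<in> X" and g: "g = hmult (poly2 p) f"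
      by blast
    have "mult_snd (\<lambda>w. w) g = hmult (poly2 (pCons 0 p)) f"
      by (rule hardy2_eqI_hfun)
        (simp add: g hfun_mult_snd[OF bounded_analytic_id] hfun_hmult_poly2 poly2_pCons)
    then show "mult_snd (\<lambda>w. w) g \<in> closed_cspan ?G"
      using f by (intro closed_cspan_superset) auto
  qed (simp_all add: mult_linear)
  ultimately show ?thesis
    using L unfolding submodule_def submodule_generated_def by blast
qed

lemma submodule_generated_superset: "f \<in> X \<Longrightarrow> f \<in> submodule_generated X"
proof -
  assume "f \<in> X"
  moreover have "hmult (poly2 1) f = f"
    by (rule hardy2_eqI_hfun) (simp only: hfun_hmult_poly2 poly2_one mult_1)
  ultimately show ?thesis
    unfolding submodule_generated_def by (intro closed_cspan_superset) (metis (mono_tags, lifting) mem_Collect_eq)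
qed

lemma submodule_generated_minimal:
  assumes "submodule L" "X \<subseteq> L"
  shows "submodule_generated X \<subseteq> L"
  unfolding submodule_generated_def
  using assms hmult_poly2_in_submodule submoduleD[OF assms(1)] by (intro closed_cspan_minimal) auto

section \<open>Weighted composition with a pair of inner functions\<close>

locale inner_at =
  fixes \<theta> :: "complex \<Rightarrow> complex" and a :: complex
  assumes \<theta>: "inner_function \<theta>" and \<theta>_disk: "\<And>z. z \<in> \<bbbD> \<Longrightarrow> \<theta> z \<in> \<bbbD>" and a_disk: "a \<in> \<bbbD>"
begin

sublocale inner_with_zero a "\<lambda>z. disk_aut (\<theta> a) (\<theta> z)"
proof
  show "inner_function (\<lambda>z. disk_aut (\<theta> a) (\<theta> z))"
    by (intro inner_function_disk_aut_comp \<theta> \<theta>_disk a_disk)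
qed (use a_disk in simp_all)

text \<open>The factor by which composition with \<open>\<theta>\<close> has to be corrected so that it maps the normalized
  kernel at \<open>\<theta> a\<close> to the one at \<open>a\<close>; with it composition becomes isometric.\<close>

definition weight :: "complex \<Rightarrow> complex"
  where "weight z = szego a z / szego (\<theta> a) (\<theta> z)"

lemma szego_comp_analytic:
  "bounded_analytic (\<lambda>z. szego (\<theta> a) (\<theta> z))" "bounded_analytic (\<lambda>z. 1 / szego (\<theta> a) (\<theta> z))"
proof -
  note \<theta>' = inner_function_bounded_analytic[OF \<theta>]
  have "bounded_analytic (\<lambda>z. of_real (sqrt (1 - (cmod (\<theta> a))\<^sup>2)) * (1 / (1 - cnj (\<theta> a) * \<theta> z)))"
    by (intro bounded_analytic_mult bounded_analytic_const bounded_analytic_inverse_linear \<theta>' \<theta>_disk a_disk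
        inner_function_le_1 \<theta>)
  then show "bounded_analytic (\<lambda>z. szego (\<theta> a) (\<theta> z))"
    by (simp add: szego_def[abs_def])
  have "bounded_analytic (\<lambda>z. 1 / of_real (sqrt (1 - (cmod (\<theta> a))\<^sup>2)) * (1 - cnj (\<theta> a) * \<theta> z))"
    by (intro bounded_analytic_mult bounded_analytic_diff bounded_analytic_const \<theta>')
  then show "bounded_analytic (\<lambda>z. 1 / szego (\<theta> a) (\<theta> z))"
    by (simp add: szego_def[abs_def])
qed

lemma inverse_szego_analytic: "bounded_analytic (\<lambda>z. 1 / szego a z)"
proof -
  have "bounded_analytic (\<lambda>z. 1 / of_real (sqrt (1 - (cmod a)\<^sup>2)) * (1 - cnj a * z))"
    by (intro bounded_analytic_mult bounded_analytic_diff bounded_analytic_const bounded_analytic_id)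
  then show ?thesis
    by (simp add: szego_def[abs_def])
qed

lemma weight_analytic: "bounded_analytic weight" "bounded_analytic (\<lambda>z. 1 / weight z)"
  using bounded_analytic_mult[OF szego_analytic[OF a_disk] szego_comp_analytic(2)]
    bounded_analytic_mult[OF szego_comp_analytic(1) inverse_szego_analytic]
  by (simp_all add: weight_def[abs_def])

lemma weight_mult_szego: "z \<in> \<bbbD> \<Longrightarrow> weight z * szego (\<theta> a) (\<theta> z) = szego a z"
  using szego_nonzero[OF \<theta>_disk[OF a_disk] \<theta>_disk] by (simp add: weight_def)

lemma weight_nonzero: "z \<in> \<bbbD> \<Longrightarrow> weight z \<noteq> 0"
  using szego_nonzero[OF \<theta>_disk[OF a_disk] \<theta>_disk] szego_nonzero[OF a_disk] by (simp add: weight_def)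

lemma base_in_disk: "\<theta> a \<in> \<bbbD>"
  by (rule \<theta>_disk[OF a_disk])

end

lemma hardy_inner_disk_aut_powers:
  assumes "c \<in> \<bbbD>"
  shows "hardy_inner (\<lambda>z. disk_aut c z ^ m * szego c z) (\<lambda>z. disk_aut c z ^ n * szego c z)
    = (if m = n then 1 else 0)"
proof -
  interpret inner_with_zero c "disk_aut c"
    by standard (use assms inner_function_disk_aut[OF assms] in simp_all)
  show ?thesis
    using hardy_inner_power[OF one_multiplier one_multiplier, of m n] kernel_inner_one[of "\<lambda>_. 1"]
    by simp
qed

text \<open>The image of the monomial basis under weighted composition with the automorphisms
  \<open>disk_aut c\<close> and \<open>disk_aut d\<close>.\<close>

definition kernel_basis :: "complex \<Rightarrow> complex \<Rightarrow> nat \<Rightarrow> nat \<Rightarrow> hardy2"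
  where "kernel_basis c d m n =
    htensor (\<lambda>z. disk_aut c z ^ m * szego c z) (\<lambda>w. disk_aut d w ^ n * szego d w)"

lemma kernel_basis_analytic: "c \<in> \<bbbD> \<Longrightarrow> bounded_analytic (\<lambda>z. disk_aut c z ^ m * szego c z)"
  by (intro bounded_analytic_mult bounded_analytic_power bounded_analytic_disk_aut szego_analytic)

lemma hfun_kernel_basis:
  "c \<in> \<bbbD> \<Longrightarrow> d \<in> \<bbbD> \<Longrightarrow> z \<in> \<bbbD> \<Longrightarrow> w \<in> \<bbbD> \<Longrightarrow> hfun (kernel_basis c d m n) (z, w)
    = (disk_aut c z ^ m * szego c z) * (disk_aut d w ^ n * szego d w)"
  unfolding kernel_basis_def by (intro hfun_htensor kernel_basis_analytic)

text \<open>The closed span is invariant under the coordinate functions, because it is invariant under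
  \<open>disk_aut c\<close> and \<open>disk_aut d\<close>. Hence it contains the product of the first basis vector
  with any bounded analytic functions of one variable, in particular all monomials.\<close>

lemma kernel_basis_total:
  assumes c: "c \<in> \<bbbD>" and d: "d \<in> \<bbbD>"
  shows "closed_cspan (range (\<lambda>(m, n). kernel_basis c d m n)) = UNIV"
proof -
  let ?S = "range (\<lambda>(m, n). kernel_basis c d m n)" and ?b = "kernel_basis c d"
  let ?L = "closed_cspan ?S"
  have L: "closed ?L" "csubspace ?L"
    by (simp_all add: csubspace_closed_cspan)
  have b: "?b m n \<in> ?L" for m n
    by (intro closed_cspan_superset) auto
  have "mult_fst (disk_aut c) f \<in> ?L" if "f \<in> ?L" for f
  proof (rule closed_cspan_map_into[OF bounded_linear_mult_fst _ L _ that])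
    fix f assume "f \<in> ?S"
    then obtain m n where f: "f = ?b m n"
      by auto
    have "mult_fst (disk_aut c) f = ?b (Suc m) n"
      by (rule hardy2_eqI_hfun)
        (simp add: f hfun_mult_fst bounded_analytic_disk_aut c d hfun_kernel_basis c[simplified] d[simplified])
    then show "mult_fst (disk_aut c) f \<in> ?L"
      by (simp add: b)
  qed (use c in \<open>simp_all add: mult_linear bounded_analytic_disk_aut\<close>)
  from mult_fst_disk_aut_invariant[OF L c this] have z: "mult_fst (\<lambda>z. z) f \<in> ?L" if "f \<in> ?L" for f
    using that by blast
  have "mult_snd (disk_aut d) f \<in> ?L" if "f \<in> ?L" for f
  proof (rule closed_cspan_map_into[OF bounded_linear_mult_snd _ L _ that])
    fix f assume "f \<in> ?S"
    then obtain m n where f: "f = ?b m n"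
      by auto
    have "mult_snd (disk_aut d) f = ?b m (Suc n)"
      by (rule hardy2_eqI_hfun)
        (simp add: f hfun_mult_snd bounded_analytic_disk_aut c d hfun_kernel_basis c[simplified] d[simplified])
    then show "mult_snd (disk_aut d) f \<in> ?L"
      by (simp add: b)
  qed (use d in \<open>simp_all add: mult_linear bounded_analytic_disk_aut\<close>)
  from mult_snd_disk_aut_invariant[OF L d this] have w: "mult_snd (\<lambda>w. w) f \<in> ?L" if "f \<in> ?L" for f
    using that by blast
  interpret C: inner_at "\<lambda>z. z" c
    by standard (use c in \<open>simp_all add: inner_function_id\<close>)
  interpret D: inner_at "\<lambda>z. z" d
    by standard (use d in \<open>simp_all add: inner_function_id\<close>)
  have "hmonom (i, j) \<in> ?L" for i j
  proof -
    let ?u = "\<lambda>z. z ^ i * (1 / szego c z)" and ?v = "\<lambda>w. w ^ j * (1 / szego d w)"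
    have uv: "bounded_analytic ?u" "bounded_analytic ?v"
      by (intro bounded_analytic_mult bounded_analytic_power bounded_analytic_id
          C.inverse_szego_analytic D.inverse_szego_analytic)+
    have "hmonom (i, j) = mult_fst ?u (mult_snd ?v (?b 0 0))"
    proof (rule hardy2_eqI_hfun)
      fix z w :: complex assume zw: "z \<in> \<bbbD>" "w \<in> \<bbbD>"
      show "hfun (hmonom (i, j)) (z, w) = hfun (mult_fst ?u (mult_snd ?v (?b 0 0))) (z, w)"
        unfolding hfun_hmonom[OF zw] hfun_mult_fst[OF uv(1) zw] hfun_mult_snd[OF uv(2) zw]
          hfun_kernel_basis[OF c d zw]
        using szego_nonzero[OF c zw(1)] szego_nonzero[OF d zw(2)] by simp
    qed
    then show ?thesis
      using mult_fst_invariant[OF L z uv(1) mult_snd_invariant[OF L w uv(2) b]] by simp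
  qed
  then have "range hmonom \<subseteq> ?L"
    by auto
  from closed_cspan_minimal[OF this L(2,1)] show ?thesis
    using hmonom_total by auto
qed

locale inner_pair = fst: inner_at \<theta> a + snd: inner_at \<phi> b for \<theta> a \<phi> b
begin

definition wcomp :: "hardy2 \<Rightarrow> hardy2"
  where "wcomp f = hardy2_of (\<lambda>(z, w). fst.weight z * snd.weight w * hfun f (\<theta> z, \<phi> w))"

definition wcomp_defined :: "hardy2 \<Rightarrow> bool"
  where "wcomp_defined f \<longleftrightarrow> in_hardy2 (\<lambda>(z, w). fst.weight z * snd.weight w * hfun f (\<theta> z, \<phi> w))"

lemma wcomp_eqI:
  assumes "\<And>z w. z \<in> \<bbbD> \<Longrightarrow> w \<in> \<bbbD> \<Longrightarrow> hfun g (z, w) = fst.weight z * snd.weight w * hfun f (\<theta> z, \<phi> w)"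
  shows "wcomp f = g" "wcomp_defined f"
proof -
  show "wcomp f = g"
    unfolding wcomp_def by (rule hardy2_of_eqI) (simp add: assms)
  show "wcomp_defined f"
    unfolding wcomp_defined_def in_hardy2_def by (intro exI[of _ g]) (simp add: assms)
qed

lemma hfun_wcomp':
  "wcomp_defined f \<Longrightarrow> z \<in> \<bbbD> \<Longrightarrow> w \<in> \<bbbD> \<Longrightarrow>
    hfun (wcomp f) (z, w) = fst.weight z * snd.weight w * hfun f (\<theta> z, \<phi> w)"
  unfolding wcomp_def wcomp_defined_def by (simp add: hfun_hardy2_of)

lemma wcomp_linear':
  assumes "wcomp_defined f" "wcomp_defined g"
  shows "wcomp (f + g) = wcomp f + wcomp g" "wcomp_defined (f + g)"
    "wcomp (c *\<^sub>C f) = c *\<^sub>C wcomp f" "wcomp_defined (c *\<^sub>C f)"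
  using wcomp_eqI[of "wcomp f + wcomp g" "f + g"] wcomp_eqI[of "c *\<^sub>C wcomp f" "c *\<^sub>C f"] assms
  by (auto simp: hfun_wcomp' algebra_simps)

text \<open>With \<open>e\<close> and \<open>d\<close> in the model spaces and \<open>f\<close> in the Hardy space these vectors realize the
  tensor product decomposition of the Hardy space over the bidisk.\<close>

definition tensor :: "(complex \<Rightarrow> complex) \<Rightarrow> (complex \<Rightarrow> complex) \<Rightarrow> hardy2 \<Rightarrow> hardy2"
  where "tensor e d f = mult_fst e (mult_snd d (wcomp f))"

abbreviation "\<tau> z \<equiv> disk_aut (\<theta> a) (\<theta> z)"
abbreviation "\<sigma> w \<equiv> disk_aut (\<phi> b) (\<phi> w)"
abbreviation "basis \<equiv> \<lambda>(m, n). kernel_basis (\<theta> a) (\<phi> b) m n"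

lemma wcomp_basis:
  "wcomp (basis (m, n)) = htensor (\<lambda>z. \<tau> z ^ m * szego a z) (\<lambda>w. \<sigma> w ^ n * szego b w)"
  "wcomp_defined (basis (m, n))"
proof -
  have "hfun (htensor (\<lambda>z. \<tau> z ^ m * szego a z) (\<lambda>w. \<sigma> w ^ n * szego b w)) (z, w)
      = fst.weight z * snd.weight w * hfun (basis (m, n)) (\<theta> z, \<phi> w)" if zw: "z \<in> \<bbbD>" "w \<in> \<bbbD>" for z w
  proof -
    have "hfun (htensor (\<lambda>z. \<tau> z ^ m * szego a z) (\<lambda>w. \<sigma> w ^ n * szego b w)) (z, w)
        = (\<tau> z ^ m * szego a z) * (\<sigma> w ^ n * szego b w)"
      by (intro hfun_htensor fst.ba snd.ba zw)
    then show ?thesis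
      unfolding split_conv fst.weight_mult_szego[OF zw(1), symmetric]
        snd.weight_mult_szego[OF zw(2), symmetric] hfun_kernel_basis[OF fst.base_in_disk
          snd.base_in_disk fst.\<theta>_disk[OF zw(1)] snd.\<theta>_disk[OF zw(2)]]
      by (simp only: mult_ac)
  qed
  from wcomp_eqI[OF this] show "wcomp (basis (m, n)) = htensor (\<lambda>z. \<tau> z ^ m * szego a z) (\<lambda>w. \<sigma> w ^ n * szego b w)"
    "wcomp_defined (basis (m, n))" by auto
qed

definition tensor_formula :: "hardy2 \<Rightarrow> hardy2 \<Rightarrow> bool"
  where "tensor_formula f g \<longleftrightarrow> (\<forall>e\<in>fst.multipliers. \<forall>u\<in>fst.multipliers. \<forall>d\<in>snd.multipliers. \<forall>v\<in>snd.multipliers.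
    cinner (tensor e d f) (tensor u v g) = fst.kernel_inner e u * snd.kernel_inner d v * cinner f g)"

text \<open>On the basis, \<open>wcomp\<close> replaces the automorphism \<open>disk_aut (\<theta> a)\<close> by \<open>\<tau>\<close> and the kernel at \<open>\<theta> a\<close> by
  the one at \<open>a\<close>. So the formula is the orthogonality of the spaces \<open>\<tau>\<^sup>n K\<close>.\<close>

lemma tensor_formula_basis: "tensor_formula (basis (m, n)) (basis (m', n'))"
  unfolding tensor_formula_def
proof (intro ballI)
  fix e u d v
  assume e: "e \<in> fst.multipliers" and u: "u \<in> fst.multipliers"
    and d: "d \<in> snd.multipliers" and v: "v \<in> snd.multipliers"
  note e' = fst.multipliersD(1)[OF e] and u' = fst.multipliersD(1)[OF u]
    and d' = snd.multipliersD(1)[OF d] and v' = snd.multipliersD(1)[OF v]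
  have tensor: "tensor e d (basis (m, n))
      = htensor (\<lambda>z. e z * (\<tau> z ^ m * szego a z)) (\<lambda>w. d w * (\<sigma> w ^ n * szego b w))"
    if "bounded_analytic e" "bounded_analytic d" for e d m n
    unfolding tensor_def wcomp_basis
    by (rule hardy2_eqI_hfun) (simp add: hfun_mult_fst hfun_mult_snd hfun_htensor that fst.ba snd.ba)
  have "cinner (basis (m, n)) (basis (m', n')) = (if m = m' then 1 else 0) * (if n = n' then 1 else 0)"
    by (simp only: split_conv kernel_basis_def cinner_htensor kernel_basis_analytic
        hardy_inner_disk_aut_powers fst.base_in_disk snd.base_in_disk)
  moreover have "cinner (tensor e d (basis (m, n))) (tensor u v (basis (m', n')))
      = (if m = m' then fst.kernel_inner e u else 0) * (if n = n' then snd.kernel_inner d v else 0)"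
    unfolding tensor[OF e' d'] tensor[OF u' v']
      fst.hardy_inner_power[OF e u, symmetric] snd.hardy_inner_power[OF d v, symmetric]
    by (intro cinner_htensor fst.ba snd.ba e' u' d' v')
  ultimately show "cinner (tensor e d (basis (m, n))) (tensor u v (basis (m', n')))
      = fst.kernel_inner e u * snd.kernel_inner d v * cinner (basis (m, n)) (basis (m', n'))"
    by (simp del: split_conv)
qed

lemma tensor_linear':
  assumes "wcomp_defined f" "wcomp_defined g" "bounded_analytic e" "bounded_analytic d"
  shows "tensor e d (f + g) = tensor e d f + tensor e d g" "tensor e d (c *\<^sub>C f) = c *\<^sub>C tensor e d f"
  unfolding tensor_def using assms by (simp_all add: wcomp_linear' mult_linear)

lemma wcomp_defined_0: "wcomp_defined 0" and wcomp_0: "wcomp 0 = 0"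
  by (rule wcomp_eqI[of 0]; simp)+

lemma cspan_basis_defined: "f \<in> cspan (range basis) \<Longrightarrow> wcomp_defined f"
proof -
  have "cspan (range basis) \<subseteq> {f. wcomp_defined f}"
    by (intro complex_vector.span_minimal csubspaceI)
      (auto simp: wcomp_linear' wcomp_defined_0 wcomp_basis[unfolded split_conv])
  then show "f \<in> cspan (range basis) \<Longrightarrow> wcomp_defined f"
    by blast
qed

lemma tensor_formula_cspan_basis:
  assumes "f \<in> cspan (range basis)" "g \<in> cspan (range basis)"
  shows "tensor_formula f g"
proof -
  note mults = fst.multipliersD(1) snd.multipliersD(1)
  have zero: "tensor e d 0 = 0" if "bounded_analytic e" "bounded_analytic d" for e d
    unfolding tensor_def wcomp_0 using that
    by (intro hardy2_eqI_hfun) (simp add: hfun_mult_fst hfun_mult_snd)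
  have 1: "cspan (range basis) \<subseteq> {g. wcomp_defined g \<and> tensor_formula (basis k) g}" for k
  proof (intro complex_vector.span_minimal csubspaceI)
    show "range basis \<subseteq> {g. wcomp_defined g \<and> tensor_formula (basis k) g}"
      using wcomp_basis(2) tensor_formula_basis by (cases k) (auto simp del: split_conv)
  qed (auto simp: wcomp_defined_0 wcomp_linear' tensor_formula_def zero mults tensor_linear' cinner_simps
      algebra_simps simp del: split_conv)
  have "cspan (range basis) \<subseteq> {f. wcomp_defined f \<and> tensor_formula f g}"
  proof (intro complex_vector.span_minimal csubspaceI)
    show "range basis \<subseteq> {f. wcomp_defined f \<and> tensor_formula f g}"
    proof
      fix f assume "f \<in> range basis"
      then obtain k where f: "f = basis k"
        by blast
      have "g \<in> {g. wcomp_defined g \<and> tensor_formula (basis k) g}"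
        using 1 assms(2) by (rule subsetD)
      then show "f \<in> {f. wcomp_defined f \<and> tensor_formula f g}"
        using wcomp_basis(2)[of "fst k" "snd k"] unfolding f prod.collapse by blast
    qed
  qed (auto simp: wcomp_defined_0 wcomp_linear' tensor_formula_def zero mults tensor_linear' cinner_simps
      algebra_simps simp del: split_conv)
  with assms(1) show ?thesis
    by blast
qed

lemma tensor_one_one: "tensor (\<lambda>_. 1) (\<lambda>_. 1) f = wcomp f"
  unfolding tensor_def by (rule hardy2_eqI_hfun)
    (simp only: hfun_mult_fst[OF bounded_analytic_const] hfun_mult_snd[OF bounded_analytic_const] mult_1)

lemma norm_wcomp_cspan_basis:
  assumes "f \<in> cspan (range basis)"
  shows "norm (wcomp f) = norm f"
proof (rule norm_eq_of_cinner_eq)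
  show "cinner (wcomp f) (wcomp f) = cinner f f"
    using tensor_formula_cspan_basis[OF assms assms, unfolded tensor_formula_def, rule_format,
        OF fst.one_multiplier fst.one_multiplier snd.one_multiplier snd.one_multiplier]
    by (simp only: tensor_one_one fst.kernel_inner_one[OF bounded_analytic_const]
        snd.kernel_inner_one[OF bounded_analytic_const] mult_1)
qed

text \<open>On the dense span of the basis \<open>wcomp\<close> is isometric; by completeness the images of an
  approximating sequence converge, and their limit has the right values because point evaluations
  are continuous.\<close>

lemma wcomp_everywhere: "wcomp_defined f" "norm (wcomp f) = norm f"
proof -
  have "f \<in> closed_cspan (range basis)"
    using kernel_basis_total[OF fst.base_in_disk snd.base_in_disk] by simp
  then obtain X where X: "\<And>n. X n \<in> cspan (range basis)" "X \<longlonglongrightarrow> f"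
    unfolding closure_sequential by blast
  note defined = cspan_basis_defined[OF X(1)]
  have diff: "dist (wcomp (X m)) (wcomp (X n)) = dist (X m) (X n)" for m n
  proof -
    have "X m - X n \<in> cspan (range basis)"
      by (intro complex_vector.span_diff X)
    moreover have "wcomp (X m - X n) = wcomp (X m) - wcomp (X n)"
      by (rule wcomp_eqI) (simp add: hfun_wcomp' defined algebra_simps)
    ultimately show ?thesis
      using norm_wcomp_cspan_basis unfolding dist_norm by metis
  qed
  have "Cauchy X"
    using X(2) by (rule LIMSEQ_imp_Cauchy)
  then have "Cauchy (\<lambda>n. wcomp (X n))"
    unfolding Cauchy_def diff .
  then obtain g where g: "(\<lambda>n. wcomp (X n)) \<longlonglongrightarrow> g"
    using complete_hardy2 unfolding complete_def by blast
  have g_eq: "hfun g (z, w) = fst.weight z * snd.weight w * hfun f (\<theta> z, \<phi> w)"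
    if zw: "z \<in> \<bbbD>" "w \<in> \<bbbD>" for z w
  proof (rule LIMSEQ_unique)
    show "(\<lambda>n. hfun (wcomp (X n)) (z, w)) \<longlonglongrightarrow> hfun g (z, w)"
      by (intro tendsto_hfun g)
    show "(\<lambda>n. hfun (wcomp (X n)) (z, w)) \<longlonglongrightarrow> fst.weight z * snd.weight w * hfun f (\<theta> z, \<phi> w)"
      unfolding hfun_wcomp'[OF defined zw] by (intro tendsto_mult tendsto_const tendsto_hfun X)
  qed
  then show "wcomp_defined f"
    by (rule wcomp_eqI(2))
  have "wcomp f = g"
    using g_eq by (rule wcomp_eqI(1))
  moreover have "norm g = norm f"
  proof (rule LIMSEQ_unique)
    show "(\<lambda>n. norm (wcomp (X n))) \<longlonglongrightarrow> norm g"
      by (intro tendsto_norm g)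
    show "(\<lambda>n. norm (wcomp (X n))) \<longlonglongrightarrow> norm f"
      unfolding norm_wcomp_cspan_basis[OF X(1)] by (intro tendsto_norm X)
  qed
  ultimately show "norm (wcomp f) = norm f"
    by simp
qed

lemmas hfun_wcomp = hfun_wcomp'[OF wcomp_everywhere(1)]
lemmas wcomp_linear = wcomp_linear'[OF wcomp_everywhere(1) wcomp_everywhere(1)]
lemmas tensor_linear = tensor_linear'[OF wcomp_everywhere(1) wcomp_everywhere(1)]

lemma hfun_tensor:
  "bounded_analytic e \<Longrightarrow> bounded_analytic d \<Longrightarrow> z \<in> \<bbbD> \<Longrightarrow> w \<in> \<bbbD> \<Longrightarrow>
    hfun (tensor e d f) (z, w) = e z * (d w * (fst.weight z * snd.weight w * hfun f (\<theta> z, \<phi> w)))"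
  by (simp add: tensor_def hfun_mult_fst hfun_mult_snd hfun_wcomp)

lemma bounded_linear_tensor:
  assumes "bounded_analytic e" "bounded_analytic d"
  shows "bounded_linear (tensor e d)"
proof -
  have "bounded_linear wcomp"
    by (rule bounded_linear_intro[of _ 1]) (simp_all add: wcomp_linear wcomp_everywhere scaleR_scaleC)
  from bounded_linear_compose[OF bounded_linear_mult_fst[OF assms(1)]
      bounded_linear_compose[OF bounded_linear_mult_snd[OF assms(2)] this]]
  show ?thesis
    by (simp add: tensor_def[abs_def])
qed

theorem cinner_tensor:
  assumes "e \<in> fst.multipliers" "u \<in> fst.multipliers" "d \<in> snd.multipliers" "v \<in> snd.multipliers"
  shows "cinner (tensor e d f) (tensor u v g) = fst.kernel_inner e u * snd.kernel_inner d v * cinner f g"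
proof -
  note cont = bounded_linear.continuous_on[OF bounded_linear_tensor]
  note total = kernel_basis_total[OF fst.base_in_disk snd.base_in_disk]
  let ?P = "\<lambda>f g. cinner (tensor e d f) (tensor u v g) = fst.kernel_inner e u * snd.kernel_inner d v * cinner f g"
  have 1: "?P f g" if "f \<in> cspan (range basis)" for f g
  proof -
    have "closure (cspan (range basis)) \<subseteq> {g. ?P f g}"
    proof (rule closure_minimal)
      show "cspan (range basis) \<subseteq> {g. ?P f g}"
        using tensor_formula_cspan_basis[OF that] assms unfolding tensor_formula_def by blast
      show "closed {g. ?P f g}"
        by (intro closed_Collect_eq continuous_intros cont fst.multipliersD(1) snd.multipliersD(1) assms)
    qed
    then show ?thesis
      using total by auto
  qed
  have "closure (cspan (range basis)) \<subseteq> {f. ?P f g}"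
  proof (rule closure_minimal)
    show "cspan (range basis) \<subseteq> {f. ?P f g}"
      using 1 by blast
    show "closed {f. ?P f g}"
      by (intro closed_Collect_eq continuous_intros cont fst.multipliersD(1) snd.multipliersD(1) assms)
  qed
  then show ?thesis
    using total by auto
qed

lemma hfun_comp_op:
  assumes "z \<in> \<bbbD>" "w \<in> \<bbbD>"
  shows "hfun (comp_op \<theta> \<phi> f) (z, w) = hfun f (\<theta> z, \<phi> w)"
proof -
  have "comp_op \<theta> \<phi> f = mult_fst (\<lambda>z. 1 / fst.weight z) (mult_snd (\<lambda>w. 1 / snd.weight w) (wcomp f))"
    unfolding comp_op_def
    by (rule hardy2_of_eqI) (simp add: hfun_mult_fst[OF fst.weight_analytic(2)]
        hfun_mult_snd[OF snd.weight_analytic(2)] hfun_wcomp fst.weight_nonzero snd.weight_nonzero)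
  then show ?thesis
    using assms by (simp add: hfun_mult_fst[OF fst.weight_analytic(2)]
        hfun_mult_snd[OF snd.weight_analytic(2)] hfun_wcomp fst.weight_nonzero snd.weight_nonzero)
qed

text \<open>\<open>disk_aut a * e = forward e + c \<tau>\<close>, and \<open>\<tau>\<close> is the image of \<open>disk_aut (\<theta> a)\<close> under composition with
  \<open>\<theta>\<close>.\<close>

lemma disk_aut_mult_tensor:
  assumes e: "bounded_analytic e" and d: "bounded_analytic d"
  shows "mult_fst (disk_aut a) (tensor e d f)
      = tensor (fst.forward e) d f + fst.kernel_inner e fst.quotient *\<^sub>C tensor (\<lambda>_. 1) d (mult_fst (disk_aut (\<theta> a)) f)"
    "mult_snd (disk_aut b) (tensor e d f)
      = tensor e (snd.forward d) f + snd.kernel_inner d snd.quotient *\<^sub>C tensor e (\<lambda>_. 1) (mult_snd (disk_aut (\<phi> b)) f)"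
proof -
  have fwd: "bounded_analytic (fst.forward e)" "bounded_analytic (snd.forward d)"
    unfolding fst.forward_def snd.forward_def
    by (intro fst.ba snd.ba e d bounded_analytic_const)+
  show "mult_fst (disk_aut a) (tensor e d f)
      = tensor (fst.forward e) d f + fst.kernel_inner e fst.quotient *\<^sub>C tensor (\<lambda>_. 1) d (mult_fst (disk_aut (\<theta> a)) f)"
  proof (rule hardy2_eqI_hfun)
    fix z w :: complex assume zw: "z \<in> \<bbbD>" "w \<in> \<bbbD>"
    show "hfun (mult_fst (disk_aut a) (tensor e d f)) (z, w) = hfun (tensor (fst.forward e) d f
        + fst.kernel_inner e fst.quotient *\<^sub>C tensor (\<lambda>_. 1) d (mult_fst (disk_aut (\<theta> a)) f)) (z, w)"
      unfolding hfun_simps hfun_mult_fst[OF fst.analytic(3) zw] hfun_tensor[OF e d zw]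
        hfun_tensor[OF fwd(1) d zw] hfun_tensor[OF bounded_analytic_const d zw]
        hfun_mult_fst[OF bounded_analytic_disk_aut[OF fst.base_in_disk] fst.\<theta>_disk[OF zw(1)] snd.\<theta>_disk[OF zw(2)]]
      by (simp add: fst.forward_def algebra_simps)
  qed
  show "mult_snd (disk_aut b) (tensor e d f)
      = tensor e (snd.forward d) f + snd.kernel_inner d snd.quotient *\<^sub>C tensor e (\<lambda>_. 1) (mult_snd (disk_aut (\<phi> b)) f)"
  proof (rule hardy2_eqI_hfun)
    fix z w :: complex assume zw: "z \<in> \<bbbD>" "w \<in> \<bbbD>"
    show "hfun (mult_snd (disk_aut b) (tensor e d f)) (z, w) = hfun (tensor e (snd.forward d) f
        + snd.kernel_inner d snd.quotient *\<^sub>C tensor e (\<lambda>_. 1) (mult_snd (disk_aut (\<phi> b)) f)) (z, w)"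
      unfolding hfun_simps hfun_mult_snd[OF snd.analytic(3) zw] hfun_tensor[OF e d zw]
        hfun_tensor[OF e fwd(2) zw] hfun_tensor[OF e bounded_analytic_const zw]
        hfun_mult_snd[OF bounded_analytic_disk_aut[OF snd.base_in_disk] fst.\<theta>_disk[OF zw(1)] snd.\<theta>_disk[OF zw(2)]]
      by (simp add: snd.forward_def algebra_simps)
  qed
qed

lemma disk_aut_mult_tensor_blaschke:
  assumes e: "bounded_analytic e" and d: "bounded_analytic d"
  shows "mult_fst (disk_aut a) (tensor (blaschke_quotient a e) d f)
      = tensor e d f - fst.kernel_inner e (\<lambda>_. 1) *\<^sub>C tensor (\<lambda>_. 1) d f"
    "mult_snd (disk_aut b) (tensor e (blaschke_quotient b d) f)
      = tensor e d f - snd.kernel_inner d (\<lambda>_. 1) *\<^sub>C tensor e (\<lambda>_. 1) f"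
proof -
  have bq: "bounded_analytic (blaschke_quotient a e)" "bounded_analytic (blaschke_quotient b d)"
    by (intro blaschke_quotient_analytic fst.a_disk snd.a_disk e d)+
  show "mult_fst (disk_aut a) (tensor (blaschke_quotient a e) d f)
      = tensor e d f - fst.kernel_inner e (\<lambda>_. 1) *\<^sub>C tensor (\<lambda>_. 1) d f"
  proof (rule hardy2_eqI_hfun)
    fix z w :: complex assume zw: "z \<in> \<bbbD>" "w \<in> \<bbbD>"
    have "disk_aut a z * (blaschke_quotient a e z * x) = e z * x - e a * x" for x
      using disk_aut_mult_blaschke_quotient[OF fst.a_disk e zw(1)]
      by (simp only: mult.assoc[symmetric] left_diff_distrib[symmetric])
    then show "hfun (mult_fst (disk_aut a) (tensor (blaschke_quotient a e) d f)) (z, w)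
        = hfun (tensor e d f - fst.kernel_inner e (\<lambda>_. 1) *\<^sub>C tensor (\<lambda>_. 1) d f) (z, w)"
      unfolding hfun_simps hfun_mult_fst[OF fst.analytic(3) zw] hfun_tensor[OF e d zw]
        hfun_tensor[OF bq(1) d zw] hfun_tensor[OF bounded_analytic_const d zw]
        fst.kernel_inner_one[OF e] mult_1_left .
  qed
  show "mult_snd (disk_aut b) (tensor e (blaschke_quotient b d) f)
      = tensor e d f - snd.kernel_inner d (\<lambda>_. 1) *\<^sub>C tensor e (\<lambda>_. 1) f"
  proof (rule hardy2_eqI_hfun)
    fix z w :: complex assume zw: "z \<in> \<bbbD>" "w \<in> \<bbbD>"
    have "disk_aut b w * (e z * (blaschke_quotient b d w * x))
        = e z * ((disk_aut b w * blaschke_quotient b d w) * x)" for x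
      by (simp only: mult_ac)
    then have "disk_aut b w * (e z * (blaschke_quotient b d w * x)) = e z * (d w * x) - d b * (e z * x)" for x
      unfolding disk_aut_mult_blaschke_quotient[OF snd.a_disk d zw(2)] by (simp add: algebra_simps)
    then show "hfun (mult_snd (disk_aut b) (tensor e (blaschke_quotient b d) f)) (z, w)
        = hfun (tensor e d f - snd.kernel_inner d (\<lambda>_. 1) *\<^sub>C tensor e (\<lambda>_. 1) f) (z, w)"
      unfolding hfun_simps hfun_mult_snd[OF snd.analytic(3) zw] hfun_tensor[OF e d zw]
        hfun_tensor[OF e bq(2) zw] hfun_tensor[OF e bounded_analytic_const zw]
        snd.kernel_inner_one[OF d] mult_1_left .
  qed
qed

lemma disk_aut_mult_tensor_quotient:
  shows "bounded_analytic d \<Longrightarrow> mult_fst (disk_aut a) (tensor fst.quotient d f)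
      = tensor (\<lambda>_. 1) d (mult_fst (disk_aut (\<theta> a)) f)"
    "bounded_analytic e \<Longrightarrow> mult_snd (disk_aut b) (tensor e snd.quotient f)
      = tensor e (\<lambda>_. 1) (mult_snd (disk_aut (\<phi> b)) f)"
proof -
  assume d: "bounded_analytic d"
  show "mult_fst (disk_aut a) (tensor fst.quotient d f) = tensor (\<lambda>_. 1) d (mult_fst (disk_aut (\<theta> a)) f)"
  proof (rule hardy2_eqI_hfun)
    fix z w :: complex assume zw: "z \<in> \<bbbD>" "w \<in> \<bbbD>"
    show "hfun (mult_fst (disk_aut a) (tensor fst.quotient d f)) (z, w)
        = hfun (tensor (\<lambda>_. 1) d (mult_fst (disk_aut (\<theta> a)) f)) (z, w)"
      unfolding hfun_mult_fst[OF fst.analytic(3) zw] hfun_tensor[OF fst.analytic(4) d zw]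
        hfun_tensor[OF bounded_analytic_const d zw]
        hfun_mult_fst[OF bounded_analytic_disk_aut[OF fst.base_in_disk] fst.\<theta>_disk[OF zw(1)] snd.\<theta>_disk[OF zw(2)]]
        fst.disk_aut_mult_quotient[OF zw(1), symmetric]
      by (simp only: mult_ac mult_1_left mult_1_right)
  qed
next
  assume e: "bounded_analytic e"
  show "mult_snd (disk_aut b) (tensor e snd.quotient f) = tensor e (\<lambda>_. 1) (mult_snd (disk_aut (\<phi> b)) f)"
  proof (rule hardy2_eqI_hfun)
    fix z w :: complex assume zw: "z \<in> \<bbbD>" "w \<in> \<bbbD>"
    show "hfun (mult_snd (disk_aut b) (tensor e snd.quotient f)) (z, w)
        = hfun (tensor e (\<lambda>_. 1) (mult_snd (disk_aut (\<phi> b)) f)) (z, w)"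
      unfolding hfun_mult_snd[OF snd.analytic(3) zw] hfun_tensor[OF e snd.analytic(4) zw]
        hfun_tensor[OF e bounded_analytic_const zw]
        hfun_mult_snd[OF bounded_analytic_disk_aut[OF snd.base_in_disk] fst.\<theta>_disk[OF zw(1)] snd.\<theta>_disk[OF zw(2)]]
        snd.disk_aut_mult_quotient[OF zw(2), symmetric]
      by (simp only: mult_ac mult_1_left mult_1_right)
  qed
qed

text \<open>The left side contains the tensors since it is invariant under bounded multipliers. Conversely
  the closed span of the tensors is invariant under \<open>disk_aut a\<close> and \<open>disk_aut b\<close>, hence a submodule,
  and it contains each \<open>f(\<theta>(z), \<phi>(w))\<close>: this is the tensor of \<open>f'\<close> divided by Szego kernels,
  where \<open>f'\<close> is \<open>f\<close> times Szego kernels.\<close>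

theorem submodule_generated_eq_tensors:
  assumes M: "submodule M"
  shows "submodule_generated (comp_op \<theta> \<phi> ` M)
    = closed_cspan {tensor e d f | e d f. e \<in> fst.multipliers \<and> d \<in> snd.multipliers \<and> f \<in> M}"
    (is "?N = closed_cspan ?G")
proof
  note N = submodule_submodule_generated[of "comp_op \<theta> \<phi> ` M"]
  have "tensor e d f \<in> ?N" if ed: "e \<in> fst.multipliers" "d \<in> snd.multipliers" and f: "f \<in> M" for e d f
  proof -
    have "wcomp f = mult_fst fst.weight (mult_snd snd.weight (comp_op \<theta> \<phi> f))"
      by (rule hardy2_eqI_hfun) (simp add: hfun_wcomp hfun_mult_fst hfun_mult_snd fst.weight_analytic
          snd.weight_analytic hfun_comp_op)
    moreover have "comp_op \<theta> \<phi> f \<in> ?N"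
      using f by (intro submodule_generated_superset imageI)
    ultimately show ?thesis
      unfolding tensor_def
      by (simp only:) (intro submoduleD(3,4)[OF N] fst.multipliersD(1)[OF ed(1)] snd.multipliersD(1)[OF ed(2)]
          fst.weight_analytic(1) snd.weight_analytic(1))
  qed
  then show "closed_cspan ?G \<subseteq> ?N"
    using submoduleD(1,2)[OF N] by (intro closed_cspan_minimal) auto
  have L: "closed (closed_cspan ?G)" "csubspace (closed_cspan ?G)"
    by (simp_all add: csubspace_closed_cspan)
  have in_L: "tensor e d f \<in> closed_cspan ?G" if "e \<in> fst.multipliers" "d \<in> snd.multipliers" "f \<in> M" for e d f
    using that by (intro closed_cspan_superset) blast
  have "mult_fst (disk_aut a) x \<in> closed_cspan ?G" if "x \<in> closed_cspan ?G" for x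
  proof (rule closed_cspan_map_into[OF bounded_linear_mult_fst _ L _ that])
    fix x assume "x \<in> ?G"
    then obtain e d f where *: "e \<in> fst.multipliers" "d \<in> snd.multipliers" "f \<in> M" and x: "x = tensor e d f"
      by blast
    show "mult_fst (disk_aut a) x \<in> closed_cspan ?G"
      unfolding x disk_aut_mult_tensor(1)[OF fst.multipliersD(1)[OF *(1)] snd.multipliersD(1)[OF *(2)]]
      by (intro csubspace_add csubspace_scale L in_L fst.forward_multiplier fst.one_multiplier *
          submoduleD(3)[OF M] bounded_analytic_disk_aut fst.base_in_disk)
  qed (simp_all add: fst.analytic(3) mult_linear)
  then have "mult_fst (\<lambda>z. z) x \<in> closed_cspan ?G" if "x \<in> closed_cspan ?G" for x
    using mult_fst_disk_aut_invariant[OF L fst.a_disk _ that] by blast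
  moreover have "mult_snd (disk_aut b) x \<in> closed_cspan ?G" if "x \<in> closed_cspan ?G" for x
  proof (rule closed_cspan_map_into[OF bounded_linear_mult_snd _ L _ that])
    fix x assume "x \<in> ?G"
    then obtain e d f where *: "e \<in> fst.multipliers" "d \<in> snd.multipliers" "f \<in> M" and x: "x = tensor e d f"
      by blast
    show "mult_snd (disk_aut b) x \<in> closed_cspan ?G"
      unfolding x disk_aut_mult_tensor(2)[OF fst.multipliersD(1)[OF *(1)] snd.multipliersD(1)[OF *(2)]]
      by (intro csubspace_add csubspace_scale L in_L snd.forward_multiplier snd.one_multiplier *
          submoduleD(4)[OF M] bounded_analytic_disk_aut snd.base_in_disk)
  qed (simp_all add: snd.analytic(3) mult_linear)
  then have "mult_snd (\<lambda>w. w) x \<in> closed_cspan ?G" if "x \<in> closed_cspan ?G" for x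
    using mult_snd_disk_aut_invariant[OF L snd.a_disk _ that] by blast
  ultimately have sub: "submodule (closed_cspan ?G)"
    unfolding submodule_def using L by blast
  have "comp_op \<theta> \<phi> f \<in> closed_cspan ?G" if f: "f \<in> M" for f
  proof -
    define f' where "f' = mult_fst (szego (\<theta> a)) (mult_snd (szego (\<phi> b)) f)"
    have f': "f' \<in> M"
      unfolding f'_def by (intro submoduleD(3,4)[OF M] szego_analytic fst.base_in_disk snd.base_in_disk f)
    have "comp_op \<theta> \<phi> f = mult_fst (\<lambda>z. 1 / szego a z) (mult_snd (\<lambda>w. 1 / szego b w) (tensor (\<lambda>_. 1) (\<lambda>_. 1) f'))"
    proof (rule hardy2_eqI_hfun)
      fix z w :: complex assume zw: "z \<in> \<bbbD>" "w \<in> \<bbbD>"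
      have f'_eq: "hfun f' (\<theta> z, \<phi> w) = szego (\<theta> a) (\<theta> z) * (szego (\<phi> b) (\<phi> w) * hfun f (\<theta> z, \<phi> w))"
        using fst.\<theta>_disk[OF zw(1)] snd.\<theta>_disk[OF zw(2)] unfolding f'_def
        by (simp only: hfun_mult_fst hfun_mult_snd szego_analytic fst.base_in_disk snd.base_in_disk)
      have nz: "szego a z \<noteq> 0" "szego b w \<noteq> 0"
        using szego_nonzero fst.a_disk snd.a_disk zw by blast+
      have key: "fst.weight z * snd.weight w * (szego (\<theta> a) (\<theta> z) * (szego (\<phi> b) (\<phi> w) * hfun f (\<theta> z, \<phi> w)))
          = szego a z * (szego b w * hfun f (\<theta> z, \<phi> w))"
        by (simp only: fst.weight_mult_szego[OF zw(1), symmetric] snd.weight_mult_szego[OF zw(2), symmetric] mult_ac)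
      show "hfun (comp_op \<theta> \<phi> f) (z, w)
          = hfun (mult_fst (\<lambda>z. 1 / szego a z) (mult_snd (\<lambda>w. 1 / szego b w) (tensor (\<lambda>_. 1) (\<lambda>_. 1) f'))) (z, w)"
        unfolding tensor_one_one hfun_comp_op[OF zw] hfun_mult_fst[OF fst.inverse_szego_analytic zw]
          hfun_mult_snd[OF snd.inverse_szego_analytic zw] hfun_wcomp[OF zw] f'_eq key
        by (simp add: nz)
    qed
    then show ?thesis
      by (simp only:) (intro submoduleD(3,4)[OF sub] in_L fst.one_multiplier snd.one_multiplier f'
          fst.inverse_szego_analytic snd.inverse_szego_analytic)
  qed
  then show "?N \<subseteq> closed_cspan ?G"
    by (intro submodule_generated_minimal sub) auto
qed

text \<open>The submodule generated by the composed functions is the tensor product of the two model spaces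
  with \<open>M\<close>, and the four multiplication operators fit into \<open>tensor_bishift\<close>.\<close>

theorem hs_norm_sq_eq:
  assumes M: "submodule M"
  defines "N \<equiv> submodule_generated (comp_op \<theta> \<phi> ` M)"
  shows "hs_norm_sq N (self_commutator_product N (mult_fst (disk_aut a)) (mult_snd (disk_aut b)))
      = hs_norm_sq M (self_commutator_product M (mult_fst (disk_aut (\<theta> a))) (mult_snd (disk_aut (\<phi> b))))"
    "hs_norm_sq N (cross_commutator N (mult_fst (disk_aut a)) (mult_snd (disk_aut b)))
      = hs_norm_sq M (cross_commutator M (mult_fst (disk_aut (\<theta> a))) (mult_snd (disk_aut (\<phi> b))))"
proof -
  have N: "submodule N"
    unfolding N_def by (rule submodule_submodule_generated)
  have op: "bounded_operator_on L (mult_fst (disk_aut c))" "bounded_operator_on L (mult_snd (disk_aut c))"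
    if "submodule L" "c \<in> \<bbbD>" for L c
    by (rule bounded_operator_onI[where K = 1];
        simp add: submoduleD(3,4)[OF that(1)] mult_linear bounded_analytic_disk_aut[OF that(2)]
          inner_function_norm_mult_fst inner_function_norm_mult_snd inner_function_disk_aut[OF that(2)])+
  note isometry = inner_function_cinner_mult[OF inner_function_disk_aut]
  note complete = submoduleD(1)[THEN closed_imp_complete_hardy2]
  have N_eq: "N = closed_cspan {tensor e d f | e d f. e \<in> fst.multipliers \<and> d \<in> snd.multipliers \<and> f \<in> M}"
    unfolding N_def by (rule submodule_generated_eq_tensors[OF M])
  note shared = M N complete submoduleD(2) N_eq op isometry bounded_analytic_const
  interpret first: tensor_shift M N fst.multipliers snd.multipliers fst.kernel_inner snd.kernel_inner tensor
    "mult_fst (disk_aut a)" "mult_fst (disk_aut (\<theta> a))" fst.forward "blaschke_quotient a" "\<lambda>_. 1" fst.quotient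
    by unfold_locales
      (rule fst.kernel_inner_one[OF bounded_analytic_const] shared tensor_linear cinner_tensor
        disk_aut_mult_tensor disk_aut_mult_tensor_blaschke disk_aut_mult_tensor_quotient
        fst.a_disk fst.base_in_disk fst.one_multiplier fst.quotient_multiplier fst.kernel_inner_quotient_quotient
        fst.forward_multiplier fst.backward_multiplier fst.kernel_inner_forward fst.kernel_inner_commute
        fst.multipliersD(1) snd.multipliersD(1) | assumption)+
  have N_eq': "N = closed_cspan {tensor e d f | d e f. d \<in> snd.multipliers \<and> e \<in> fst.multipliers \<and> f \<in> M}"
    unfolding N_eq by (rule arg_cong[of _ _ closed_cspan]) blast
  have cinner_tensor': "cinner (tensor e d f) (tensor u v g) = snd.kernel_inner d v * fst.kernel_inner e u * cinner f g"
    if "d \<in> snd.multipliers" "v \<in> snd.multipliers" "e \<in> fst.multipliers" "u \<in> fst.multipliers" for e d u v f g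
    using that by (simp add: cinner_tensor)
  interpret second: tensor_shift M N snd.multipliers fst.multipliers snd.kernel_inner fst.kernel_inner "\<lambda>d e. tensor e d"
    "mult_snd (disk_aut b)" "mult_snd (disk_aut (\<phi> b))" snd.forward "blaschke_quotient b" "\<lambda>_. 1" snd.quotient
    by unfold_locales
      (rule snd.kernel_inner_one[OF bounded_analytic_const] N_eq' shared tensor_linear cinner_tensor'
        disk_aut_mult_tensor disk_aut_mult_tensor_blaschke disk_aut_mult_tensor_quotient
        snd.a_disk snd.base_in_disk snd.one_multiplier snd.quotient_multiplier snd.kernel_inner_quotient_quotient
        snd.forward_multiplier snd.backward_multiplier snd.kernel_inner_forward snd.kernel_inner_commute
        fst.multipliersD(1) snd.multipliersD(1) | assumption)+
  interpret tensor_bishift M N fst.multipliers snd.multipliers fst.kernel_inner snd.kernel_inner tensor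
    "mult_fst (disk_aut a)" "mult_fst (disk_aut (\<theta> a))" fst.forward "blaschke_quotient a" "\<lambda>_. 1" fst.quotient
    "mult_snd (disk_aut b)" "mult_snd (disk_aut (\<phi> b))" snd.forward "blaschke_quotient b" "\<lambda>_. 1" snd.quotient
    ..
  show "hs_norm_sq N (self_commutator_product N (mult_fst (disk_aut a)) (mult_snd (disk_aut b)))
      = hs_norm_sq M (self_commutator_product M (mult_fst (disk_aut (\<theta> a))) (mult_snd (disk_aut (\<phi> b))))"
    unfolding self_commutator_product_def by (rule hs_norm_sq_defect_product)
  show "hs_norm_sq N (cross_commutator N (mult_fst (disk_aut a)) (mult_snd (disk_aut b)))
      = hs_norm_sq M (cross_commutator M (mult_fst (disk_aut (\<theta> a))) (mult_snd (disk_aut (\<phi> b))))"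
    unfolding cross_commutator_def by (rule hs_norm_sq_cross_commutator)
qed

end

section \<open>Invariance of the numerical invariants\<close>

theorem corollary4p1:
  fixes \<theta> \<phi> :: "complex \<Rightarrow> complex" and M :: "hardy2 set"
  assumes "inner_function \<theta>" and "\<not> \<theta> constant_on \<bbbD>"
    and "inner_function \<phi>" and "\<not> \<phi> constant_on \<bbbD>"
    and "hilbert_schmidt_submodule M"
  shows "\<forall>(a, b)\<in>\<bbbD> \<times> \<bbbD>.
    Sigma0 (submodule_generated (comp_op \<theta> \<phi> ` M)) (a, b) = Sigma0 M (\<theta> a, \<phi> b) \<and>
    Sigma1 (submodule_generated (comp_op \<theta> \<phi> ` M)) (a, b) = Sigma1 M (\<theta> a, \<phi> b)"
proof (intro ballI, clarify)
  fix a b :: complex assume "a \<in> \<bbbD>" "b \<in> \<bbbD>"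
  then interpret inner_pair \<theta> a \<phi> b
    using assms inner_function_maps_disk unfolding inner_pair_def inner_at_def by blast
  have "submodule M"
    using assms(5) by (simp add: hilbert_schmidt_submodule_def)
  from hs_norm_sq_eq[OF this]
  show "Sigma0 (submodule_generated (comp_op \<theta> \<phi> ` M)) (a, b) = Sigma0 M (\<theta> a, \<phi> b) \<and>
      Sigma1 (submodule_generated (comp_op \<theta> \<phi> ` M)) (a, b) = Sigma1 M (\<theta> a, \<phi> b)"
    by (simp add: Sigma0_def Sigma1_def)
qed

end
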